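(* There is an absolute constant $C>0$ such that the following holds. Consider a finite-horizon Markov decision process with (possibly non-compact) state space $\mathsf S\subset\mathbb R^{d}$, compact action space $\mathsf A\subset\mathbb R^{d_{\mathsf A}}$, horizon $H\ge1$, one-step transition densities $p_h^a(y|x)$ ($h=1,\dots,H$), rewards $R_h$ ($0\le h\le H-1$) and terminal reward $F$. Assume that for every compact $\mathcal D\subset\mathsf S$ (of positive Lebesgue measure) there are constants $\delta_{\mathcal D}>0$, $\Lambda>0$, $L_{\mathcal D}>0$ and a function $\mathcal L_{\mathcal D}\ge0$ on $\mathbb R^d$ such that $$0<\delta_{\mathcal D}\le p_h^a(z|x)\le\Lambda,\qquad |p_h^{a_1}(y|x_1)-p_h^{a_2}(y|x_2)|\le\mathcal L_{\mathcal D}(y)\bigl(|x_1-x_2|+\rho_{\mathsf A}(a_1,a_2)\bigr)$$ for all $x,z,x_1,x_2\in\mathcal D$, $y\in\mathbb R^d$, $a,a_1,a_2\in\mathsf A$, $h=1,\dots,H$, where $$\|\mathcal L_{\mathcal D}\|_{L^\infty(\mathcal D)}+\frac1{\mathrm{Leb}(\mathcal D)}\|\mathcal L_{\mathcal D}\|_{L^1(\mathbb R^d\setminus\mathcal D)}\le L_{\mathcal D},$$ and that for some $G>0$, $\max\{|R_h(s,a)|,|F(s)|\}\le G$ for all $(s,a)\in\mathsf S\times\mathsf A$, $0\le h\le H-1$. Let $\mathcal D\subset\mathsf S$ be compact with positive Lebesgue measure, let $x_0\in\mathcal D$, and let $\overline V_0^{\mathcal D}(x_0)$ be the output of the weighted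 mesh algorithm with $N$ trajectories applied to the MDP reflected in $\mathcal D$. Then there is $N_0$ such that for all $N>N_0$ $$\mathbb E\bigl[|\overline V_0^{\mathcal D}(x_0)-V_0^\star(x_0)|\bigr]\le C\,\frac{H^2G}{\sqrt N}\left(\frac{L_{\mathcal D}\,\mathrm{DI}(\mathcal D\times\mathsf A)+L_{\mathcal D}\,\mathrm{diam}(\mathcal D)\,\mathrm{diam}(\mathsf A)+\Lambda}{\delta_{\mathcal D}}+\frac{\Lambda^2}{\delta_{\mathcal D}^2}\right)+C\,HG\sum_{l=0}^H\sup_{\boldsymbol\pi\in\Pi}\mathbb P_{\boldsymbol\pi}\bigl(S_l^{(x_0,0)}\notin\mathcal D\bigr).$$
   Context: **MDP.** $|\cdot|$ is the Euclidean norm on $\mathbb R^d$, $\rho_{\mathsf A}$ the metric on $\mathsf A$ (diameters are with respect to these). For $h=1,\dots,H$, $P_h(\cdot|x,a)$ is a probability kernel from $\mathsf S\times\mathsf A$ to $\mathsf S$ with Lebesgue density $y\mapsto p_h^a(y|x)$ (extended by zero outside $\mathsf S$). A policy is $\boldsymbol\pi=(\pi_0,\dots,\pi_{H-1})$ with measurable $\pi_t:\mathsf S\to\mathcal P(\mathsf A)$ (probability measures on $\mathsf A$); $\Pi$ is the set of policies. Under $\boldsymbol\pi$, $A_t\sim\pi_t(S_t)$, $S_{t+1}\sim P_{t+1}(\cdot|S_t,A_t)$; $S_l^{(x_0,0)}$ is the state at time $l$ of this controlled chain started at $S_0=x_0$, and $\mathbb P_{\boldsymbol\pi}$ its law. $V_h^\star(x)=\sup_{\boldsymbol\pi\in\Pi}\mathbb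 E_{\boldsymbol\pi}\bigl[\sum_{t=h}^{H-1}R_t(S_t,A_t)+F(S_H)\,|\,S_h=x\bigr]$. **Reflected MDP.** For compact $\mathcal D\subset\mathsf S$ of positive Lebesgue measure $\mathrm{Leb}(\mathcal D)$, the MDP reflected in $\mathcal D$ has state space $\mathcal D$, the same $\mathsf A$, $H$, $R_h$, $F$ (restricted to $\mathcal D$), and transitions: from $x\in\mathcal D$ under action $a$ draw $Y\sim P_h(\cdot|x,a)$; the next state is $Y$ if $Y\in\mathcal D$, and otherwise an independent uniform point of $\mathcal D$. Its transition densities are $$p_h^{a,\mathcal D}(y|x)=p_h^a(y|x)+\frac1{\mathrm{Leb}(\mathcal D)}\int_{\mathbb R^d\setminus\mathcal D}p_h^a(z|x)\,dz,\qquad x,y\in\mathcal D.$$ Standing convention: the data are regular enough (e.g. $R_h$, $F$ continuous) that all functions involved are measurable and the Bellman equations hold for the original and for the reflected MDP (value function at time $h$ equals the supremum over $a\in\mathsf A$ of $R_h(x,a)$ plus the expected value function at time $h+1$ after one transition from $x$ under $a$, with terminal value $F$). **Weighted mesh algorithm for the reflected MDP.** Fix controls $b_0,\dots,b_{H-1}\in\mathsf A$. Simulate independently for $n=1,\dots,N$ ($N\ge2$) chains with $S_0^{(n)}=x_0$ and $S_{h+1}^{(n)}$ drawn from the density $p_{h+1}^{b_h,\mathcal D}(\cdot|S_h^{(n)})$. With $0/0=0$ let $$w_{h,n,N}(x,a)=\frac{p_{h+1}^{a,\mathcal D}(S_{h+1}^{(n)}|x)}{\sum_{k\ne n}p_{h+1}^{b_h,\mathcal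 D}(S_{h+1}^{(n)}|S_h^{(k)})}\Big/\sum_{n'=1}^N\frac{p_{h+1}^{a,\mathcal D}(S_{h+1}^{(n')}|x)}{\sum_{k'\ne n'}p_{h+1}^{b_h,\mathcal D}(S_{h+1}^{(n')}|S_h^{(k')})}.$$ Put $\overline V_H^{\mathcal D}(S_H^{(n)})=F(S_H^{(n)})$ and, for $h=H-1,\dots,0$, $r=1,\dots,N$, $$\overline V_h^{\mathcal D}(S_h^{(r)})=\sup_{a\in\mathsf A}\Bigl(R_h(S_h^{(r)},a)+\sum_{n=1}^N\overline V_{h+1}^{\mathcal D}(S_{h+1}^{(n)})\,w_{h,n,N}(S_h^{(r)},a)\Bigr).$$ The output is $\overline V_0^{\mathcal D}(x_0)$; the expectation in the claim is over these simulations. **Dudley integral.** For a metric space $(\mathsf X,\rho)$, $\mathcal N(\mathsf X,\rho,u)$ is the smallest number of $\rho$-balls of radius $u$ covering $\mathsf X$, and $\mathrm{DI}(\mathsf X)=\int_0^{\mathrm{diam}(\mathsf X)}\sqrt{\log\mathcal N(\mathsf X,\rho,u)}\,du$. On $\mathcal D\times\mathsf A$ the metric is $\rho((x,a),(x',a'))=|x-x'|+\rho_{\mathsf A}(a,a')$. *)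

theory Defs
  imports "HOL-Probability.Probability"
begin

text \<open>
  Vectors of \<open>\<real>\<^sup>d\<close> are extensional functions on \<open>{..<d}\<close>, so that one statement can quantify over all
  dimensions; a type-indexed dimension would let an ``absolute'' constant depend on the dimension.
\<close>

type_synonym vec = "nat \<Rightarrow> real"

abbreviation euclid_top :: "nat \<Rightarrow> vec topology" where
  "euclid_top d \<equiv> product_topology (\<lambda>_. euclideanreal) {..<d}"

abbreviation leb :: "nat \<Rightarrow> vec measure" where
  "leb d \<equiv> Pi\<^sub>M {..<d} (\<lambda>_. lborel)"

definition edist :: "nat \<Rightarrow> vec \<Rightarrow> vec \<Rightarrow> real" where
  "edist d x y = L2_set (\<lambda>i. x i - y i) {..<d}"


subsection \<open>Metric entropy\<close>

text \<open>Extended values are used throughout, so that an infinite Dudley integral is really infinite.\<close>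

definition mdiam :: "'a set \<Rightarrow> ('a \<Rightarrow> 'a \<Rightarrow> real) \<Rightarrow> ennreal" where
  "mdiam X \<rho> = (SUP x\<in>X. SUP y\<in>X. ennreal (\<rho> x y))"

definition covering_number :: "'a set \<Rightarrow> ('a \<Rightarrow> 'a \<Rightarrow> real) \<Rightarrow> real \<Rightarrow> enat" where
  "covering_number X \<rho> u =
     (INF C\<in>{C. finite C \<and> C \<subseteq> X \<and> X \<subseteq> (\<Union>c\<in>C. Metric_space.mball X \<rho> c u)}. enat (card C))"

definition dudley :: "'a set \<Rightarrow> ('a \<Rightarrow> 'a \<Rightarrow> real) \<Rightarrow> ennreal" where
  "dudley X \<rho> =
     (\<integral>\<^sup>+u\<in>{u. 0 < u \<and> ennreal u \<le> mdiam X \<rho>}.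
        (case covering_number X \<rho> u of enat n \<Rightarrow> ennreal (sqrt (ln (real n))) | \<infinity> \<Rightarrow> \<infinity>) \<partial>lborel)"


subsection \<open>Markov decision processes\<close>

text \<open>\<open>dens M h a x y\<close> is the transition density \<open>p\<^sub>h\<^sup>a(y|x)\<close>, for \<open>1 \<le> h \<le> horizon M\<close>.\<close>

record mdp =
  sdim :: nat
  adim :: nat
  states :: "vec set"
  actions :: "vec set"
  adist :: "vec \<Rightarrow> vec \<Rightarrow> real"
  horizon :: nat
  dens :: "nat \<Rightarrow> vec \<Rightarrow> vec \<Rightarrow> vec \<Rightarrow> real"
  reward :: "nat \<Rightarrow> vec \<Rightarrow> vec \<Rightarrow> real"
  terminal :: "vec \<Rightarrow> real"

definition stateM :: "mdp \<Rightarrow> vec measure" where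
  "stateM M = restrict_space (leb (sdim M)) (states M)"

definition actionM :: "mdp \<Rightarrow> vec measure" where
  "actionM M = restrict_space (Pi\<^sub>M {..<adim M} (\<lambda>_. borel)) (actions M)"

text \<open>
  The metric on the action space need not be the Euclidean one, but it induces the same topology
  (hence the same Borel sets).
\<close>

definition is_mdp :: "mdp \<Rightarrow> bool" where
  "is_mdp M \<longleftrightarrow>
     1 \<le> sdim M \<and> 1 \<le> adim M \<and> 1 \<le> horizon M \<and>
     states M \<in> sets (leb (sdim M)) \<and>
     compactin (euclid_top (adim M)) (actions M) \<and>
     Metric_space (actions M) (adist M) \<and>
     Metric_space.mtopology (actions M) (adist M) = subtopology (euclid_top (adim M)) (actions M) \<and>
     (\<forall>h\<in>{1..horizon M}.
        (\<lambda>(x, a, y). dens M h a x y)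
          \<in> borel_measurable (stateM M \<Otimes>\<^sub>M actionM M \<Otimes>\<^sub>M leb (sdim M)) \<and>
        (\<forall>x\<in>states M. \<forall>a\<in>actions M.
           (\<forall>y\<in>space (leb (sdim M)). 0 \<le> dens M h a x y) \<and>
           (\<forall>y\<in>space (leb (sdim M)) - states M. dens M h a x y = 0) \<and>
           (\<integral>\<^sup>+y. ennreal (dens M h a x y) \<partial>leb (sdim M)) = 1))"

definition trans_kernel :: "mdp \<Rightarrow> nat \<Rightarrow> vec \<Rightarrow> vec \<Rightarrow> vec measure" where
  "trans_kernel M h x a = density (stateM M) (\<lambda>y. ennreal (dens M h a x y))"

definition policies :: "mdp \<Rightarrow> (nat \<Rightarrow> vec \<Rightarrow> vec measure) set" where
  "policies M = {\<pi>. \<forall>t<horizon M. \<pi> t \<in> stateM M \<rightarrow>\<^sub>M prob_algebra (actionM M)}"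

text \<open>
  \<open>path_law M \<pi> h x n\<close> is the joint law of the states \<open>S\<^sub>h, \<dots>, S\<^sub>h\<^sub>+\<^sub>n\<close> and the actions
  \<open>A\<^sub>h, \<dots>, A\<^sub>h\<^sub>+\<^sub>n\<^sub>-\<^sub>1\<close> of the chain controlled by \<open>\<pi>\<close> and started at time \<open>h\<close> in \<open>x\<close>.
\<close>

definition pathM :: "mdp \<Rightarrow> nat \<Rightarrow> nat \<Rightarrow> ((nat \<Rightarrow> vec) \<times> (nat \<Rightarrow> vec)) measure" where
  "pathM M h n = Pi\<^sub>M {h..h + n} (\<lambda>_. stateM M) \<Otimes>\<^sub>M Pi\<^sub>M {h..<h + n} (\<lambda>_. actionM M)"

primrec path_law ::
  "mdp \<Rightarrow> (nat \<Rightarrow> vec \<Rightarrow> vec measure) \<Rightarrow> nat \<Rightarrow> vec \<Rightarrow> nat \<Rightarrow> ((nat \<Rightarrow> vec) \<times> (nat \<Rightarrow> vec)) measure"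
where
  "path_law M \<pi> h x 0 = return (pathM M h 0) ((\<lambda>i\<in>{h}. x), (\<lambda>i. undefined))"
| "path_law M \<pi> h x (Suc n) =
     path_law M \<pi> h x n \<bind> (\<lambda>(s, a).
       \<pi> (h + n) (s (h + n)) \<bind> (\<lambda>u.
         trans_kernel M (Suc (h + n)) (s (h + n)) u \<bind> (\<lambda>y.
           return (pathM M h (Suc n)) (s(Suc (h + n) := y), a(h + n := u)))))"

definition value_fun :: "mdp \<Rightarrow> nat \<Rightarrow> vec \<Rightarrow> real" where
  "value_fun M h x =
     (SUP \<pi>\<in>policies M.
        \<integral>(s, a). (\<Sum>t\<in>{h..<horizon M}. reward M t (s t) (a t)) + terminal M (s (horizon M))
          \<partial>path_law M \<pi> h x (horizon M - h))"

definition exit_prob :: "mdp \<Rightarrow> vec set \<Rightarrow> (nat \<Rightarrow> vec \<Rightarrow> vec measure) \<Rightarrow> vec \<Rightarrow> nat \<Rightarrow> ennreal" where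
  "exit_prob M D \<pi> x l =
     (let P = path_law M \<pi> 0 x (horizon M) in emeasure P {(s, a) \<in> space P. s l \<notin> D})"

text \<open>Standing convention: everything is measurable and the Bellman equations hold.\<close>

definition regular_mdp :: "mdp \<Rightarrow> bool" where
  "regular_mdp M \<longleftrightarrow>
     (\<forall>h<horizon M. (\<lambda>(x, a). reward M h x a) \<in> borel_measurable (stateM M \<Otimes>\<^sub>M actionM M)) \<and>
     terminal M \<in> borel_measurable (stateM M) \<and>
     (\<forall>h\<le>horizon M. value_fun M h \<in> borel_measurable (stateM M)) \<and>
     (\<forall>x\<in>states M. value_fun M (horizon M) x = terminal M x) \<and>
     (\<forall>h<horizon M. \<forall>x\<in>states M.
        value_fun M h x =
          (SUP a\<in>actions M. reward M h x a + (\<integral>y. value_fun M (Suc h) y \<partial>trans_kernel M (Suc h) x a)))"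


subsection \<open>Reflection in a compact set\<close>

definition compact_pos :: "mdp \<Rightarrow> vec set \<Rightarrow> bool" where
  "compact_pos M D \<longleftrightarrow>
     D \<subseteq> states M \<and> compactin (euclid_top (sdim M)) D \<and> 0 < emeasure (leb (sdim M)) D"

definition reflected :: "mdp \<Rightarrow> vec set \<Rightarrow> mdp" where
  "reflected M D =
     M\<lparr>states := D,
       dens := (\<lambda>h a x y.
         if y \<in> D
         then dens M h a x y +
           1 / measure (leb (sdim M)) D *
             (LINT z:space (leb (sdim M)) - D|leb (sdim M). dens M h a x z)
         else 0)\<rparr>"

definition local_bounds ::
  "mdp \<Rightarrow> vec set \<Rightarrow> real \<Rightarrow> real \<Rightarrow> real \<Rightarrow> (vec \<Rightarrow> real) \<Rightarrow> bool"
where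
  "local_bounds M D \<delta> \<Lambda> L Lf \<longleftrightarrow>
     0 < \<delta> \<and> 0 < \<Lambda> \<and> 0 < L \<and>
     Lf \<in> borel_measurable (leb (sdim M)) \<and>
     (\<forall>y\<in>space (leb (sdim M)). 0 \<le> Lf y) \<and>
     (\<forall>h\<in>{1..horizon M}. \<forall>a\<in>actions M. \<forall>x\<in>D. \<forall>z\<in>D.
        \<delta> \<le> dens M h a x z \<and> dens M h a x z \<le> \<Lambda>) \<and>
     (\<forall>h\<in>{1..horizon M}. \<forall>a1\<in>actions M. \<forall>a2\<in>actions M. \<forall>x1\<in>D. \<forall>x2\<in>D.
        \<forall>y\<in>space (leb (sdim M)).
          \<bar>dens M h a1 x1 y - dens M h a2 x2 y\<bar> \<le> Lf y * (edist (sdim M) x1 x2 + adist M a1 a2)) \<and>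
     esssup (restrict_space (leb (sdim M)) D) (\<lambda>y. ennreal (Lf y)) +
       (\<integral>\<^sup>+y\<in>space (leb (sdim M)) - D. ennreal (Lf y) \<partial>leb (sdim M)) / emeasure (leb (sdim M)) D
       \<le> ennreal L"

definition sa_dist :: "mdp \<Rightarrow> vec \<times> vec \<Rightarrow> vec \<times> vec \<Rightarrow> real" where
  "sa_dist M = (\<lambda>(x, a) (x', a'). edist (sdim M) x x' + adist M a a')"


subsection \<open>The weighted mesh algorithm\<close>

text \<open>
  A sample \<open>\<omega>\<close> consists of \<open>N\<close> trajectories, with \<open>\<omega> n h = S\<^sub>h\<^sup>(\<^sup>n\<^sup>)\<close> for \<open>n \<in> {1..N}\<close>. The algorithm is
  defined for an arbitrary MDP; it is meant to be run on \<open>reflected M D\<close>.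
\<close>

definition mesh_law :: "mdp \<Rightarrow> (nat \<Rightarrow> vec) \<Rightarrow> vec \<Rightarrow> nat \<Rightarrow> (nat \<Rightarrow> nat \<Rightarrow> vec) measure" where
  "mesh_law M b x0 N =
     Pi\<^sub>M {1..N} (\<lambda>_. distr (path_law M (\<lambda>t _. return (actionM M) (b t)) 0 x0 (horizon M))
                        (Pi\<^sub>M {0..horizon M} (\<lambda>_. stateM M)) fst)"

definition mesh_ratio ::
  "mdp \<Rightarrow> (nat \<Rightarrow> vec) \<Rightarrow> nat \<Rightarrow> (nat \<Rightarrow> nat \<Rightarrow> vec) \<Rightarrow> nat \<Rightarrow> nat \<Rightarrow> vec \<Rightarrow> vec \<Rightarrow> real"
where
  "mesh_ratio M b N \<omega> h n x a =
     dens M (Suc h) a x (\<omega> n (Suc h)) /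
       (\<Sum>k\<in>{1..N} - {n}. dens M (Suc h) (b h) (\<omega> k h) (\<omega> n (Suc h)))"

definition mesh_weight ::
  "mdp \<Rightarrow> (nat \<Rightarrow> vec) \<Rightarrow> nat \<Rightarrow> (nat \<Rightarrow> nat \<Rightarrow> vec) \<Rightarrow> nat \<Rightarrow> nat \<Rightarrow> vec \<Rightarrow> vec \<Rightarrow> real"
where
  "mesh_weight M b N \<omega> h n x a =
     mesh_ratio M b N \<omega> h n x a / (\<Sum>n'\<in>{1..N}. mesh_ratio M b N \<omega> h n' x a)"

text \<open>The algorithm evaluates this recursion only at mesh points \<open>x = \<omega> r h\<close>.\<close>

function mesh_value ::
  "mdp \<Rightarrow> (nat \<Rightarrow> vec) \<Rightarrow> nat \<Rightarrow> (nat \<Rightarrow> nat \<Rightarrow> vec) \<Rightarrow> nat \<Rightarrow> vec \<Rightarrow> real"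
where
  "mesh_value M b N \<omega> h x =
     (if h < horizon M
      then SUP a\<in>actions M. reward M h x a +
             (\<Sum>n\<in>{1..N}. mesh_value M b N \<omega> (Suc h) (\<omega> n (Suc h)) * mesh_weight M b N \<omega> h n x a)
      else terminal M x)"
  by pat_completeness auto
termination
  by (relation "Wellfounded.measure (\<lambda>(M, b, N, \<omega>, h, x). horizon M - h)") auto

declare mesh_value.simps [simp del]

definition mesh_measurable :: "mdp \<Rightarrow> (nat \<Rightarrow> vec) \<Rightarrow> vec \<Rightarrow> bool" where
  "mesh_measurable M b x0 \<longleftrightarrow>
     (\<forall>N\<ge>2.
        (\<lambda>\<omega>. mesh_value M b N \<omega> 0 x0) \<in> borel_measurable (mesh_law M b x0 N) \<and>
        (\<forall>h\<le>horizon M. \<forall>r\<in>{1..N}.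
           (\<lambda>\<omega>. mesh_value M b N \<omega> h (\<omega> r h)) \<in> borel_measurable (mesh_law M b x0 N)))"

end

theory Submission
  imports Defs
begin

text \<open>
  \<^bold>\<open>Mesh error.\<close> The weights sum to one, so \<open>|mesh value - value function|\<close> grows from time \<open>h + 1\<close> to
  time \<open>h\<close> by at most the error of the weighted sum for the fixed, deterministic function
  \<open>value_fun (h + 1)\<close>, uniformly over states and actions. Conditionally on the states at time \<open>h\<close>, this
  sum consists of independent bounded terms that are Lipschitz in the state-action pair; by Hoeffding's
  lemma it is a sub-Gaussian process, and chaining bounds it by the Dudley integral. Its conditional
  mean differs from the exact integral only by \<open>O(1 / N)\<close>, because \<open>\<Sum>\<^sub>n q\<^sub>n / \<Sum>\<^sub>k\<^sub>\<noteq>\<^sub>n q\<^sub>k\<close> is that close to one.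

  \<^bold>\<open>Reflection error.\<close> The reflected densities dominate the original ones on \<open>D\<close>, hence the path law of
  the reflected process dominates the original path law restricted to the paths that stay in \<open>D\<close>.
  Comparing the two policy by policy makes a measurable choice of near-optimal actions unnecessary.
\<close>

subsection \<open>Chaining\<close>

text \<open>Conditioning is never formalised as conditional expectation. The trajectories are the
  coordinates of a product measure and the Markov property of one trajectory is an identity between
  integrals, so coordinates are integrated out one at a time.

  The weights are self-normalised: the weighted sum is \<open>U = SV / A\<close>, where
  \<open>SV\<close> estimates the integral \<open>I\<close> of the value function and
  \<open>A\<close> estimates one. Both are instances of one uniform importance sampling bound, and
  \<open>U - I = U * (1 - A) + (SV - I)\<close> combines them, because \<open>U\<close> is an
  average of bounded values.

  The sampling error involves the bounds on the densities only through two quotients: upper bound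
  over lower bound, and Lipschitz constant over lower bound. Reflection changes the bounds
  themselves, but it at most doubles \<open>\<Lambda> / \<delta>\<close> and does not increase
  \<open>L / \<delta>\<close>.

  The factor \<open>H\<^sup>2 G\<close> is the number \<open>H\<close> of time steps times the size
  \<open>H G\<close> of the value functions.\<close>

lemma le_ln_add_exp_div:
  fixes x A :: real
  assumes "0 < A"
  shows "x \<le> ln A + exp x / A"
  using exp_ge_add_one_self[of "x - ln A"] assms by (simp add: exp_diff)

text \<open>
  Measurable majorants take the place of suprema, which need not be measurable over an uncountable
  index set. Integrating \<open>\<bar>x\<bar> \<le> ln A + exp \<bar>x\<bar> / A\<close> avoids maxima and Jensen's inequality.
\<close>

lemma subgaussian_family_majorant:
  fixes Z :: "'i \<Rightarrow> 'w \<Rightarrow> real" and m s :: real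
  assumes "prob_space \<Omega>" and J: "finite J" "real (card J) \<le> m" "1 \<le> m" and s: "0 < s"
    and meas: "\<And>j. j \<in> J \<Longrightarrow> Z j \<in> borel_measurable \<Omega>"
    and mgf: "\<And>j l. j \<in> J \<Longrightarrow> (\<integral>\<^sup>+\<omega>. ennreal (exp (l * Z j \<omega>)) \<partial>\<Omega>) \<le> ennreal (exp (l\<^sup>2 * s\<^sup>2 / 2))"
  obtains B where "B \<in> borel_measurable \<Omega>"
    "(\<integral>\<^sup>+\<omega>. B \<omega> \<partial>\<Omega>) \<le> ennreal (4 * s * sqrt (ln (2 * m)))"
    "\<And>j \<omega>. j \<in> J \<Longrightarrow> ennreal \<bar>Z j \<omega>\<bar> \<le> B \<omega>"
proof -
  interpret prob_space \<Omega> by fact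
  define q where "q = sqrt (ln (2 * m))"
  have "ln 2 \<le> ln (2 * m)" using J by (subst ln_le_cancel_iff) auto
  moreover have "q\<^sup>2 = ln (2 * m)" using J by (simp add: q_def)
  ultimately have q2: "1 / 2 \<le> q\<^sup>2" using ln2_ge_two_thirds by linarith
  have q0: "0 < q" using J by (simp add: q_def)
  define l where "l = q / s"
  have l0: "0 < l" using q0 s by (simp add: l_def)
  have ls: "l\<^sup>2 * s\<^sup>2 = q\<^sup>2" using s by (simp add: l_def power_divide)
  \<comment> \<open>\<open>A\<close> dominates the sum of the expectations of the
    \<open>2 * card J\<close> exponentials, so after division by \<open>A * l\<close> they
    contribute at most \<open>1 / l\<close>. For \<open>l = q / s\<close> the other summand
    \<open>ln A / l\<close> equals \<open>3 / 2 * s * q\<close>.\<close>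
  define A where "A = 2 * m * exp (l\<^sup>2 * s\<^sup>2 / 2)"
  have A0: "0 < A" using J by (simp add: A_def)
  have lnA: "ln A = q\<^sup>2 + q\<^sup>2 / 2"
    using J by (simp add: A_def ln_mult ls) (simp add: q_def ln_mult)
  have lnA0: "0 < ln A" using lnA zero_less_power[OF q0, of 2] by linarith
  define B where "B = (\<lambda>\<omega>. ennreal (ln A / l) +
    (\<Sum>j\<in>J. ennreal (1 / (A * l)) * (ennreal (exp (l * Z j \<omega>)) + ennreal (exp ((- l) * Z j \<omega>)))))"
  have B_meas: "B \<in> borel_measurable \<Omega>"
    unfolding B_def using meas by measurable
  have "(\<integral>\<^sup>+\<omega>. B \<omega> \<partial>\<Omega>) = ennreal (ln A / l) + (\<Sum>j\<in>J. ennreal (1 / (A * l)) *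
      ((\<integral>\<^sup>+\<omega>. ennreal (exp (l * Z j \<omega>)) \<partial>\<Omega>) + (\<integral>\<^sup>+\<omega>. ennreal (exp ((- l) * Z j \<omega>)) \<partial>\<Omega>)))"
    unfolding B_def using meas
    by (subst nn_integral_add; (subst nn_integral_sum)?; simp add: emeasure_space_1 nn_integral_cmult nn_integral_add)
  also have "\<dots> \<le> ennreal (ln A / l) + (\<Sum>j\<in>J. ennreal (1 / (A * l)) *
      (ennreal (exp (l\<^sup>2 * s\<^sup>2 / 2)) + ennreal (exp (l\<^sup>2 * s\<^sup>2 / 2))))"
    using mgf[of _ l] mgf[of _ "- l"] by (intro add_left_mono sum_mono mult_left_mono add_mono) auto
  also have "\<dots> = ennreal (ln A / l + real (card J) * ((1 / (A * l)) * (2 * exp (l\<^sup>2 * s\<^sup>2 / 2))))"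
    using A0 l0 lnA0
    by (simp flip: ennreal_plus ennreal_mult add: ennreal_of_nat_eq_real_of_nat)
  also have "\<dots> \<le> ennreal (4 * s * q)"
  proof (rule ennreal_leI)
    have "real (card J) * ((1 / (A * l)) * (2 * exp (l\<^sup>2 * s\<^sup>2 / 2))) = real (card J) / m / l"
      using J l0 by (simp add: A_def field_simps)
    also have "\<dots> \<le> 1 / l" using J l0 by (intro divide_right_mono) auto
    finally have "ln A / l + real (card J) * ((1 / (A * l)) * (2 * exp (l\<^sup>2 * s\<^sup>2 / 2)))
        \<le> (q\<^sup>2 + q\<^sup>2 / 2 + 1) / l"
      by (simp add: lnA add_divide_distrib)
    \<comment> \<open>The factor 2 in \<open>ln (2 * m)\<close> keeps \<open>q\<^sup>2\<close> above
      \<open>1 / 2\<close> even for \<open>m = 1\<close>, so the summand 1 is at most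
      \<open>2 * q\<^sup>2\<close>.\<close>
    also have "\<dots> \<le> (4 * q\<^sup>2) / l"
      using q2 l0 by (intro divide_right_mono) auto
    also have "\<dots> = 4 * s * q" using q0 s by (simp add: l_def power2_eq_square)
    finally show "ln A / l + real (card J) * ((1 / (A * l)) * (2 * exp (l\<^sup>2 * s\<^sup>2 / 2))) \<le> 4 * s * q" .
  qed
  finally have B_int: "(\<integral>\<^sup>+\<omega>. B \<omega> \<partial>\<Omega>) \<le> ennreal (4 * s * sqrt (ln (2 * m)))"
    by (simp add: q_def)
  have "ennreal \<bar>Z j \<omega>\<bar> \<le> B \<omega>" if j: "j \<in> J" for j \<omega>
  proof -
    have "l * \<bar>Z j \<omega>\<bar> \<le> ln A + exp (l * \<bar>Z j \<omega>\<bar>) / A"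
      using le_ln_add_exp_div[OF A0] .
    also have "exp (l * \<bar>Z j \<omega>\<bar>) \<le> exp (l * Z j \<omega>) + exp ((- l) * Z j \<omega>)"
      by (simp add: abs_if)
    finally have "l * \<bar>Z j \<omega>\<bar> \<le> ln A + (exp (l * Z j \<omega>) + exp ((- l) * Z j \<omega>)) / A"
      using A0 by (simp add: divide_right_mono)
    then have "\<bar>Z j \<omega>\<bar> \<le> (ln A + (exp (l * Z j \<omega>) + exp ((- l) * Z j \<omega>)) / A) / l"
      using l0 by (simp add: pos_le_divide_eq mult.commute)
    also have "\<dots> = ln A / l + 1 / (A * l) * (exp (l * Z j \<omega>) + exp ((- l) * Z j \<omega>))"
      using l0 A0 by (simp add: field_simps)
    finally have "ennreal \<bar>Z j \<omega>\<bar> \<le> ennreal (ln A / l) +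
        ennreal (1 / (A * l)) * (ennreal (exp (l * Z j \<omega>)) + ennreal (exp ((- l) * Z j \<omega>)))"
      using l0 A0 lnA0 by (simp flip: ennreal_plus ennreal_mult add: ennreal_leI)
    also have "\<dots> \<le> B \<omega>"
      unfolding B_def using j J(1)
      by (intro add_left_mono member_le_sum[where f = "\<lambda>j. ennreal (1 / (A * l)) *
        (ennreal (exp (l * Z j \<omega>)) + ennreal (exp ((- l) * Z j \<omega>)))"]) auto
    finally show ?thesis .
  qed
  then show thesis using that B_meas B_int by blast
qed

section \<open>Covering numbers and finiteness of the entropy integral\<close>

lemma covering_number_attained:
  assumes "covering_number X \<rho> u = enat n"
  obtains C where "finite C" "C \<subseteq> X" "X \<subseteq> (\<Union>c\<in>C. Metric_space.mball X \<rho> c u)" "card C = n"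
proof -
  define F where "F = {C. finite C \<and> C \<subseteq> X \<and> X \<subseteq> (\<Union>c\<in>C. Metric_space.mball X \<rho> c u)}"
  have eq: "Inf ((\<lambda>C. enat (card C)) ` F) = enat n"
    using assms by (simp add: covering_number_def F_def)
  then have ne: "(\<lambda>C. enat (card C)) ` F \<noteq> {}"
    by (auto simp: top_enat_def)
  then obtain z where "z \<in> (\<lambda>C. enat (card C)) ` F" by blast
  then have "Inf ((\<lambda>C. enat (card C)) ` F) \<in> (\<lambda>C. enat (card C)) ` F"
    unfolding Inf_enat_def using ne by (auto intro: LeastI)
  then obtain C where "C \<in> F" "enat n = enat (card C)" unfolding eq by blast
  then show thesis using that unfolding F_def by auto
qed

lemma covering_number_antimono:
  assumes "Metric_space X \<rho>" "u \<le> v"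
  shows "covering_number X \<rho> v \<le> covering_number X \<rho> u"
proof -
  interpret Metric_space X \<rho> by fact
  show ?thesis unfolding covering_number_def
    using mball_subset_concentric[OF assms(2)] by (intro INF_superset_mono) blast+
qed

lemma mdiam_upper: "x \<in> X \<Longrightarrow> y \<in> X \<Longrightarrow> ennreal (\<rho> x y) \<le> mdiam X \<rho>"
  unfolding mdiam_def by (meson SUP_upper2 order_refl)

lemma mdiam_least: "(\<And>x y. x \<in> X \<Longrightarrow> y \<in> X \<Longrightarrow> \<rho> x y \<le> r) \<Longrightarrow> mdiam X \<rho> \<le> ennreal r"
  unfolding mdiam_def by (intro SUP_least ennreal_leI)

text \<open>Covering numbers grow as the radius shrinks, so an infinite one at \<open>u\<close>
  makes the integrand infinite on all of \<open>{0<..u}\<close>, a set of positive length inside the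
  domain of integration.\<close>

lemma covering_number_finite:
  assumes X: "Metric_space X \<rho>" and fin: "dudley X \<rho> < \<infinity>" and u: "0 < u" "ennreal u \<le> mdiam X \<rho>"
  shows "covering_number X \<rho> u \<noteq> \<infinity>"
proof
  assume inf: "covering_number X \<rho> u = \<infinity>"
  have "(\<integral>\<^sup>+v. \<infinity> * indicator {0<..u} v \<partial>lborel) \<le> dudley X \<rho>"
    unfolding dudley_def
  proof (rule nn_integral_mono)
    fix v :: real
    show "\<infinity> * indicator {0<..u} v \<le> (case covering_number X \<rho> v of enat n \<Rightarrow> ennreal (sqrt (ln (real n))) | \<infinity> \<Rightarrow> \<infinity>)
        * indicator {u. 0 < u \<and> ennreal u \<le> mdiam X \<rho>} v"
    proof (cases "v \<in> {0<..u}")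
      case True
      then have "covering_number X \<rho> v = \<infinity>"
        using covering_number_antimono[OF X, of v u] inf by (auto simp: top.extremum_unique)
      moreover have "ennreal v \<le> mdiam X \<rho>" using True u(2) by (meson ennreal_leI greaterThanAtMost_iff order_trans)
      ultimately show ?thesis using True by simp
    qed simp
  qed
  also have "(\<integral>\<^sup>+v. \<infinity> * indicator {0<..u} v \<partial>lborel) = \<infinity>"
    using u(1) by (subst nn_integral_cmult_indicator) (auto simp: ennreal_top_mult)
  finally show False using fin by simp
qed

text \<open>An infinite diameter would put radius 1 into the domain of the entropy integral. Then
  there is a finite net of radius 1, and any two points are at most 2 plus a distance of centres
  apart; \<open>K\<close> bounds the latter crudely by the sum over all pairs.\<close>

lemma mdiam_finite:
  assumes X: "Metric_space X \<rho>" and fin: "dudley X \<rho> < \<infinity>"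
  shows "mdiam X \<rho> < \<infinity>"
proof (rule ccontr)
  assume "\<not> mdiam X \<rho> < \<infinity>"
  then have top: "mdiam X \<rho> = \<infinity>" by (simp add: less_top[symmetric])
  then obtain n where "covering_number X \<rho> 1 = enat n"
    using covering_number_finite[OF X fin, of 1] by auto
  then obtain C where C: "finite C" "C \<subseteq> X" "X \<subseteq> (\<Union>c\<in>C. Metric_space.mball X \<rho> c 1)"
    by (rule covering_number_attained)
  interpret Metric_space X \<rho> by fact
  define K where "K = (\<Sum>(c,c')\<in>C \<times> C. \<rho> c c')"
  have "mdiam X \<rho> \<le> ennreal (2 + K)"
  proof (rule mdiam_least)
    fix x y assume xy: "x \<in> X" "y \<in> X"
    then obtain c c' where c: "c \<in> C" "c' \<in> C" "\<rho> c x < 1" "\<rho> c' y < 1"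
      using C(3) by (auto simp: in_mball subset_iff) metis
    have "\<rho> c c' \<le> K"
      unfolding K_def using c C(1) member_le_sum[of "(c,c')" "C \<times> C" "\<lambda>(c,c'). \<rho> c c'"] by auto
    moreover have "\<rho> x y \<le> \<rho> x c + \<rho> c c' + \<rho> c' y"
      using triangle[of x c y] triangle[of c c' y] c xy C(2) by (auto simp: subset_iff)
    ultimately show "\<rho> x y \<le> 2 + K" using c commute[of x c] by simp
  qed
  then show False using top by (simp add: top_unique)
qed

text \<open>Dudley's entropy bound with explicit constants. The chain starts at \<open>t0\<close>,
  whose own size enters through \<open>\<tau>\<close>. The pathwise Lipschitz condition carries the
  bound from the nets to all of \<open>X\<close> at every sample point, with no exceptional set;
  accordingly \<open>\<kappa>\<close> does not appear in the bound.\<close>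

theorem chaining:
  fixes Z :: "'t \<Rightarrow> 'w \<Rightarrow> real"
  assumes "prob_space \<Omega>" and X: "Metric_space X \<rho>" and t0: "t0 \<in> X" and fin: "dudley X \<rho> < \<infinity>"
    and pos: "0 < \<sigma>" "0 < \<tau>"
    and meas: "\<And>t. t \<in> X \<Longrightarrow> Z t \<in> borel_measurable \<Omega>"
    and mgf0: "\<And>l. (\<integral>\<^sup>+\<omega>. ennreal (exp (l * Z t0 \<omega>)) \<partial>\<Omega>) \<le> ennreal (exp (l\<^sup>2 * \<tau>\<^sup>2 / 2))"
    and mgf: "\<And>s t l. s \<in> X \<Longrightarrow> t \<in> X \<Longrightarrow>
      (\<integral>\<^sup>+\<omega>. ennreal (exp (l * (Z s \<omega> - Z t \<omega>))) \<partial>\<Omega>) \<le> ennreal (exp (l\<^sup>2 * (\<sigma> * \<rho> s t)\<^sup>2 / 2))"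
    and lip: "\<And>s t \<omega>. s \<in> X \<Longrightarrow> t \<in> X \<Longrightarrow> \<omega> \<in> space \<Omega> \<Longrightarrow> \<bar>Z s \<omega> - Z t \<omega>\<bar> \<le> \<kappa> * \<rho> s t"
  obtains B where "B \<in> borel_measurable \<Omega>"
    "(\<integral>\<^sup>+\<omega>. B \<omega> \<partial>\<Omega>) \<le> ennreal (4 * \<tau>) + ennreal (56 * \<sigma>) * dudley X \<rho>"
    "\<And>\<omega> t. \<omega> \<in> space \<Omega> \<Longrightarrow> t \<in> X \<Longrightarrow> ennreal \<bar>Z t \<omega>\<bar> \<le> B \<omega>"
proof -
  interpret Metric_space X \<rho> by fact
  obtain B0 where B0: "B0 \<in> borel_measurable \<Omega>" "\<And>\<omega>. ennreal \<bar>Z t0 \<omega>\<bar> \<le> B0 \<omega>"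
    "(\<integral>\<^sup>+\<omega>. B0 \<omega> \<partial>\<Omega>) \<le> ennreal (4 * \<tau> * sqrt (ln 2))"
    by (rule subgaussian_family_majorant[OF assms(1), of "{t0}" 1 \<tau> "\<lambda>_. Z t0"])
       (use pos meas[OF t0] mgf0 in auto)
  have "sqrt (ln 2) \<le> (1::real)" using ln_2_less_1 by (simp add: real_sqrt_le_iff)
  then have "4 * \<tau> * sqrt (ln 2) \<le> 4 * \<tau>" using pos by simp
  then have B0': "(\<integral>\<^sup>+\<omega>. B0 \<omega> \<partial>\<Omega>) \<le> ennreal (4 * \<tau>)"
    using B0(3) by (meson ennreal_leI order_trans)
  obtain r where r: "mdiam X \<rho> = ennreal r" "0 \<le> r"
    using mdiam_finite[OF X fin] by (cases "mdiam X \<rho>") auto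
  have diam: "\<rho> x y \<le> r" if "x \<in> X" "y \<in> X" for x y
    using mdiam_upper[OF that, of \<rho>] r by simp
  show thesis
  proof (cases "r = 0")
    case True
    have "ennreal \<bar>Z t \<omega>\<bar> \<le> B0 \<omega>" if "\<omega> \<in> space \<Omega>" "t \<in> X" for \<omega> t
    proof -
      have "\<rho> t t0 = 0" using diam[OF that(2) t0] nonneg[of t t0] True by simp
      then have "Z t \<omega> = Z t0 \<omega>" using lip[OF that(2) t0 that(1)] by simp
      then show ?thesis using B0(2) by simp
    qed
    then show thesis using that B0 B0' by (meson add_increasing2 zero_le)
  next
    case False
    with r have r0: "0 < r" by simp
    define u where "u k = r / 2 ^ Suc k" for k
    have u0: "0 < u k" and ur: "u k \<le> r" for k
      using r0 one_le_power[of "2::real" "Suc k"] by (auto simp: u_def divide_simps simp del: power_Suc one_le_power)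
    have uS: "u k = 2 * u (Suc k)" for k by (simp add: u_def)
    have "\<exists>n. covering_number X \<rho> (u k) = enat n" for k
      using covering_number_finite[OF X fin u0[of k]] ur[of k] r by (auto intro: ennreal_leI)
    then obtain n where n: "covering_number X \<rho> (u k) = enat (n k)" for k by metis
    have "\<exists>C. finite C \<and> C \<subseteq> X \<and> X \<subseteq> (\<Union>c\<in>C. mball c (u k)) \<and> card C = n k" for k
      using covering_number_attained[OF n[of k]] by metis
    then obtain T where T: "finite (T k)" "T k \<subseteq> X" "X \<subseteq> (\<Union>c\<in>T k. mball c (u k))" "card (T k) = n k" for k
      by metis
    have n_mono: "n k \<le> n (Suc k)" for k
      using covering_number_antimono[OF X, of "u (Suc k)" "u k"] n[of k] n[of "Suc k"] uS[of k] u0[of "Suc k"] by simp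
    \<comment> \<open>These radii are at most \<open>r / 4\<close>, and a single ball of such a
      radius has diameter at most \<open>r / 2\<close>. Having
      \<open>ln 2 \<le> ln (n (Suc k))\<close> lets the \<open>ln 2\<close> of the maximal
      inequality disappear into the entropy.\<close>
    have n2: "2 \<le> n (Suc k)" for k
    proof (rule ccontr)
      assume "\<not> 2 \<le> n (Suc k)"
      moreover have "T (Suc k) \<noteq> {}" using T(3)[of "Suc k"] t0 by auto
      then have "n (Suc k) \<noteq> 0" using T(1,4) by (metis card_0_eq)
      ultimately have "card (T (Suc k)) = 1" using T(4) by simp
      then obtain c where c: "T (Suc k) = {c}" by (rule card_1_singletonE)
      have "mdiam X \<rho> \<le> ennreal (2 * u (Suc k))"
      proof (rule mdiam_least)
        fix x y assume "x \<in> X" "y \<in> X"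
        then have "x \<in> mball c (u (Suc k))" "y \<in> mball c (u (Suc k))" using T(3)[of "Suc k"] c by auto
        then show "\<rho> x y \<le> 2 * u (Suc k)" using triangle[of x c y] commute[of x c] by (auto simp: in_mball)
      qed
      then have "r \<le> 2 * u (Suc k)" using r u0[of "Suc k"] by simp
      then show False using r0 one_le_power[of "2::real" k] by (simp add: u_def divide_simps del: one_le_power)
    qed
    define W where "W k = (if k = 0 then {t0} else T k)" for k
    have W: "finite (W k)" "W k \<subseteq> X" for k using T t0 by (auto simp: W_def)
    have cardW: "card (W k) \<le> n (Suc k)" "card (W (Suc k)) = n (Suc k)" for k
      using T(4) n_mono[of k] n2[of k] by (auto simp: W_def)
    \<comment> \<open>The links of the chain. Two consecutive approximations of a point are at most
      \<open>u k + u (Suc k) = 3 * u (Suc k)\<close> apart. The first link starts at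
      \<open>t0\<close>, which is within \<open>r = 4 * u 1\<close> of every point; hence the factor
      4.\<close>
    define J where "J k = {(s, t) \<in> W k \<times> W (Suc k). \<rho> s t \<le> 4 * u (Suc k)}" for k
    have J: "finite (J k)" for k
      unfolding J_def using W by (auto intro: finite_subset[of _ "W k \<times> W (Suc k)"])
    have cardJ: "real (card (J k)) \<le> (real (n (Suc k)))\<^sup>2" for k
    proof -
      have "card (J k) \<le> card (W k \<times> W (Suc k))"
        unfolding J_def using W by (intro card_mono) auto
      also have "\<dots> \<le> n (Suc k) * n (Suc k)" using cardW[of k] by (simp add: card_cartesian_product)
      finally show ?thesis by (metis of_nat_le_iff of_nat_mult power2_eq_square)
    qed
    let ?q = "\<lambda>k. sqrt (ln (real (n (Suc k))))"
    define c where "c k = u k * sqrt (ln (real (n k)))" for k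
    have "\<exists>B. B \<in> borel_measurable \<Omega> \<and> (\<integral>\<^sup>+\<omega>. B \<omega> \<partial>\<Omega>) \<le> ennreal (28 * \<sigma> * c (Suc k)) \<and>
        (\<forall>(s, t)\<in>J k. \<forall>\<omega>. ennreal \<bar>Z s \<omega> - Z t \<omega>\<bar> \<le> B \<omega>)" for k
    proof -
      let ?u = "4 * \<sigma> * u (Suc k)" and ?m = "(real (n (Suc k)))\<^sup>2"
      have m1: "1 \<le> ?m" using n2[of k] by (simp add: one_le_power)
      obtain B where B: "B \<in> borel_measurable \<Omega>"
        "(\<integral>\<^sup>+\<omega>. B \<omega> \<partial>\<Omega>) \<le> ennreal (4 * ?u * sqrt (ln (2 * ?m)))"
        "\<And>j \<omega>. j \<in> J k \<Longrightarrow> ennreal \<bar>Z (fst j) \<omega> - Z (snd j) \<omega>\<bar> \<le> B \<omega>"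
      proof (rule subgaussian_family_majorant[OF assms(1) J cardJ m1, of ?u "\<lambda>j \<omega>. Z (fst j) \<omega> - Z (snd j) \<omega>"])
        show "0 < ?u" using pos u0 by simp
        fix j assume "j \<in> J k"
        then have j: "fst j \<in> X" "snd j \<in> X" "\<rho> (fst j) (snd j) \<le> 4 * u (Suc k)"
          using W[of k] W[of "Suc k"] by (auto simp: J_def)
        then show "(\<lambda>\<omega>. Z (fst j) \<omega> - Z (snd j) \<omega>) \<in> borel_measurable \<Omega>" using meas by measurable
        fix l
        have "(\<sigma> * \<rho> (fst j) (snd j))\<^sup>2 \<le> ?u\<^sup>2"
          using j(3) pos nonneg[of "fst j" "snd j"] by (intro power_mono) auto
        then have "l\<^sup>2 * (\<sigma> * \<rho> (fst j) (snd j))\<^sup>2 / 2 \<le> l\<^sup>2 * ?u\<^sup>2 / 2" by (simp add: mult_left_mono)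
        then show "(\<integral>\<^sup>+\<omega>. ennreal (exp (l * (Z (fst j) \<omega> - Z (snd j) \<omega>))) \<partial>\<Omega>) \<le> ennreal (exp (l\<^sup>2 * ?u\<^sup>2 / 2))"
          using mgf[OF j(1,2), of l] by (meson ennreal_leI exp_le_cancel_iff order_trans)
      qed (auto simp: split_def)
      \<comment> \<open>The square \<open>?m\<close> bounds the number of links. Since
        \<open>sqrt 3 \<le> 7 / 4\<close>, the two factors 4, from the maximal inequality and from
        the length of the links, become \<open>4 * 4 * 7 / 4 = 28\<close>.\<close>
      have "ln (2 * ?m) = ln 2 + 2 * ln (n (Suc k))" using n2[of k] by (simp add: ln_mult ln_realpow)
      also have "\<dots> \<le> 3 * ln (real (n (Suc k)))" using n2[of k] by simp
      finally have "sqrt (ln (2 * ?m)) \<le> sqrt 3 * ?q k"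
        by (metis real_sqrt_le_iff real_sqrt_mult)
      also have "\<dots> \<le> 7 / 4 * ?q k"
        by (intro mult_right_mono real_le_lsqrt) (use n2[of k] in \<open>auto simp: power2_eq_square real_sqrt_ge_zero\<close>)
      finally have "4 * ?u * sqrt (ln (2 * ?m)) \<le> 4 * ?u * (7 / 4 * ?q k)"
        using pos u0[of "Suc k"] by (intro mult_left_mono) auto
      also have "\<dots> = 28 * \<sigma> * c (Suc k)" by (simp add: c_def)
      finally have "(\<integral>\<^sup>+\<omega>. B \<omega> \<partial>\<Omega>) \<le> ennreal (28 * \<sigma> * c (Suc k))"
        using B(2) by (meson ennreal_leI order_trans)
      then show ?thesis using B by fastforce
    qed
    then obtain B where B: "B k \<in> borel_measurable \<Omega>" "(\<integral>\<^sup>+\<omega>. B k \<omega> \<partial>\<Omega>) \<le> ennreal (28 * \<sigma> * c (Suc k))"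
        "\<And>s t \<omega>. (s, t) \<in> J k \<Longrightarrow> ennreal \<bar>Z s \<omega> - Z t \<omega>\<bar> \<le> B k \<omega>" for k
      by (metis (no_types, lifting) case_prodD)
    have c_nonneg: "0 \<le> c (Suc k)" for k using n2[of k] u0[of "Suc k"] by (simp add: c_def)
    \<comment> \<open>Sum against integral: the intervals \<open>S k\<close> are disjoint, have
      length \<open>u (Suc k) / 2\<close>, and on \<open>S k\<close> the integrand is at least its
      value at \<open>u (Suc k)\<close>. The halved length costs the factor 2 that turns 28 into
      56.\<close>
    have dud: "(\<Sum>k. ennreal (c (Suc k))) \<le> 2 * dudley X \<rho>"
    proof -
      define S where "S k = {u (Suc (Suc k))<..u (Suc k)}" for k
      have S_emb: "emeasure lborel (S k) = ennreal (u (Suc k) / 2)" for k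
        using uS[of "Suc k"] u0[of "Suc (Suc k)"] by (simp add: S_def)
      have u_anti: "u j \<le> u k" if "k \<le> j" for j k
        using that r0 unfolding u_def by (intro divide_left_mono power_increasing) auto
      have disj: "j = k" if "v \<in> S j" "v \<in> S k" for j k v
      proof -
        have "False" if "v \<in> S j" "v \<in> S k" "j < k" for j k
          using that u_anti[of "Suc (Suc j)" "Suc k"] by (auto simp: S_def)
        then show ?thesis using that by (metis linorder_neqE_nat)
      qed
      have "(\<Sum>k. ennreal (c (Suc k))) = 2 * (\<Sum>k. ennreal (?q k) * emeasure lborel (S k))"
      proof -
        have "ennreal (c (Suc k)) = 2 * (ennreal (?q k) * emeasure lborel (S k))" for k
        proof -
          have "2 * (ennreal (?q k) * emeasure lborel (S k))
              = ennreal 2 * (ennreal (?q k) * ennreal (u (Suc k) / 2))"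
            by (simp add: S_emb)
          also have "\<dots> = ennreal (2 * (?q k * (u (Suc k) / 2)))"
            using n2[of k] u0[of "Suc k"] by (simp flip: ennreal_mult del: ennreal_numeral)
          finally show ?thesis by (simp add: c_def mult.commute)
        qed
        then show ?thesis by (simp flip: ennreal_suminf_cmult)
      qed
      also have "(\<Sum>k. ennreal (?q k) * emeasure lborel (S k))
          = (\<integral>\<^sup>+v. (\<Sum>k. ennreal (?q k) * indicator (S k) v) \<partial>lborel)"
        by (subst nn_integral_suminf) (auto simp: S_def nn_integral_cmult_indicator)
      also have "\<dots> \<le> dudley X \<rho>"
        unfolding dudley_def
      proof (rule nn_integral_mono)
        fix v :: real
        let ?I = "(case covering_number X \<rho> v of enat n \<Rightarrow> ennreal (sqrt (ln (real n))) | \<infinity> \<Rightarrow> \<infinity>)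
          * indicator {u. 0 < u \<and> ennreal u \<le> mdiam X \<rho>} v"
        show "(\<Sum>k. ennreal (?q k) * indicator (S k) v) \<le> ?I"
        proof (cases "\<exists>k. v \<in> S k")
          case True
          then obtain k where k: "v \<in> S k" by blast
          have "(\<Sum>k. ennreal (?q k) * indicator (S k) v)
              = (\<Sum>j\<in>{k}. ennreal (?q j) * indicator (S j) v)"
            using disj[OF k] by (intro suminf_finite) (auto simp: indicator_def)
          also have "\<dots> = ennreal (?q k)" using k by simp
          also have "\<dots> \<le> ?I"
          proof -
            have v: "0 < v" "v \<le> u (Suc k)" using k u0[of "Suc (Suc k)"] by (auto simp: S_def)
            then have le: "enat (n (Suc k)) \<le> covering_number X \<rho> v"
              using covering_number_antimono[OF X v(2)] n by simp
            have "ennreal v \<le> mdiam X \<rho>" using v ur[of "Suc k"] r by (simp add: ennreal_leI)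
            then show ?thesis using v le n2[of k]
              by (cases "covering_number X \<rho> v") (auto intro!: ennreal_leI simp: real_sqrt_le_iff)
          qed
          finally show ?thesis .
        next
          case False
          then show ?thesis by (simp add: indicator_def)
        qed
      qed
      finally show ?thesis by (simp add: mult_left_mono)
    qed
    let ?B = "\<lambda>\<omega>. B0 \<omega> + (\<Sum>k. B k \<omega>)"
    have "?B \<in> borel_measurable \<Omega>" using B0 B by measurable
    moreover have "(\<integral>\<^sup>+\<omega>. ?B \<omega> \<partial>\<Omega>) \<le> ennreal (4 * \<tau>) + ennreal (56 * \<sigma>) * dudley X \<rho>"
    proof -
      have "(\<integral>\<^sup>+\<omega>. ?B \<omega> \<partial>\<Omega>) = (\<integral>\<^sup>+\<omega>. B0 \<omega> \<partial>\<Omega>) + (\<Sum>k. \<integral>\<^sup>+\<omega>. B k \<omega> \<partial>\<Omega>)"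
        using B0 B by (simp add: nn_integral_add nn_integral_suminf)
      also have "\<dots> \<le> ennreal (4 * \<tau>) + (\<Sum>k. ennreal (28 * \<sigma>) * ennreal (c (Suc k)))"
        using B0' B(2) pos c_nonneg by (intro add_mono suminf_le) (auto simp flip: ennreal_mult)
      also have "(\<Sum>k. ennreal (28 * \<sigma>) * ennreal (c (Suc k))) = ennreal (28 * \<sigma>) * (\<Sum>k. ennreal (c (Suc k)))"
        by simp
      also have "\<dots> \<le> ennreal (28 * \<sigma>) * (2 * dudley X \<rho>)" by (intro mult_left_mono dud) simp
      also have "\<dots> = ennreal (28 * \<sigma>) * ennreal 2 * dudley X \<rho>" by (simp add: mult.assoc)
      also have "ennreal (28 * \<sigma>) * ennreal 2 = ennreal (56 * \<sigma>)"
        using pos by (subst ennreal_mult[symmetric]) auto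
      finally show ?thesis by simp
    qed
    moreover have "ennreal \<bar>Z t \<omega>\<bar> \<le> ?B \<omega>" if \<omega>: "\<omega> \<in> space \<Omega>" and t: "t \<in> X" for \<omega> t
    proof -
      have "\<exists>c\<in>W k. \<rho> c t \<le> (if k = 0 then r else u k)" for k
      proof (cases "k = 0")
        case True
        then show ?thesis using diam[OF t0 t] by (simp add: W_def)
      next
        case False
        obtain c where "c \<in> T k" "t \<in> mball c (u k)" using T(3)[of k] t by blast
        then show ?thesis using False by (auto simp: W_def in_mball intro!: bexI[of _ c])
      qed
      then obtain p where p: "p k \<in> W k" "\<rho> (p k) t \<le> (if k = 0 then r else u k)" for k by metis
      have pX: "p k \<in> X" for k using p W by blast
      have pJ: "(p k, p (Suc k)) \<in> J k" for k
      proof -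
        have "\<rho> (p k) (p (Suc k)) \<le> 4 * u (Suc k)"
        proof (cases "k = 0")
          case True
          then show ?thesis using diam[OF pX pX, of 0 1] by (simp add: u_def)
        next
          case False
          have "\<rho> (p k) (p (Suc k)) \<le> \<rho> (p k) t + \<rho> (p (Suc k)) t"
            using triangle[of "p k" t "p (Suc k)"] pX t commute by metis
          then show ?thesis using p(2)[of k] p(2)[of "Suc k"] False uS[of k] u0[of "Suc k"] by simp
        qed
        then show ?thesis using p by (simp add: J_def)
      qed
      have step: "ennreal \<bar>Z (p k) \<omega>\<bar> \<le> B0 \<omega> + (\<Sum>j<k. B j \<omega>)" for k
      proof (induction k)
        case 0
        then show ?case using B0(2) p(1)[of 0] by (simp add: W_def)
      next
        case (Suc k)
        have "\<bar>Z (p (Suc k)) \<omega>\<bar> \<le> \<bar>Z (p k) \<omega>\<bar> + \<bar>Z (p k) \<omega> - Z (p (Suc k)) \<omega>\<bar>" by simp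
        then have "ennreal \<bar>Z (p (Suc k)) \<omega>\<bar> \<le> ennreal \<bar>Z (p k) \<omega>\<bar> + ennreal \<bar>Z (p k) \<omega> - Z (p (Suc k)) \<omega>\<bar>"
          by (simp flip: ennreal_plus add: ennreal_leI)
        also have "\<dots> \<le> (B0 \<omega> + (\<Sum>j<k. B j \<omega>)) + B k \<omega>"
          using Suc B(3)[OF pJ] by (intro add_mono) auto
        finally show ?case by (simp add: add.assoc)
      qed
      have "ennreal \<bar>Z (p k) \<omega>\<bar> \<le> ?B \<omega>" for k
        using step[of k] sum_le_suminf[of "\<lambda>k. B k \<omega>" "{..<k}"] by (meson add_left_mono finite_lessThan order_trans summableI zero_le)
      show ?thesis
      \<comment> \<open>An infinite majorant dominates trivially. A finite one bounds
        \<open>Z\<close> at all the approximating points \<open>p k\<close>, which converge to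
        \<open>t\<close>.\<close>
      proof (cases "?B \<omega>")
        case (real b)
        have "\<bar>Z t \<omega>\<bar> \<le> b + \<bar>\<kappa>\<bar> * u (Suc k)" for k
        proof -
          have "\<bar>Z (p (Suc k)) \<omega>\<bar> \<le> b" using \<open>ennreal \<bar>Z (p (Suc k)) \<omega>\<bar> \<le> ?B \<omega>\<close> real by simp
          moreover have "\<bar>Z (p (Suc k)) \<omega> - Z t \<omega>\<bar> \<le> \<kappa> * \<rho> (p (Suc k)) t" using lip[OF pX t \<omega>] .
          moreover have "\<kappa> * \<rho> (p (Suc k)) t \<le> \<bar>\<kappa>\<bar> * u (Suc k)"
            using p(2)[of "Suc k"] by (intro mult_mono) auto
          ultimately show ?thesis by linarith
        qed
        moreover have "(\<lambda>k. b + \<bar>\<kappa>\<bar> * u (Suc k)) \<longlonglongrightarrow> b + \<bar>\<kappa>\<bar> * 0"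
          unfolding u_def using LIMSEQ_divide_realpow_zero[of 2 r, THEN LIMSEQ_Suc, THEN LIMSEQ_Suc]
          by (intro tendsto_intros) simp
        ultimately have "\<bar>Z t \<omega>\<bar> \<le> b" by (intro LIMSEQ_le_const[of _ b]) auto
        then show ?thesis using real by (simp add: ennreal_leI)
      qed auto
    qed
    ultimately show thesis using that by blast
  qed
qed

subsection \<open>Importance sampling from the empirical mixture\<close>

text \<open>Integrability is not assumed: the integral of a non-integrable function is 0 by
  convention, and \<open>K\<close> is nonnegative because a probability space has a point at which
  it bounds an absolute value.\<close>

lemma (in prob_space) abs_expectation_le:
  fixes f :: "'a \<Rightarrow> real"
  assumes "\<And>x. x \<in> space M \<Longrightarrow> \<bar>f x\<bar> \<le> K"
  shows "\<bar>expectation f\<bar> \<le> K"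
proof (cases "integrable M f")
  case True
  have "\<bar>expectation f\<bar> \<le> expectation (\<lambda>x. \<bar>f x\<bar>)" by (rule integral_abs_bound)
  also have "\<dots> \<le> K" using True assms by (intro integral_le_const AE_I2) auto
  finally show ?thesis .
next
  case False
  obtain x where "x \<in> space M" using not_empty by blast
  then show ?thesis using False assms[of x] by (simp add: not_integrable_integral_eq)
qed

text \<open>One time step of the mesh. \<open>P\<close> is the law of a single trajectory,
  \<open>X\<close> and \<open>Y\<close> are its states at two consecutive times, and
  \<open>\<kappa>\<close> is the transition density under the control used in the simulation. The
  Markov property is stated as the identity \<open>markov\<close> for the joint law of
  \<open>X\<close> and \<open>Y\<close>, which is the form in which single coordinates are
  integrated out.\<close>

locale mesh_step = finite_measure S + P: prob_space P
  for S :: "'s measure" and P :: "'w measure" +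
  fixes X Y :: "'w \<Rightarrow> 's" and \<kappa> :: "'s \<Rightarrow> 's \<Rightarrow> real" and \<delta> \<Lambda> :: real and N :: nat
  assumes X [measurable]: "X \<in> P \<rightarrow>\<^sub>M S" and Y [measurable]: "Y \<in> P \<rightarrow>\<^sub>M S"
    and \<kappa>_meas [measurable]: "(\<lambda>(s, y). \<kappa> s y) \<in> borel_measurable (S \<Otimes>\<^sub>M S)"
    and \<delta>: "0 < \<delta>"
    and \<kappa>_bounds: "\<And>s y. s \<in> space S \<Longrightarrow> y \<in> space S \<Longrightarrow> \<delta> \<le> \<kappa> s y \<and> \<kappa> s y \<le> \<Lambda>"
    and \<kappa>_prob: "\<And>s. s \<in> space S \<Longrightarrow> (\<integral>\<^sup>+y. ennreal (\<kappa> s y) \<partial>S) = 1"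
    and markov: "\<And>\<Phi>. \<Phi> \<in> borel_measurable (S \<Otimes>\<^sub>M S) \<Longrightarrow>
      (\<integral>\<^sup>+w. \<Phi> (X w, Y w) \<partial>P) = (\<integral>\<^sup>+w. \<integral>\<^sup>+y. \<Phi> (X w, y) * ennreal (\<kappa> (X w) y) \<partial>S \<partial>P)"
    and N: "2 \<le> N"
begin

abbreviation samples :: "(nat \<Rightarrow> 'w) measure" where
  "samples \<equiv> Pi\<^sub>M {1..N} (\<lambda>_. P)"

abbreviation points :: "(nat \<Rightarrow> 's) measure" where
  "points \<equiv> Pi\<^sub>M {1..N} (\<lambda>_. S)"

abbreviation pts :: "(nat \<Rightarrow> 'w) \<Rightarrow> nat \<Rightarrow> 's" where
  "pts \<omega> \<equiv> (\<lambda>k\<in>{1..N}. X (\<omega> k))"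

abbreviation kernel :: "(nat \<Rightarrow> 's) \<Rightarrow> nat \<Rightarrow> 's measure" where
  "kernel x n \<equiv> density S (\<lambda>y. ennreal (\<kappa> (x n) y))"

text \<open>The leave-one-out mixture density in the algorithm. It is a sum and not a mean, which is
  why the estimators below carry no factor \<open>1 / N\<close>.\<close>

definition den :: "nat \<Rightarrow> (nat \<Rightarrow> 's) \<Rightarrow> 's \<Rightarrow> real" where
  "den n x y = (\<Sum>k\<in>{1..N} - {n}. \<kappa> (x k) y)"

definition cmean :: "('s \<Rightarrow> real) \<Rightarrow> nat \<Rightarrow> (nat \<Rightarrow> 's) \<Rightarrow> real" where
  "cmean \<psi> n x = (\<integral>y. \<psi> y / den n x y * \<kappa> (x n) y \<partial>S)"

text \<open>The transition noise alone: given the starting states, these are independent centred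
  terms. The distance of the conditional means from the target integral is dealt with separately in
  \<open>cmean_bias\<close>.\<close>

definition dev :: "('s \<Rightarrow> real) \<Rightarrow> (nat \<Rightarrow> 'w) \<Rightarrow> real" where
  "dev \<psi> \<omega> = (\<Sum>n\<in>{1..N}. \<psi> (Y (\<omega> n)) / den n (pts \<omega>) (Y (\<omega> n)) - cmean \<psi> n (pts \<omega>))"

section \<open>Sub-Gaussian bounds given the starting states\<close>

lemma pts_measurable [measurable]: "pts \<in> samples \<rightarrow>\<^sub>M points"
  by measurable

text \<open>This is conditional independence in integral form. The terms with
  \<open>n \<noteq> j\<close> see trajectory \<open>j\<close> only through its starting state, so in
  the integral over this trajectory they form a factor \<open>G (X w)\<close>; the Markov identity
  then bounds what term \<open>j\<close> contributes, whatever the starting states are.\<close>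

lemma nn_integral_exp_sum_le:
  fixes F :: "nat \<Rightarrow> (nat \<Rightarrow> 's) \<Rightarrow> 's \<Rightarrow> real"
  assumes F: "\<And>n. n \<in> {1..N} \<Longrightarrow> (\<lambda>(x, y). F n x y) \<in> borel_measurable (points \<Otimes>\<^sub>M S)"
    and bound: "\<And>n x. n \<in> {1..N} \<Longrightarrow> x \<in> space points \<Longrightarrow>
      (\<integral>\<^sup>+y. ennreal (exp (F n x y)) * ennreal (\<kappa> (x n) y) \<partial>S) \<le> ennreal (exp c)"
    and "J \<subseteq> {1..N}"
  shows "(\<integral>\<^sup>+\<omega>. ennreal (exp (\<Sum>n\<in>J. F n (pts \<omega>) (Y (\<omega> n)))) \<partial>samples) \<le> ennreal (exp (c * card J))"
proof -
  interpret PS: product_sigma_finite "\<lambda>_::nat. P" by standard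
  have "finite J" using assms(3) finite_subset by blast
  then show ?thesis using assms(3)
  proof (induction J rule: finite_induct)
    case empty
    interpret prob_space samples by (rule prob_space_PiM) (rule P.prob_space_axioms)
    show ?case using emeasure_space_1 by simp
  next
    case (insert j J)
    then have j: "j \<in> {1..N}" and J: "J \<subseteq> {1..N}" by auto
    let ?R = "{1..N} - {j}"
    have ins: "insert j ?R = {1..N}" using j by auto
    have Fm: "(\<lambda>\<omega>. F n (pts \<omega>) (Y (\<omega> n))) \<in> borel_measurable samples" if "n \<in> {1..N}" for n
    proof -
      have "(\<lambda>\<omega>. Y (\<omega> n)) \<in> samples \<rightarrow>\<^sub>M S" using that by measurable
      from measurable_compose[OF measurable_Pair[OF pts_measurable this] F[OF that]] show ?thesis by simp
    qed
    define g where "g K \<omega> = ennreal (exp (\<Sum>n\<in>K. F n (pts \<omega>) (Y (\<omega> n))))" for K \<omega>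
    have g_meas: "g K \<in> borel_measurable samples" if "K \<subseteq> {1..N}" for K
      unfolding g_def using that Fm by (intro measurable_compose[OF _ measurable_ennreal] borel_measurable_exp
        borel_measurable_sum measurable_compose[OF _ borel_measurable_exp]) auto
    have "(\<integral>\<^sup>+\<omega>. g (insert j J) \<omega> \<partial>samples) = (\<integral>\<^sup>+x. \<integral>\<^sup>+w. g (insert j J) (x(j := w)) \<partial>P \<partial>Pi\<^sub>M ?R (\<lambda>_. P))"
      by (rule PS.product_nn_integral_insert[of ?R j "g (insert j J)", unfolded ins, OF _ _ g_meas[OF insert.prems]]) auto
    \<comment> \<open>Coordinate \<open>j\<close> cannot be dropped once its term has been bounded,
      since the other terms still depend on its starting state. The bound is therefore inserted
      under the integral over \<open>w\<close>, and the product integral is reassembled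
      afterwards.\<close>
    also have "\<dots> \<le> (\<integral>\<^sup>+x. \<integral>\<^sup>+w. g J (x(j := w)) * ennreal (exp c) \<partial>P \<partial>Pi\<^sub>M ?R (\<lambda>_. P))"
    proof (rule nn_integral_mono)
      fix x assume x: "x \<in> space (Pi\<^sub>M ?R (\<lambda>_. P))"
      \<comment> \<open>The vector of starting states as a function of the one that is being
        integrated out.\<close>
      define x' where "x' s = (\<lambda>k\<in>{1..N}. if k = j then s else X (x k))" for s
      have xk: "x k \<in> space P" if "k \<in> ?R" for k using x that unfolding space_PiM by (rule PiE_mem)
      have x'_meas: "x' \<in> S \<rightarrow>\<^sub>M points"
        unfolding x'_def
      proof (rule measurable_restrict)
        fix k assume "k \<in> {1..N}"
        then show "(\<lambda>s. if k = j then s else X (x k)) \<in> S \<rightarrow>\<^sub>M S"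
          using measurable_space[OF X xk[of k]] by (cases "k = j") (simp_all add: measurable_const)
      qed
      have pts_eq: "pts (x(j := w)) = x' (X w)" for w unfolding x'_def by (rule restrict_ext) simp
      have Yn: "Y (x n) \<in> space S" if "n \<in> J" for n
        using that J insert.hyps by (intro measurable_space[OF Y] xk) auto
      define G where "G s = ennreal (exp (\<Sum>n\<in>J. F n (x' s) (Y (x n))))" for s
      have FG: "(\<lambda>s. F n (x' s) (Y (x n))) \<in> borel_measurable S" if "n \<in> J" for n
        using measurable_compose[OF _ F[of n], of "\<lambda>s. (x' s, Y (x n))" S] that J x'_meas Yn[OF that] by auto
      have G_meas: "G \<in> borel_measurable S"
        unfolding G_def using FG by (intro measurable_compose[OF _ measurable_ennreal]
          measurable_compose[OF _ borel_measurable_exp] borel_measurable_sum) auto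
      have Fj: "(\<lambda>(s, y). F j (x' s) y) \<in> borel_measurable (S \<Otimes>\<^sub>M S)"
      proof -
        have "(\<lambda>p. (x' (fst p), snd p)) \<in> S \<Otimes>\<^sub>M S \<rightarrow>\<^sub>M points \<Otimes>\<^sub>M S"
          using x'_meas by (intro measurable_Pair measurable_compose[OF measurable_fst] measurable_snd)
        from measurable_compose[OF this F[OF j]] show ?thesis by (simp add: split_def)
      qed
      define \<Phi> where "\<Phi> = (\<lambda>(s, y). G s * ennreal (exp (F j (x' s) y)))"
      have \<Phi>_meas: "\<Phi> \<in> borel_measurable (S \<Otimes>\<^sub>M S)"
        unfolding \<Phi>_def split_def
        using measurable_compose[OF measurable_fst G_meas] measurable_compose[OF Fj measurable_compose[OF borel_measurable_exp measurable_ennreal]]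
        by (intro borel_measurable_times_ennreal) (auto simp: split_def)
      have gJ: "g J (x(j := w)) = G (X w)" for w
        unfolding g_def G_def pts_eq using insert.hyps by (intro arg_cong[where f=ennreal] arg_cong[where f=exp] sum.cong) auto
      have "g (insert j J) (x(j := w)) = \<Phi> (X w, Y w)" for w
      proof -
        have "g (insert j J) (x(j := w)) = g J (x(j := w)) * ennreal (exp (F j (x' (X w)) (Y w)))"
          unfolding g_def pts_eq using insert.hyps by (simp add: exp_add ennreal_mult' mult.commute)
        then show ?thesis by (simp add: \<Phi>_def gJ)
      qed
      then have "(\<integral>\<^sup>+w. g (insert j J) (x(j := w)) \<partial>P) = (\<integral>\<^sup>+w. \<integral>\<^sup>+y. \<Phi> (X w, y) * ennreal (\<kappa> (X w) y) \<partial>S \<partial>P)"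
        using markov[OF \<Phi>_meas] by simp
      also have "\<dots> \<le> (\<integral>\<^sup>+w. G (X w) * ennreal (exp c) \<partial>P)"
      proof (rule nn_integral_mono)
        fix w assume w: "w \<in> space P"
        then have Xw: "X w \<in> space S" by (rule measurable_space[OF X])
        have x'w: "x' (X w) \<in> space points" by (rule measurable_space[OF x'_meas Xw])
        have m1: "(\<lambda>y. ennreal (exp (F j (x' (X w)) y)) * ennreal (\<kappa> (X w) y)) \<in> borel_measurable S"
        proof -
          have [measurable]: "F j (x' (X w)) \<in> borel_measurable S" "\<kappa> (X w) \<in> borel_measurable S"
            using measurable_Pair2[OF Fj Xw] measurable_Pair2[OF \<kappa>_meas Xw] by simp_all
          show ?thesis by measurable
        qed
        have "(\<integral>\<^sup>+y. \<Phi> (X w, y) * ennreal (\<kappa> (X w) y) \<partial>S) =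
            (\<integral>\<^sup>+y. G (X w) * (ennreal (exp (F j (x' (X w)) y)) * ennreal (\<kappa> (X w) y)) \<partial>S)"
          by (simp add: \<Phi>_def mult.assoc)
        also have "\<dots> = G (X w) * (\<integral>\<^sup>+y. ennreal (exp (F j (x' (X w)) y)) * ennreal (\<kappa> (X w) y) \<partial>S)"
          by (rule nn_integral_cmult[OF m1])
        also have "\<dots> \<le> G (X w) * ennreal (exp c)"
          using bound[OF j x'w] j by (intro mult_left_mono) (auto simp: x'_def)
        finally show "(\<integral>\<^sup>+y. \<Phi> (X w, y) * ennreal (\<kappa> (X w) y) \<partial>S) \<le> G (X w) * ennreal (exp c)" .
      qed
      finally show "(\<integral>\<^sup>+w. g (insert j J) (x(j := w)) \<partial>P) \<le> (\<integral>\<^sup>+w. g J (x(j := w)) * ennreal (exp c) \<partial>P)"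
        by (simp add: gJ)
    qed
    also have "\<dots> = (\<integral>\<^sup>+\<omega>. g J \<omega> * ennreal (exp c) \<partial>samples)"
      using g_meas[OF J]
      by (intro PS.product_nn_integral_insert[of ?R j "\<lambda>\<omega>. g J \<omega> * ennreal (exp c)", unfolded ins, symmetric])
        (auto simp del: One_nat_def)
    also have "\<dots> = (\<integral>\<^sup>+\<omega>. g J \<omega> \<partial>samples) * ennreal (exp c)"
      using g_meas[OF J] by (rule nn_integral_multc)
    also have "\<dots> \<le> ennreal (exp (c * card J)) * ennreal (exp c)"
      using insert.IH[OF J] unfolding g_def by (rule mult_right_mono) simp
    also have "\<dots> = ennreal (exp (c * card (insert j J)))"
      using insert.hyps by (simp flip: ennreal_mult exp_add add: algebra_simps)
    finally show ?case unfolding g_def .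
  qed
qed

lemma \<kappa>_point_measurable:
  assumes "k \<in> {1..N}"
  shows "(\<lambda>p. \<kappa> (fst p k) (snd p)) \<in> borel_measurable (points \<Otimes>\<^sub>M S)"
proof -
  have "(\<lambda>p. (fst p k, snd p)) \<in> points \<Otimes>\<^sub>M S \<rightarrow>\<^sub>M S \<Otimes>\<^sub>M S"
    using assms by (intro measurable_Pair measurable_snd measurable_compose[OF measurable_fst measurable_component_singleton])
  from measurable_compose[OF this \<kappa>_meas] show ?thesis by simp
qed

lemma den_measurable:
  assumes "n \<in> {1..N}"
  shows "(\<lambda>(x, y). den n x y) \<in> borel_measurable (points \<Otimes>\<^sub>M S)"
  unfolding den_def split_def by (intro borel_measurable_sum \<kappa>_point_measurable) auto

lemma den_ge:
  assumes "n \<in> {1..N}" "x \<in> space points" "y \<in> space S"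
  shows "real (N - 1) * \<delta> \<le> den n x y"
proof -
  have "(\<Sum>k\<in>{1..N} - {n}. \<delta>) \<le> den n x y"
    unfolding den_def
  proof (rule sum_mono)
    fix k assume "k \<in> {1..N} - {n}"
    then have "x k \<in> space S" using assms(2) by (auto simp: space_PiM PiE_iff)
    then show "\<delta> \<le> \<kappa> (x k) y" using \<kappa>_bounds assms(3) by blast
  qed
  then show ?thesis using assms(1) by simp
qed

lemma den_pos:
  assumes "n \<in> {1..N}" "x \<in> space points" "y \<in> space S"
  shows "0 < den n x y"
  using den_ge[OF assms] N \<delta> by (smt (verit) mult_pos_pos of_nat_0_less_iff zero_less_diff One_nat_def Suc_1 Suc_le_eq)

lemma cmean_measurable:
  assumes n: "n \<in> {1..N}" and \<psi>: "\<psi> \<in> borel_measurable S"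
  shows "cmean \<psi> n \<in> borel_measurable points"
proof -
  have "(\<lambda>(x, y). \<psi> y / den n x y * \<kappa> (x n) y) \<in> borel_measurable (points \<Otimes>\<^sub>M S)"
    using den_measurable[OF n] measurable_compose[OF measurable_snd \<psi>]
    unfolding split_def by (intro borel_measurable_times borel_measurable_divide \<kappa>_point_measurable n)
  then show ?thesis unfolding cmean_def[abs_def] by (rule borel_measurable_lebesgue_integral)
qed

lemma section_measurable:
  assumes "n \<in> {1..N}" "x \<in> space points"
  shows "den n x \<in> borel_measurable S" "\<kappa> (x n) \<in> borel_measurable S"
proof -
  show "den n x \<in> borel_measurable S"
    using measurable_Pair2[OF den_measurable[OF assms(1)] assms(2)] by simp
  have "x n \<in> space S" using assms by (auto simp: space_PiM)
  then show "\<kappa> (x n) \<in> borel_measurable S" using measurable_Pair2[OF \<kappa>_meas] by simp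
qed

lemma quotient_bound:
  assumes "n \<in> {1..N}" "x \<in> space points" "y \<in> space S" "\<bar>\<psi> y\<bar> \<le> c"
  shows "\<bar>\<psi> y / den n x y\<bar> \<le> c / (real (N - 1) * \<delta>)"
proof -
  have "0 < real (N - 1) * \<delta>" using N \<delta> by simp
  then have "\<bar>\<psi> y\<bar> / den n x y \<le> c / (real (N - 1) * \<delta>)"
    using assms den_ge[OF assms(1-3)] by (intro frac_le) auto
  then show ?thesis using den_pos[OF assms(1-3)] by (simp add: abs_divide)
qed

lemma cmean_eq:
  assumes n: "n \<in> {1..N}" and x: "x \<in> space points" and \<psi>: "\<psi> \<in> borel_measurable S"
  shows "cmean \<psi> n x = (\<integral>y. \<psi> y / den n x y \<partial>kernel x n)"
proof -
  have xn: "x n \<in> space S" using n x by (auto simp: space_PiM)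
  show ?thesis unfolding cmean_def
    using \<psi> section_measurable[OF n x] \<kappa>_bounds[OF xn] \<delta>
    by (subst integral_density) (auto intro!: AE_I2 Bochner_Integration.integral_cong simp: mult.commute, fastforce)
qed

lemma kernel_prob:
  assumes n: "n \<in> {1..N}" and x: "x \<in> space points"
  shows "prob_space (kernel x n)"
proof
  have xn: "x n \<in> space S" using n x by (auto simp: space_PiM)
  show "emeasure (kernel x n) (space (kernel x n)) = 1"
    using \<kappa>_prob[OF xn] section_measurable[OF n x] by (simp add: emeasure_density cong: nn_integral_cong)
qed

lemma kernel_interval:
  assumes n: "n \<in> {1..N}" and x: "x \<in> space points" and \<psi>: "\<psi> \<in> borel_measurable S"
    and c: "\<And>y. y \<in> space S \<Longrightarrow> \<bar>\<psi> y\<bar> \<le> c"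
  shows "interval_bounded_random_variable (kernel x n) (\<lambda>y. \<psi> y / den n x y)
    (- (c / (real (N - 1) * \<delta>))) (c / (real (N - 1) * \<delta>))"
proof -
  interpret K: prob_space "kernel x n" by (rule kernel_prob[OF n x])
  show ?thesis
  proof
    show "K.random_variable borel (\<lambda>y. \<psi> y / den n x y)"
      using \<psi> section_measurable[OF n x] by measurable
    show "AE y in kernel x n. \<psi> y / den n x y
        \<in> {- (c / (real (N - 1) * \<delta>))..c / (real (N - 1) * \<delta>)}"
    proof (rule AE_I2)
      fix y assume "y \<in> space (kernel x n)"
      then have "\<bar>\<psi> y / den n x y\<bar> \<le> c / (real (N - 1) * \<delta>)"
        using quotient_bound[where \<psi> = \<psi> and c = c, OF n x _ c] by simp
      then show "\<psi> y / den n x y \<in> {- (c / (real (N - 1) * \<delta>))..c / (real (N - 1) * \<delta>)}"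
        unfolding abs_le_iff by simp
    qed
  qed
qed

text \<open>Given the starting states, the quotient lies in an interval of length
  \<open>2 * ?a\<close>, so Hoeffding's lemma gives the exponent \<open>l\<^sup>2 * (2 * ?a)\<^sup>2
  / 8 = l\<^sup>2 * ?a\<^sup>2 / 2\<close>.\<close>

lemma kernel_mgf:
  assumes n: "n \<in> {1..N}" and x: "x \<in> space points" and \<psi>: "\<psi> \<in> borel_measurable S"
    and c: "\<And>y. y \<in> space S \<Longrightarrow> \<bar>\<psi> y\<bar> \<le> c"
  shows "(\<integral>\<^sup>+y. ennreal (exp (l * (\<psi> y / den n x y - cmean \<psi> n x))) * ennreal (\<kappa> (x n) y) \<partial>S)
    \<le> ennreal (exp (l\<^sup>2 * (c / (real (N - 1) * \<delta>))\<^sup>2 / 2))"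
proof -
  let ?M = "kernel x n" and ?a = "c / (real (N - 1) * \<delta>)"
  note meas = \<psi> section_measurable[OF n x]
  \<comment> \<open>Hoeffding's lemma is available for positive \<open>l\<close>. The quantification
    over \<open>\<phi>\<close> allows the negative case to be reduced to it by passing to
    \<open>- \<psi>\<close>.\<close>
  have pos: "(\<integral>\<^sup>+y. ennreal (exp (l * (\<phi> y / den n x y - cmean \<phi> n x))) \<partial>?M) \<le> ennreal (exp (l\<^sup>2 * ?a\<^sup>2 / 2))"
    if "0 < l" "\<phi> \<in> borel_measurable S" "\<And>y. y \<in> space S \<Longrightarrow> \<bar>\<phi> y\<bar> \<le> c" for l \<phi>
  proof -
    interpret interval_bounded_random_variable ?M "\<lambda>y. \<phi> y / den n x y" "- ?a" ?a
      using kernel_interval[OF n x that(2,3)] .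
    have "?a - - ?a = 2 * ?a" by simp
    then have eq: "l\<^sup>2 * (?a - - ?a)\<^sup>2 / 8 = l\<^sup>2 * ?a\<^sup>2 / 2" by (simp only: power_mult_distrib) simp
    show ?thesis using Hoeffdings_lemma_nn_integral[OF that(1)] unfolding eq cmean_eq[OF n x that(2)] .
  qed
  have "(\<integral>\<^sup>+y. ennreal (exp (l * (\<psi> y / den n x y - cmean \<psi> n x))) \<partial>?M) \<le> ennreal (exp (l\<^sup>2 * ?a\<^sup>2 / 2))"
  proof (cases l "0::real" rule: linorder_cases)
    case greater
    then show ?thesis using pos \<psi> c by blast
  next
    case equal
    interpret K: prob_space ?M by (rule kernel_prob[OF n x])
    show ?thesis using equal K.emeasure_space_1 by simp
  next
    case less
    have "cmean (\<lambda>y. - \<psi> y) n x = - cmean \<psi> n x" unfolding cmean_def by simp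
    then show ?thesis using pos[of "- l" "\<lambda>y. - \<psi> y"] less \<psi> c by (simp add: algebra_simps)
  qed
  also have "(\<integral>\<^sup>+y. ennreal (exp (l * (\<psi> y / den n x y - cmean \<psi> n x))) \<partial>?M) =
    (\<integral>\<^sup>+y. ennreal (exp (l * (\<psi> y / den n x y - cmean \<psi> n x))) * ennreal (\<kappa> (x n) y) \<partial>S)"
    using meas by (subst nn_integral_density) (auto simp: mult.commute)
  finally show ?thesis .
qed

lemma N_sub_1: "real N / 2 \<le> real (N - 1)"
  using N by (simp add: of_nat_diff)

lemma dev_measurable:
  assumes "\<psi> \<in> borel_measurable S"
  shows "dev \<psi> \<in> borel_measurable samples"
  unfolding dev_def[abs_def]
proof (intro borel_measurable_sum borel_measurable_diff borel_measurable_divide)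
  fix n assume n: "n \<in> {1..N}"
  then have Yn: "(\<lambda>\<omega>. Y (\<omega> n)) \<in> samples \<rightarrow>\<^sub>M S" by measurable
  then show "(\<lambda>\<omega>. \<psi> (Y (\<omega> n))) \<in> borel_measurable samples" using assms by measurable
  show "(\<lambda>\<omega>. den n (pts \<omega>) (Y (\<omega> n))) \<in> borel_measurable samples"
    using measurable_compose[OF measurable_Pair[OF pts_measurable Yn] den_measurable[OF n]] by simp
  show "(\<lambda>\<omega>. cmean \<psi> n (pts \<omega>)) \<in> borel_measurable samples"
    using measurable_compose[OF pts_measurable cmean_measurable[OF n assms]] .
qed

text \<open>The \<open>N\<close> terms have variance proxy
  \<open>(c / ((N - 1) * \<delta>))\<^sup>2\<close> each, and these add up. The factor 2 in the
  scale comes from \<open>N / 2 \<le> N - 1\<close>.\<close>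

lemma dev_mgf:
  assumes \<psi>: "\<psi> \<in> borel_measurable S" and c: "\<And>y. y \<in> space S \<Longrightarrow> \<bar>\<psi> y\<bar> \<le> c"
  shows "(\<integral>\<^sup>+\<omega>. ennreal (exp (l * dev \<psi> \<omega>)) \<partial>samples) \<le> ennreal (exp (l\<^sup>2 * (2 * c / (\<delta> * sqrt N))\<^sup>2 / 2))"
proof -
  let ?a = "c / (real (N - 1) * \<delta>)"
  have "(\<integral>\<^sup>+\<omega>. ennreal (exp (\<Sum>n\<in>{1..N}. l * (\<psi> (Y (\<omega> n)) / den n (pts \<omega>) (Y (\<omega> n)) - cmean \<psi> n (pts \<omega>)))) \<partial>samples)
      \<le> ennreal (exp (l\<^sup>2 * ?a\<^sup>2 / 2 * card {1..N}))"
  proof (rule nn_integral_exp_sum_le[where F = "\<lambda>n x y. l * (\<psi> y / den n x y - cmean \<psi> n x)"])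
    fix n assume n: "n \<in> {1..N}"
    show "(\<lambda>(x, y). l * (\<psi> y / den n x y - cmean \<psi> n x)) \<in> borel_measurable (points \<Otimes>\<^sub>M S)"
      using den_measurable[OF n] measurable_compose[OF measurable_snd \<psi>]
        measurable_compose[OF measurable_fst cmean_measurable[OF n \<psi>]]
      unfolding split_def by (intro borel_measurable_times borel_measurable_const borel_measurable_diff borel_measurable_divide)
  qed (use kernel_mgf[OF _ _ \<psi> c] in auto)
  also have "\<dots> \<le> ennreal (exp (l\<^sup>2 * (2 * c / (\<delta> * sqrt N))\<^sup>2 / 2))"
  proof (intro ennreal_leI, subst exp_le_cancel_iff)
    have "(real N)\<^sup>2 / 4 \<le> (real (N - 1))\<^sup>2"
      using power_mono[OF N_sub_1, of 2] by (simp add: power_divide)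
    then have "?a\<^sup>2 \<le> c\<^sup>2 / ((real N)\<^sup>2 / 4 * \<delta>\<^sup>2)"
      using N \<delta> unfolding power_divide power_mult_distrib by (intro divide_left_mono mult_right_mono) auto
    then have "?a\<^sup>2 * N \<le> c\<^sup>2 / ((real N)\<^sup>2 / 4 * \<delta>\<^sup>2) * N" by (rule mult_right_mono) simp
    also have "\<dots> = (2 * c / (\<delta> * sqrt N))\<^sup>2"
      using N by (simp add: power_divide power_mult_distrib power2_eq_square field_simps)
    finally have "l\<^sup>2 * (?a\<^sup>2 * N) \<le> l\<^sup>2 * (2 * c / (\<delta> * sqrt N))\<^sup>2" by (rule mult_left_mono) simp
    then show "l\<^sup>2 * ?a\<^sup>2 / 2 * card {1..N} \<le> l\<^sup>2 * (2 * c / (\<delta> * sqrt N))\<^sup>2 / 2" by (simp add: mult.assoc)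
  qed
  finally show ?thesis by (simp add: dev_def sum_distrib_left)
qed

lemma cmean_integrable:
  assumes n: "n \<in> {1..N}" and x: "x \<in> space points" and \<psi>: "\<psi> \<in> borel_measurable S"
    and c: "\<And>y. y \<in> space S \<Longrightarrow> \<bar>\<psi> y\<bar> \<le> c"
  shows "integrable S (\<lambda>y. \<psi> y / den n x y * \<kappa> (x n) y)"
proof (rule integrable_const_bound)
  have xn: "x n \<in> space S" using n x by (auto simp: space_PiM)
  show "AE y in S. norm (\<psi> y / den n x y * \<kappa> (x n) y) \<le> c / (real (N - 1) * \<delta>) * \<Lambda>"
  proof (rule AE_I2)
    fix y assume y: "y \<in> space S"
    have "\<bar>\<kappa> (x n) y\<bar> \<le> \<Lambda>" using \<kappa>_bounds[OF xn y] \<delta> by simp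
    then show "norm (\<psi> y / den n x y * \<kappa> (x n) y) \<le> c / (real (N - 1) * \<delta>) * \<Lambda>"
      using quotient_bound[where \<psi> = \<psi> and c = c, OF n x y c[OF y]] c[OF y] \<delta>
      unfolding real_norm_def abs_mult by (intro mult_mono) auto
  qed
  show "(\<lambda>y. \<psi> y / den n x y * \<kappa> (x n) y) \<in> borel_measurable S"
    using \<psi> section_measurable[OF n x] by measurable
qed

lemma pts_space: "\<omega> \<in> space samples \<Longrightarrow> pts \<omega> \<in> space points"
  by (rule measurable_space[OF pts_measurable])

text \<open>Through this linearity an increment of the process is itself a \<open>dev\<close>, so
  \<open>dev_mgf\<close> with the Lipschitz bound in place of \<open>c\<close> gives the
  sub-Gaussian increments that chaining asks for. The bounds on the functions ensure that the
  conditional means are genuine integrals.\<close>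

lemma dev_diff:
  assumes \<omega>: "\<omega> \<in> space samples"
    and \<psi>: "\<psi> \<in> borel_measurable S" "\<And>y. y \<in> space S \<Longrightarrow> \<bar>\<psi> y\<bar> \<le> c"
    and \<phi>: "\<phi> \<in> borel_measurable S" "\<And>y. y \<in> space S \<Longrightarrow> \<bar>\<phi> y\<bar> \<le> c"
  shows "dev \<psi> \<omega> - dev \<phi> \<omega> = dev (\<lambda>y. \<psi> y - \<phi> y) \<omega>"
proof -
  have "cmean (\<lambda>y. \<psi> y - \<phi> y) n (pts \<omega>) = cmean \<psi> n (pts \<omega>) - cmean \<phi> n (pts \<omega>)" if "n \<in> {1..N}" for n
    unfolding cmean_def
    using cmean_integrable[OF that pts_space[OF \<omega>] \<psi>] cmean_integrable[OF that pts_space[OF \<omega>] \<phi>]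
    by (subst Bochner_Integration.integral_diff[symmetric]) (auto simp: diff_divide_distrib left_diff_distrib)
  then show ?thesis
    unfolding dev_def sum_subtractf[symmetric] by (intro sum.cong) (auto simp: diff_divide_distrib)
qed

text \<open>Supplies the pathwise Lipschitz condition of \<open>chaining\<close>. A bound that does
  not decay in \<open>N\<close> is enough there.\<close>

lemma abs_dev_le:
  assumes \<omega>: "\<omega> \<in> space samples" and \<psi>: "\<psi> \<in> borel_measurable S" "\<And>y. y \<in> space S \<Longrightarrow> \<bar>\<psi> y\<bar> \<le> c"
  shows "\<bar>dev \<psi> \<omega>\<bar> \<le> 4 / \<delta> * c"
proof -
  let ?a = "c / (real (N - 1) * \<delta>)"
  have Yn: "Y (\<omega> n) \<in> space S" if "n \<in> {1..N}" for n
    using \<omega> that by (intro measurable_space[OF Y]) (auto simp: space_PiM)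
  have c0: "0 \<le> c" using \<psi>(2)[OF Yn[of 1]] N by force
  have "\<bar>cmean \<psi> n (pts \<omega>)\<bar> \<le> ?a" if n: "n \<in> {1..N}" for n
  proof -
    interpret prob_space "kernel (pts \<omega>) n" by (rule kernel_prob[OF n pts_space[OF \<omega>]])
    show ?thesis
      unfolding cmean_eq[OF n pts_space[OF \<omega>] \<psi>(1)]
      using quotient_bound[where \<psi> = \<psi> and c = c, OF n pts_space[OF \<omega>] _ \<psi>(2)]
      by (intro abs_expectation_le) simp
  qed
  then have "\<bar>dev \<psi> \<omega>\<bar> \<le> (\<Sum>n\<in>{1..N}. ?a + ?a)"
    unfolding dev_def using quotient_bound[where \<psi> = \<psi> and c = c, OF _ pts_space[OF \<omega>] Yn \<psi>(2)[OF Yn]]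
    by (intro order_trans[OF sum_abs] sum_mono order_trans[OF abs_triangle_ineq4] add_mono) auto
  also have "\<dots> = real N / real (N - 1) * (2 * c / \<delta>)"
  proof -
    have "(\<Sum>n\<in>{1..N}. c / (m * \<delta>) + c / (m * \<delta>)) = real N / m * (2 * c / \<delta>)" for m :: real
      by (simp add: mult_ac)
    then show ?thesis .
  qed
  also have "\<dots> \<le> 2 * (2 * c / \<delta>)"
    using N_sub_1 N c0 \<delta> by (intro mult_right_mono) (auto simp: divide_simps)
  also have "\<dots> = 4 / \<delta> * c" by simp
  finally show ?thesis .
qed

text \<open>With the full sum \<open>T\<close> as denominator the coefficients
  \<open>\<kappa> (x n) y / T\<close> would add up to one and there would be no bias. Leaving out
  index \<open>n\<close> raises a coefficient by
  \<open>\<kappa>\<^sup>2 / (T * (T - \<kappa>))\<close>, where \<open>\<kappa>\<close> stands for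
  \<open>\<kappa> (x n) y\<close>; this is at most
  \<open>(\<Lambda> / \<delta>)\<^sup>2 / (N * (N - 1))\<close>, and there are \<open>N\<close> such
  terms.\<close>

lemma cmean_bias:
  assumes x: "x \<in> space points"
    and \<psi>: "\<psi> \<in> borel_measurable S" "\<And>y. y \<in> space S \<Longrightarrow> \<bar>\<psi> y\<bar> \<le> c"
  shows "\<bar>(\<Sum>n\<in>{1..N}. cmean \<psi> n x) - (\<integral>y. \<psi> y \<partial>S)\<bar> \<le> (\<Lambda> / \<delta>)\<^sup>2 / real (N - 1) * (\<integral>y. \<bar>\<psi> y\<bar> \<partial>S)"
proof -
  have \<psi>i: "integrable S \<psi>" using \<psi> by (intro integrable_const_bound[of _ c]) auto
  have I: "integrable S (\<lambda>y. (\<Sum>n\<in>{1..N}. \<psi> y / den n x y * \<kappa> (x n) y) - \<psi> y)"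
    by (intro Bochner_Integration.integrable_diff Bochner_Integration.integrable_sum \<psi>i cmean_integrable[OF _ x \<psi>])
  have "(\<Sum>n\<in>{1..N}. cmean \<psi> n x) - (\<integral>y. \<psi> y \<partial>S)
      = (\<integral>y. (\<Sum>n\<in>{1..N}. \<psi> y / den n x y * \<kappa> (x n) y) - \<psi> y \<partial>S)"
    using cmean_integrable[OF _ x \<psi>] \<psi>i
    by (simp only: cmean_def Bochner_Integration.integral_diff Bochner_Integration.integrable_sum
        Bochner_Integration.integral_sum)
  also have "\<bar>\<dots>\<bar> \<le> (\<integral>y. \<bar>(\<Sum>n\<in>{1..N}. \<psi> y / den n x y * \<kappa> (x n) y) - \<psi> y\<bar> \<partial>S)"
    by (rule integral_abs_bound)
  also have "\<dots> \<le> (\<integral>y. (\<Lambda> / \<delta>)\<^sup>2 / real (N - 1) * \<bar>\<psi> y\<bar> \<partial>S)"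
  proof (rule integral_mono)
    show "integrable S (\<lambda>y. \<bar>(\<Sum>n\<in>{1..N}. \<psi> y / den n x y * \<kappa> (x n) y) - \<psi> y\<bar>)"
      using I by (rule integrable_abs)
    show "integrable S (\<lambda>y. (\<Lambda> / \<delta>)\<^sup>2 / real (N - 1) * \<bar>\<psi> y\<bar>)" using \<psi>i by auto
    fix y assume y: "y \<in> space S"
    define T where "T = (\<Sum>k\<in>{1..N}. \<kappa> (x k) y)"
    have xk: "\<delta> \<le> \<kappa> (x k) y" "\<kappa> (x k) y \<le> \<Lambda>" if "k \<in> {1..N}" for k
      using \<kappa>_bounds[OF _ y, of "x k"] x that by (auto simp: space_PiM PiE_iff)
    have "(\<Sum>k\<in>{1..N}. \<delta>) \<le> T" unfolding T_def using xk by (intro sum_mono) auto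
    then have T: "real N * \<delta> \<le> T" by simp
    have N\<delta>: "0 < real N * \<delta>" "0 < real (N - 1) * \<delta>" using N \<delta> by auto
    have denT: "den n x y = T - \<kappa> (x n) y" if "n \<in> {1..N}" for n
      unfolding den_def T_def using that by (simp add: sum_diff1)
    have e: "1 / den n x y * \<kappa> (x n) y - \<kappa> (x n) y / T \<in> {0..(\<Lambda> / \<delta>)\<^sup>2 / (real N * real (N - 1))}" if n: "n \<in> {1..N}" for n
    proof -
      have dp: "0 < den n x y" "0 < T" using den_pos[OF n x y] T N\<delta> by auto
      have \<Lambda>: "0 \<le> \<Lambda>" using xk[OF n] \<delta> by simp
      have "1 / den n x y * \<kappa> (x n) y - \<kappa> (x n) y / T = \<kappa> (x n) y * (T - den n x y) / (T * den n x y)"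
        using dp by (simp add: field_simps)
      also have "T - den n x y = \<kappa> (x n) y" using denT[OF n] by simp
      finally have eq: "1 / den n x y * \<kappa> (x n) y - \<kappa> (x n) y / T = \<kappa> (x n) y * \<kappa> (x n) y / (T * den n x y)" .
      have "\<dots> \<le> \<Lambda> * \<Lambda> / ((real N * \<delta>) * (real (N - 1) * \<delta>))"
        using xk[OF n] \<delta> T den_ge[OF n x y] N\<delta> \<Lambda> dp
        by (intro frac_le mult_mono mult_pos_pos[OF N\<delta>] mult_nonneg_nonneg) (auto simp del: of_nat_diff)
      also have "\<dots> = (\<Lambda> / \<delta>)\<^sup>2 / (real N * real (N - 1))" by (simp add: power2_eq_square)
      finally show ?thesis using eq dp xk[OF n] \<delta> by simp
    qed
    have T0: "0 < T" using T N\<delta> by simp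
    then have one: "(\<Sum>n\<in>{1..N}. \<kappa> (x n) y / T) = 1" by (simp add: T_def flip: sum_divide_distrib)
    have "(\<Sum>n\<in>{1..N}. \<psi> y / den n x y * \<kappa> (x n) y) - \<psi> y
        = \<psi> y * ((\<Sum>n\<in>{1..N}. 1 / den n x y * \<kappa> (x n) y) - (\<Sum>n\<in>{1..N}. \<kappa> (x n) y / T))"
      unfolding one right_diff_distrib sum_distrib_left by (simp)
    also have "\<dots> = \<psi> y * (\<Sum>n\<in>{1..N}. 1 / den n x y * \<kappa> (x n) y - \<kappa> (x n) y / T)"
      by (simp add: sum_subtractf)
    also have "\<bar>\<dots>\<bar> \<le> \<bar>\<psi> y\<bar> * (\<Sum>n\<in>{1..N}. (\<Lambda> / \<delta>)\<^sup>2 / (real N * real (N - 1)))"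
      unfolding abs_mult using e by (intro mult_left_mono order_trans[OF sum_abs] sum_mono) auto
    also have "\<dots> = (\<Lambda> / \<delta>)\<^sup>2 / real (N - 1) * \<bar>\<psi> y\<bar>" using N by simp
    finally show "\<bar>(\<Sum>n\<in>{1..N}. \<psi> y / den n x y * \<kappa> (x n) y) - \<psi> y\<bar> \<le> (\<Lambda> / \<delta>)\<^sup>2 / real (N - 1) * \<bar>\<psi> y\<bar>" .
  qed
  finally show ?thesis by simp
qed

text \<open>In the application \<open>t\<close> is a state-action pair, \<open>\<theta> t\<close>
  its transition density, and \<open>g\<close> either the value function or the constant one. The
  process \<open>dev (\<psi> t)\<close> with \<open>\<psi> t = \<theta> t * g\<close> is bounded by
  chaining; the bias is deterministic and is added to the majorant as a constant.\<close>

theorem importance_sampling_uniform: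
  fixes \<theta> :: "'t \<Rightarrow> 's \<Rightarrow> real"
  assumes T: "Metric_space T \<rho>" "t0 \<in> T" "dudley T \<rho> < \<infinity>"
    and \<theta>_meas: "\<And>t. t \<in> T \<Longrightarrow> \<theta> t \<in> borel_measurable S"
    and \<theta>: "\<And>t y. t \<in> T \<Longrightarrow> y \<in> space S \<Longrightarrow> 0 \<le> \<theta> t y \<and> \<theta> t y \<le> \<Lambda>"
    and \<theta>_int: "\<And>t. t \<in> T \<Longrightarrow> (\<integral>y. \<theta> t y \<partial>S) = 1"
    and \<theta>_lip: "\<And>s t y. s \<in> T \<Longrightarrow> t \<in> T \<Longrightarrow> y \<in> space S \<Longrightarrow> \<bar>\<theta> s y - \<theta> t y\<bar> \<le> L * \<rho> s t"
    and L: "0 < L" and g: "g \<in> borel_measurable S" "\<And>y. y \<in> space S \<Longrightarrow> \<bar>g y\<bar> \<le> K" and K: "0 < K"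
  obtains B where "B \<in> borel_measurable samples"
    "(\<integral>\<^sup>+\<omega>. B \<omega> \<partial>samples) \<le> ennreal (K / sqrt N) *
       (ennreal (112 * L / \<delta>) * dudley T \<rho> + ennreal (8 * \<Lambda> / \<delta> + 2 * (\<Lambda> / \<delta>)\<^sup>2))"
    "\<And>\<omega> t. \<omega> \<in> space samples \<Longrightarrow> t \<in> T \<Longrightarrow>
       ennreal \<bar>(\<Sum>n\<in>{1..N}. \<theta> t (Y (\<omega> n)) * g (Y (\<omega> n)) / den n (pts \<omega>) (Y (\<omega> n))) - (\<integral>y. \<theta> t y * g y \<partial>S)\<bar> \<le> B \<omega>"
proof -
  interpret Metric_space T \<rho> by fact
  have PP: "prob_space samples" by (rule prob_space_PiM) (rule P.prob_space_axioms)
  have "space S \<noteq> {}"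
    using measurable_space[OF X] P.not_empty by blast
  then have \<Lambda>0: "0 < \<Lambda>" using \<kappa>_bounds \<delta> by force
  define \<psi> where "\<psi> t y = \<theta> t y * g y" for t y
  have \<psi>_meas: "\<psi> t \<in> borel_measurable S" if "t \<in> T" for t
    unfolding \<psi>_def[abs_def] using \<theta>_meas[OF that] g(1) by measurable
  have \<psi>_bd: "\<bar>\<psi> t y\<bar> \<le> K * \<Lambda>" if "t \<in> T" "y \<in> space S" for t y
    unfolding \<psi>_def abs_mult using \<theta>[OF that] g(2)[OF that(2)] mult_mono[of "\<bar>\<theta> t y\<bar>" \<Lambda> "\<bar>g y\<bar>" K] K \<Lambda>0
    by (simp add: mult.commute)
  have \<psi>_lip: "\<bar>\<psi> s y - \<psi> t y\<bar> \<le> K * L * \<rho> s t" if "s \<in> T" "t \<in> T" "y \<in> space S" for s t y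
  proof -
    have "\<bar>\<psi> s y - \<psi> t y\<bar> = \<bar>\<theta> s y - \<theta> t y\<bar> * \<bar>g y\<bar>" by (simp add: \<psi>_def abs_mult flip: left_diff_distrib)
    also have "\<dots> \<le> (L * \<rho> s t) * K"
      using \<theta>_lip[OF that] g(2)[OF that(3)] L by (intro mult_mono) auto
    finally show ?thesis by (simp add: mult_ac)
  qed
  have sN: "0 < sqrt N" using N by simp
  \<comment> \<open>The scales that \<open>dev_mgf\<close> yields for the Lipschitz bound
    \<open>K * L * \<rho> s t\<close> of the increments and for the uniform bound
    \<open>K * \<Lambda>\<close> at the base point.\<close>
  define \<sigma> \<tau> where "\<sigma> = 2 * (K * L) / (\<delta> * sqrt N)" and "\<tau> = 2 * (K * \<Lambda>) / (\<delta> * sqrt N)"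
  obtain B where B: "B \<in> borel_measurable samples"
    "(\<integral>\<^sup>+\<omega>. B \<omega> \<partial>samples) \<le> ennreal (4 * \<tau>) + ennreal (56 * \<sigma>) * dudley T \<rho>"
    "\<And>\<omega> t. \<omega> \<in> space samples \<Longrightarrow> t \<in> T \<Longrightarrow> ennreal \<bar>dev (\<psi> t) \<omega>\<bar> \<le> B \<omega>"
  proof (rule chaining[OF PP T, of \<sigma> \<tau> "\<lambda>t. dev (\<psi> t)" "4 / \<delta> * (K * L)"])
    show "0 < \<sigma>" "0 < \<tau>" using K L \<delta> sN \<Lambda>0 by (auto simp: \<sigma>_def \<tau>_def)
    show "dev (\<psi> t) \<in> borel_measurable samples" if "t \<in> T" for t using dev_measurable \<psi>_meas that by blast
    show "(\<integral>\<^sup>+\<omega>. ennreal (exp (l * dev (\<psi> t0) \<omega>)) \<partial>samples) \<le> ennreal (exp (l\<^sup>2 * \<tau>\<^sup>2 / 2))" for l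
      using dev_mgf[OF \<psi>_meas[OF T(2)] \<psi>_bd[OF T(2)]] by (simp add: \<tau>_def)
    fix s t assume st: "s \<in> T" "t \<in> T"
    have m: "(\<lambda>y. \<psi> s y - \<psi> t y) \<in> borel_measurable S" using \<psi>_meas st by measurable
    note d = dev_diff[OF _ \<psi>_meas[OF st(1)] \<psi>_bd[OF st(1)] \<psi>_meas[OF st(2)] \<psi>_bd[OF st(2)]]
    show "(\<integral>\<^sup>+\<omega>. ennreal (exp (l * (dev (\<psi> s) \<omega> - dev (\<psi> t) \<omega>))) \<partial>samples) \<le> ennreal (exp (l\<^sup>2 * (\<sigma> * \<rho> s t)\<^sup>2 / 2))" for l
    proof -
      have "2 * (K * L * \<rho> s t) / (\<delta> * sqrt N) = \<sigma> * \<rho> s t" by (simp add: \<sigma>_def)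
      moreover have "(\<integral>\<^sup>+\<omega>. ennreal (exp (l * (dev (\<psi> s) \<omega> - dev (\<psi> t) \<omega>))) \<partial>samples) =
          (\<integral>\<^sup>+\<omega>. ennreal (exp (l * dev (\<lambda>y. \<psi> s y - \<psi> t y) \<omega>)) \<partial>samples)"
        by (intro nn_integral_cong) (simp only: d)
      ultimately show ?thesis using dev_mgf[OF m \<psi>_lip[OF st], of l] by simp
    qed
    show "\<bar>dev (\<psi> s) \<omega> - dev (\<psi> t) \<omega>\<bar> \<le> 4 / \<delta> * (K * L) * \<rho> s t" if "\<omega> \<in> space samples" for \<omega>
      using abs_dev_le[OF that m \<psi>_lip[OF st]] d[OF that] by (simp add: mult.assoc)
  qed auto
  \<comment> \<open>The bias is of order \<open>1 / N\<close>, but \<open>1 / sqrt N\<close>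
    suffices: \<open>N - 1 \<ge> N / 2 \<ge> sqrt N / 2\<close>. As \<open>\<theta> t\<close> is a
    probability density, the integral of \<open>\<bar>\<psi> t\<bar>\<close> is at most
    \<open>K\<close>, so no further power of \<open>\<Lambda>\<close> and no total mass of
    \<open>S\<close> comes in.\<close>
  define b where "b = 2 * K * (\<Lambda> / \<delta>)\<^sup>2 / sqrt N"
  have b0: "0 \<le> b" using K by (simp add: b_def)
  have bias: "\<bar>(\<Sum>n\<in>{1..N}. cmean (\<psi> t) n x) - (\<integral>y. \<psi> t y \<partial>S)\<bar> \<le> b"
    if t: "t \<in> T" and x: "x \<in> space points" for t x
  proof -
    have \<theta>i: "integrable S (\<theta> t)"
      using \<theta>[OF t] \<theta>_meas[OF t] by (intro integrable_const_bound[of _ \<Lambda>]) auto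
    have "(\<integral>y. \<bar>\<psi> t y\<bar> \<partial>S) \<le> (\<integral>y. K * \<theta> t y \<partial>S)"
    proof (rule integral_mono)
      show "integrable S (\<lambda>y. \<bar>\<psi> t y\<bar>)"
        using \<psi>_bd[OF t] \<psi>_meas[OF t] by (intro integrable_const_bound[of _ "K * \<Lambda>"]) auto
      show "\<bar>\<psi> t y\<bar> \<le> K * \<theta> t y" if "y \<in> space S" for y
        using \<theta>[OF t that] g(2)[OF that] by (simp add: \<psi>_def abs_mult mult.commute mult_right_mono)
    qed (use \<theta>i in auto)
    then have le: "(\<integral>y. \<bar>\<psi> t y\<bar> \<partial>S) \<le> K" using \<theta>_int[OF t] by simp
    have "sqrt N \<le> N" using N by (intro real_le_lsqrt) (auto simp: power2_eq_square)
    then have "sqrt N / 2 \<le> real (N - 1)" using N_sub_1 by linarith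
    then have "(\<Lambda> / \<delta>)\<^sup>2 / real (N - 1) \<le> (\<Lambda> / \<delta>)\<^sup>2 / (sqrt N / 2)"
      using sN N by (intro divide_left_mono mult_pos_pos) auto
    then have "(\<Lambda> / \<delta>)\<^sup>2 / real (N - 1) * (\<integral>y. \<bar>\<psi> t y\<bar> \<partial>S) \<le> (\<Lambda> / \<delta>)\<^sup>2 / (sqrt N / 2) * K"
      using le sN by (intro mult_mono) auto
    also have "\<dots> = b" by (simp add: b_def)
    finally show ?thesis using cmean_bias[OF x \<psi>_meas[OF t] \<psi>_bd[OF t]] by simp
  qed
  show thesis
  proof
    show "(\<lambda>\<omega>. B \<omega> + ennreal b) \<in> borel_measurable samples" using B(1) by measurable
    interpret PP: prob_space samples by (rule PP)
    have "(\<integral>\<^sup>+\<omega>. B \<omega> + ennreal b \<partial>samples) = (\<integral>\<^sup>+\<omega>. B \<omega> \<partial>samples) + ennreal b"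
      using B(1) PP.emeasure_space_1 by (simp add: nn_integral_add)
    also have "\<dots> \<le> ennreal (4 * \<tau>) + ennreal (56 * \<sigma>) * dudley T \<rho> + ennreal b" using B(2) by (rule add_right_mono)
    also have "\<dots> = ennreal (56 * \<sigma>) * dudley T \<rho> + ennreal (4 * \<tau> + b)"
      using b0 K \<Lambda>0 \<delta> by (simp add: \<tau>_def ac_simps)
    also have "56 * \<sigma> = K / sqrt N * (112 * L / \<delta>)" by (simp add: \<sigma>_def mult_ac)
    also have "4 * \<tau> + b = K / sqrt N * (8 * \<Lambda> / \<delta> + 2 * (\<Lambda> / \<delta>)\<^sup>2)"
      by (simp add: \<tau>_def b_def distrib_left mult_ac)
    also have "ennreal (K / sqrt N * (112 * L / \<delta>)) * dudley T \<rho> + ennreal (K / sqrt N * (8 * \<Lambda> / \<delta> + 2 * (\<Lambda> / \<delta>)\<^sup>2))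
       = ennreal (K / sqrt N) * (ennreal (112 * L / \<delta>) * dudley T \<rho> + ennreal (8 * \<Lambda> / \<delta> + 2 * (\<Lambda> / \<delta>)\<^sup>2))"
      using K L \<Lambda>0 \<delta> by (subst (1 2) ennreal_mult) (auto simp: distrib_left mult.assoc)
    finally show "(\<integral>\<^sup>+\<omega>. B \<omega> + ennreal b \<partial>samples) \<le> ennreal (K / sqrt N) *
       (ennreal (112 * L / \<delta>) * dudley T \<rho> + ennreal (8 * \<Lambda> / \<delta> + 2 * (\<Lambda> / \<delta>)\<^sup>2))" .
    fix \<omega> t assume \<omega>: "\<omega> \<in> space samples" and t: "t \<in> T"
    have "(\<Sum>n\<in>{1..N}. \<theta> t (Y (\<omega> n)) * g (Y (\<omega> n)) / den n (pts \<omega>) (Y (\<omega> n))) - (\<integral>y. \<theta> t y * g y \<partial>S)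
       = dev (\<psi> t) \<omega> + ((\<Sum>n\<in>{1..N}. cmean (\<psi> t) n (pts \<omega>)) - (\<integral>y. \<psi> t y \<partial>S))" (is "?e = _")
      by (simp add: dev_def \<psi>_def sum_subtractf)
    then have "\<bar>?e\<bar> \<le> \<bar>dev (\<psi> t) \<omega>\<bar> + b"
      using bias[OF t pts_space[OF \<omega>]] by linarith
    then have "ennreal \<bar>?e\<bar> \<le> ennreal \<bar>dev (\<psi> t) \<omega>\<bar> + ennreal b"
      using b0 by (simp flip: ennreal_plus add: ennreal_leI)
    also have "\<dots> \<le> B \<omega> + ennreal b" using B(3)[OF \<omega> t] by (rule add_right_mono)
    finally show "ennreal \<bar>?e\<bar> \<le> B \<omega> + ennreal b" .
  qed
qed

end

subsection \<open>Path laws\<close>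

lemma sigma_finite_leb: "sigma_finite_measure (leb d)"
proof -
  interpret product_sigma_finite "\<lambda>_::nat. lborel :: real measure" by standard
  interpret finite_product_sigma_finite "\<lambda>_::nat. lborel :: real measure" "{..<d}" by standard simp
  show ?thesis by (rule sigma_finite_measure_axioms)
qed

locale valid_mdp =
  fixes M :: mdp
  assumes M: "is_mdp M"
begin

lemma states_sets: "states M \<in> sets (leb (sdim M))"
  using M by (simp add: is_mdp_def)

lemma states_subset: "states M \<subseteq> space (leb (sdim M))"
  by (rule sets.sets_into_space[OF states_sets])

lemma space_stateM: "space (stateM M) = states M"
  using states_subset by (auto simp: stateM_def space_restrict_space)

lemma sigma_finite_stateM: "sigma_finite_measure (stateM M)"
  unfolding stateM_def
  by (rule sigma_finite_measure_restrict_space[OF sigma_finite_leb states_sets])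

lemma space_actionM: "space (actionM M) = actions M"
proof -
  have "actions M \<subseteq> topspace (euclid_top (adim M))"
    using M compactin_subset_topspace unfolding is_mdp_def by blast
  then show ?thesis by (auto simp: actionM_def space_restrict_space space_PiM)
qed

lemma ident_stateM_leb [measurable]: "(\<lambda>x. x) \<in> stateM M \<rightarrow>\<^sub>M leb (sdim M)"
  unfolding stateM_def by (rule measurable_restrict_space1) simp

lemma dens_measurable_leb:
  assumes "h \<in> {1..horizon M}"
  shows "(\<lambda>((x, a), y). dens M h a x y) \<in> borel_measurable ((stateM M \<Otimes>\<^sub>M actionM M) \<Otimes>\<^sub>M leb (sdim M))"
proof -
  have m: "(\<lambda>(x, a, y). dens M h a x y) \<in> borel_measurable (stateM M \<Otimes>\<^sub>M actionM M \<Otimes>\<^sub>M leb (sdim M))"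
    using M assms unfolding is_mdp_def by blast
  have "(\<lambda>p. (fst (fst p), snd (fst p), snd p))
      \<in> (stateM M \<Otimes>\<^sub>M actionM M) \<Otimes>\<^sub>M leb (sdim M) \<rightarrow>\<^sub>M stateM M \<Otimes>\<^sub>M actionM M \<Otimes>\<^sub>M leb (sdim M)"
    by measurable
  from measurable_compose[OF this m] show ?thesis by (simp add: split_def)
qed

lemma dens_measurable:
  assumes "h \<in> {1..horizon M}"
  shows "(\<lambda>((x, a), y). dens M h a x y) \<in> borel_measurable ((stateM M \<Otimes>\<^sub>M actionM M) \<Otimes>\<^sub>M stateM M)"
proof -
  have "(\<lambda>p. (fst p, snd p)) \<in> (stateM M \<Otimes>\<^sub>M actionM M) \<Otimes>\<^sub>M stateM M \<rightarrow>\<^sub>M (stateM M \<Otimes>\<^sub>M actionM M) \<Otimes>\<^sub>M leb (sdim M)"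
    by (intro measurable_Pair measurable_fst measurable_compose[OF measurable_snd ident_stateM_leb])
  from measurable_compose[OF this dens_measurable_leb[OF assms]] show ?thesis by simp
qed

lemma dens_section_leb:
  assumes "h \<in> {1..horizon M}" "x \<in> states M" "a \<in> actions M"
  shows "dens M h a x \<in> borel_measurable (leb (sdim M))"
  using measurable_Pair2[OF dens_measurable_leb[OF assms(1)], of "(x, a)"] assms
  by (simp add: space_pair_measure space_stateM space_actionM)

lemma dens_section:
  assumes "h \<in> {1..horizon M}" "x \<in> states M" "a \<in> actions M"
  shows "dens M h a x \<in> borel_measurable (stateM M)"
  using dens_section_leb[OF assms] unfolding stateM_def by (rule measurable_restrict_space1)

lemma dens_nonneg:
  assumes "h \<in> {1..horizon M}" "x \<in> states M" "a \<in> actions M" "y \<in> space (leb (sdim M))"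
  shows "0 \<le> dens M h a x y"
  using M assms unfolding is_mdp_def by blast

lemma nn_integral_dens:
  assumes "h \<in> {1..horizon M}" "x \<in> states M" "a \<in> actions M"
  shows "(\<integral>\<^sup>+y. ennreal (dens M h a x y) \<partial>leb (sdim M)) = 1"
  using M assms unfolding is_mdp_def by blast

lemma nn_integral_stateM:
  "(\<integral>\<^sup>+y. f y \<partial>stateM M) = (\<integral>\<^sup>+y. f y * indicator (states M) y \<partial>leb (sdim M))"
  unfolding stateM_def using states_sets by (subst nn_integral_restrict_space) (auto simp: Int_absorb2 states_subset)

lemma nn_integral_dens_stateM:
  assumes "h \<in> {1..horizon M}" "x \<in> states M" "a \<in> actions M"
  shows "(\<integral>\<^sup>+y. ennreal (dens M h a x y) \<partial>stateM M) = 1"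
proof -
  have "dens M h a x y = 0" if "y \<in> space (leb (sdim M)) - states M" for y
    using M assms that unfolding is_mdp_def by blast
  then have "(\<integral>\<^sup>+y. ennreal (dens M h a x y) * indicator (states M) y \<partial>leb (sdim M))
      = (\<integral>\<^sup>+y. ennreal (dens M h a x y) \<partial>leb (sdim M))"
    by (intro nn_integral_cong) (auto simp: indicator_def)
  then show ?thesis using nn_integral_dens[OF assms] by (simp add: nn_integral_stateM)
qed

lemma sets_trans_kernel [simp, measurable_cong]: "sets (trans_kernel M h x a) = sets (stateM M)"
  by (simp add: trans_kernel_def)

lemma space_trans_kernel: "space (trans_kernel M h x a) = states M"
  by (simp add: trans_kernel_def space_stateM)

lemma nn_integral_trans_kernel:
  assumes "h \<in> {1..horizon M}" "x \<in> states M" "a \<in> actions M" "f \<in> borel_measurable (stateM M)"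
  shows "(\<integral>\<^sup>+y. f y \<partial>trans_kernel M h x a) = (\<integral>\<^sup>+y. f y * ennreal (dens M h a x y) \<partial>stateM M)"
  unfolding trans_kernel_def using dens_section[OF assms(1-3)] assms(4)
  by (subst nn_integral_density) (auto simp: mult.commute)

lemma prob_space_trans_kernel:
  assumes "h \<in> {1..horizon M}" "x \<in> states M" "a \<in> actions M"
  shows "prob_space (trans_kernel M h x a)"
proof
  have "emeasure (trans_kernel M h x a) (space (trans_kernel M h x a)) = (\<integral>\<^sup>+y. 1 \<partial>trans_kernel M h x a)"
    by simp
  also have "\<dots> = 1" using nn_integral_dens_stateM[OF assms] by (subst nn_integral_trans_kernel[OF assms]) auto
  finally show "emeasure (trans_kernel M h x a) (space (trans_kernel M h x a)) = 1" .
qed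

lemma trans_kernel_measurable:
  assumes h: "h \<in> {1..horizon M}"
  shows "(\<lambda>(x, a). trans_kernel M h x a) \<in> stateM M \<Otimes>\<^sub>M actionM M \<rightarrow>\<^sub>M prob_algebra (stateM M)"
proof (rule measurable_prob_algebraI)
  interpret sigma_finite_measure "stateM M" by (rule sigma_finite_stateM)
  show P: "prob_space ((\<lambda>(x, a). trans_kernel M h x a) p)" if "p \<in> space (stateM M \<Otimes>\<^sub>M actionM M)" for p
    using that by (auto simp: space_pair_measure space_stateM space_actionM intro!: prob_space_trans_kernel h)
  show "(\<lambda>(x, a). trans_kernel M h x a) \<in> stateM M \<Otimes>\<^sub>M actionM M \<rightarrow>\<^sub>M subprob_algebra (stateM M)"
  proof (rule measurable_subprob_algebra)
    fix A assume A: "A \<in> sets (stateM M)"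
    have D: "(\<lambda>q. dens M h (snd (fst q)) (fst (fst q)) (snd q)) \<in> borel_measurable ((stateM M \<Otimes>\<^sub>M actionM M) \<Otimes>\<^sub>M stateM M)"
      using dens_measurable[OF h] by (simp add: split_def)
    have "(\<lambda>p. \<integral>\<^sup>+y. indicator A y * ennreal (dens M h (snd p) (fst p) y) \<partial>stateM M) \<in> borel_measurable (stateM M \<Otimes>\<^sub>M actionM M)"
      using D measurable_compose[OF measurable_snd borel_measurable_indicator[OF A], of "stateM M \<Otimes>\<^sub>M actionM M"]
      by (intro borel_measurable_nn_integral) (auto simp: split_def intro!: borel_measurable_times_ennreal)
    moreover have "emeasure (case p of (x, a) \<Rightarrow> trans_kernel M h x a) A =
        (\<integral>\<^sup>+y. indicator A y * ennreal (dens M h (snd p) (fst p) y) \<partial>stateM M)"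
      if "p \<in> space (stateM M \<Otimes>\<^sub>M actionM M)" for p
      using that A nn_integral_trans_kernel[OF h, of "fst p" "snd p" "indicator A"]
      by (auto simp: space_pair_measure space_stateM space_actionM split_def)
    ultimately show "(\<lambda>p. emeasure (case p of (x, a) \<Rightarrow> trans_kernel M h x a) A) \<in> borel_measurable (stateM M \<Otimes>\<^sub>M actionM M)"
      by (simp cong: measurable_cong)
  qed (use P in \<open>auto intro: prob_space_imp_subprob_space\<close>)
qed

section \<open>Path laws as iterated kernels\<close>

abbreviation extend ::
  "nat \<Rightarrow> nat \<Rightarrow> (nat \<Rightarrow> vec) \<times> (nat \<Rightarrow> vec) \<Rightarrow> vec \<Rightarrow> vec \<Rightarrow> (nat \<Rightarrow> vec) \<times> (nat \<Rightarrow> vec)"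
where
  "extend h n p u y \<equiv> ((fst p)(Suc (h + n) := y), (snd p)(h + n := u))"

text \<open>The body of the recursion for \<open>path_law\<close>, isolated as a kernel between path
  spaces so that its measurability can be stated once and the general rules for monadic bind
  apply.\<close>

definition path_step ::
  "(nat \<Rightarrow> vec \<Rightarrow> vec measure) \<Rightarrow> nat \<Rightarrow> nat \<Rightarrow> (nat \<Rightarrow> vec) \<times> (nat \<Rightarrow> vec) \<Rightarrow> ((nat \<Rightarrow> vec) \<times> (nat \<Rightarrow> vec)) measure"
where
  "path_step \<pi> h n = (\<lambda>(s, a). \<pi> (h + n) (s (h + n)) \<bind> (\<lambda>u.
     trans_kernel M (Suc (h + n)) (s (h + n)) u \<bind> (\<lambda>y.
       return (pathM M h (Suc n)) (s(Suc (h + n) := y), a(h + n := u)))))"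

lemma path_law_Suc: "path_law M \<pi> h x (Suc n) = path_law M \<pi> h x n \<bind> path_step \<pi> h n"
  by (simp add: path_step_def)

lemma path_state_measurable [measurable]:
  assumes "h \<le> i" "i \<le> h + n"
  shows "(\<lambda>p. fst p i) \<in> pathM M h n \<rightarrow>\<^sub>M stateM M"
  unfolding pathM_def using assms
  by (intro measurable_compose[OF measurable_fst measurable_component_singleton]) auto

lemma path_action_measurable [measurable]:
  assumes "h \<le> i" "i < h + n"
  shows "(\<lambda>p. snd p i) \<in> pathM M h n \<rightarrow>\<^sub>M actionM M"
  unfolding pathM_def using assms
  by (intro measurable_compose[OF measurable_snd measurable_component_singleton]) auto

lemma path_extend_measurable:
  "(\<lambda>((p, u), y). extend h n p u y)
     \<in> (pathM M h n \<Otimes>\<^sub>M actionM M) \<Otimes>\<^sub>M stateM M \<rightarrow>\<^sub>M pathM M h (Suc n)"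
proof -
  have "insert (Suc (h + n)) {h..h + n} = {h..h + Suc n}" "insert (h + n) {h..<h + n} = {h..<h + Suc n}" by auto
  then have s: "(\<lambda>(f, y). f(Suc (h + n) := y)) \<in> Pi\<^sub>M {h..h + n} (\<lambda>_. stateM M) \<Otimes>\<^sub>M stateM M \<rightarrow>\<^sub>M Pi\<^sub>M {h..h + Suc n} (\<lambda>_. stateM M)"
    and a: "(\<lambda>(f, y). f(h + n := y)) \<in> Pi\<^sub>M {h..<h + n} (\<lambda>_. actionM M) \<Otimes>\<^sub>M actionM M \<rightarrow>\<^sub>M Pi\<^sub>M {h..<h + Suc n} (\<lambda>_. actionM M)"
    using measurable_add_dim[of "Suc (h + n)" "{h..h + n}" "\<lambda>_. stateM M"]
      measurable_add_dim[of "h + n" "{h..<h + n}" "\<lambda>_. actionM M"] by simp_all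
  have "(\<lambda>q. (fst (fst (fst q)), snd q)) \<in> (pathM M h n \<Otimes>\<^sub>M actionM M) \<Otimes>\<^sub>M stateM M \<rightarrow>\<^sub>M Pi\<^sub>M {h..h + n} (\<lambda>_. stateM M) \<Otimes>\<^sub>M stateM M"
    "(\<lambda>q. (snd (fst (fst q)), snd (fst q))) \<in> (pathM M h n \<Otimes>\<^sub>M actionM M) \<Otimes>\<^sub>M stateM M \<rightarrow>\<^sub>M Pi\<^sub>M {h..<h + n} (\<lambda>_. actionM M) \<Otimes>\<^sub>M actionM M"
    unfolding pathM_def by measurable
  from measurable_compose[OF this(1) s] measurable_compose[OF this(2) a] show ?thesis
    unfolding pathM_def[of M h "Suc n"] by (auto simp: split_def intro!: measurable_Pair)
qed

lemma path_step_measurable: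
  assumes \<pi>: "\<pi> \<in> policies M" and n: "h + n < horizon M"
  shows "path_step \<pi> h n \<in> pathM M h n \<rightarrow>\<^sub>M prob_algebra (pathM M h (Suc n))"
    "\<And>p. p \<in> space (pathM M h n) \<Longrightarrow>
      (\<lambda>u. trans_kernel M (Suc (h + n)) (fst p (h + n)) u \<bind> (\<lambda>y.
        return (pathM M h (Suc n)) (extend h n p u y)))
      \<in> actionM M \<rightarrow>\<^sub>M prob_algebra (pathM M h (Suc n))"
proof -
  have \<pi>n: "(\<lambda>p. \<pi> (h + n) (fst p (h + n))) \<in> pathM M h n \<rightarrow>\<^sub>M prob_algebra (actionM M)"
    using \<pi> n by (intro measurable_compose[OF path_state_measurable]) (auto simp: policies_def)
  have K: "(\<lambda>q. trans_kernel M (Suc (h + n)) (fst (fst q) (h + n)) (snd q)) \<in> pathM M h n \<Otimes>\<^sub>M actionM M \<rightarrow>\<^sub>M prob_algebra (stateM M)"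
  proof -
    have "(\<lambda>q. (fst (fst q) (h + n), snd q)) \<in> pathM M h n \<Otimes>\<^sub>M actionM M \<rightarrow>\<^sub>M stateM M \<Otimes>\<^sub>M actionM M"
      by (intro measurable_Pair measurable_snd measurable_compose[OF measurable_fst path_state_measurable]) auto
    from measurable_compose[OF this trans_kernel_measurable[of "Suc (h + n)"]] show ?thesis using n by simp
  qed
  have inner: "(\<lambda>q. trans_kernel M (Suc (h + n)) (fst (fst q) (h + n)) (snd q) \<bind> (\<lambda>y.
        return (pathM M h (Suc n)) (extend h n (fst q) (snd q) y)))
      \<in> pathM M h n \<Otimes>\<^sub>M actionM M \<rightarrow>\<^sub>M prob_algebra (pathM M h (Suc n))"
    using measurable_compose[OF path_extend_measurable measurable_return_prob_space, of h n]
    by (intro measurable_bind_prob_space2[OF K]) (simp add: split_def)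
  show "path_step \<pi> h n \<in> pathM M h n \<rightarrow>\<^sub>M prob_algebra (pathM M h (Suc n))"
    unfolding path_step_def split_def
    using inner by (intro measurable_bind_prob_space2[OF \<pi>n]) (simp add: split_def)
  show "(\<lambda>u. trans_kernel M (Suc (h + n)) (fst p (h + n)) u \<bind> (\<lambda>y.
        return (pathM M h (Suc n)) (extend h n p u y)))
      \<in> actionM M \<rightarrow>\<^sub>M prob_algebra (pathM M h (Suc n))" if "p \<in> space (pathM M h n)" for p
    using measurable_Pair2[OF inner that] by simp
qed

lemma path_law_in_prob_algebra:
  assumes \<pi>: "\<pi> \<in> policies M" and x: "x \<in> states M" and "h + n \<le> horizon M"
  shows "path_law M \<pi> h x n \<in> space (prob_algebra (pathM M h n))"
  using assms(3)
proof (induction n)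
  case 0
  have "((\<lambda>i\<in>{h}. x), (\<lambda>i. undefined)) \<in> space (pathM M h 0)"
    using x by (auto simp: pathM_def space_pair_measure space_PiM space_stateM)
  then show ?case by (auto simp: space_prob_algebra intro: prob_space_return)
next
  case (Suc n)
  then have "path_law M \<pi> h x n \<in> space (prob_algebra (pathM M h n))"
    "path_step \<pi> h n \<in> pathM M h n \<rightarrow>\<^sub>M prob_algebra (pathM M h (Suc n))"
    using path_step_measurable[OF \<pi>] by auto
  then show ?case unfolding path_law_Suc space_prob_algebra[of "pathM M h (Suc n)"]
    by (intro CollectI conjI sets_bind' prob_space_bind')
qed

lemma sets_path_law:
  "\<pi> \<in> policies M \<Longrightarrow> x \<in> states M \<Longrightarrow> h + n \<le> horizon M \<Longrightarrow> sets (path_law M \<pi> h x n) = sets (pathM M h n)"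
  using path_law_in_prob_algebra by (auto simp: space_prob_algebra)

lemma prob_space_path_law:
  "\<pi> \<in> policies M \<Longrightarrow> x \<in> states M \<Longrightarrow> h + n \<le> horizon M \<Longrightarrow> prob_space (path_law M \<pi> h x n)"
  using path_law_in_prob_algebra by (auto simp: space_prob_algebra)

lemma policy_at:
  assumes "\<pi> \<in> policies M" "t < horizon M" "x \<in> states M"
  shows "prob_space (\<pi> t x)" "sets (\<pi> t x) = sets (actionM M)" "space (\<pi> t x) = actions M"
proof -
  have "\<pi> t \<in> stateM M \<rightarrow>\<^sub>M prob_algebra (actionM M)" using assms by (simp add: policies_def)
  then have "\<pi> t x \<in> space (prob_algebra (actionM M))"
    using assms(3) by (auto intro: measurable_space simp: space_stateM)
  then show "prob_space (\<pi> t x)" "sets (\<pi> t x) = sets (actionM M)" by (auto simp: space_prob_algebra)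
  then show "space (\<pi> t x) = actions M" using sets_eq_imp_space_eq space_actionM by metis
qed

lemma space_pathM_state: "p \<in> space (pathM M h n) \<Longrightarrow> h \<le> i \<Longrightarrow> i \<le> h + n \<Longrightarrow> fst p i \<in> states M"
  using measurable_space[OF path_state_measurable, of h i n p] by (simp add: space_stateM)

lemma space_pathM_action: "p \<in> space (pathM M h n) \<Longrightarrow> h \<le> i \<Longrightarrow> i < h + n \<Longrightarrow> snd p i \<in> actions M"
  using measurable_space[OF path_action_measurable, of h i n p] by (simp add: space_actionM)

text \<open>The one-step transition operator on functions of paths: the expectation of
  \<open>\<Phi>\<close> over the next action and the next state, given the path \<open>p\<close> so
  far.\<close>

definition step_integral where
  "step_integral \<pi> h n \<Phi> p = (\<integral>\<^sup>+u. \<integral>\<^sup>+y. \<Phi> (extend h n p u y)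
     \<partial>trans_kernel M (Suc (h + n)) (fst p (h + n)) u \<partial>\<pi> (h + n) (fst p (h + n)))"

lemma nn_integral_path_step:
  assumes \<pi>: "\<pi> \<in> policies M" and n: "h + n < horizon M"
    and \<Phi>: "\<Phi> \<in> borel_measurable (pathM M h (Suc n))" and p: "p \<in> space (pathM M h n)"
  shows "(\<integral>\<^sup>+q. \<Phi> q \<partial>path_step \<pi> h n p) = step_integral \<pi> h n \<Phi> p"
proof -
  have pn: "fst p (h + n) \<in> states M" using space_pathM_state[OF p] by simp
  note \<pi>n = policy_at[OF \<pi> n pn]
  let ?K = "trans_kernel M (Suc (h + n)) (fst p (h + n))" and ?ret = "return (pathM M h (Suc n))"
  have "(\<integral>\<^sup>+q. \<Phi> q \<partial>path_step \<pi> h n p) =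
    (\<integral>\<^sup>+u. \<integral>\<^sup>+q. \<Phi> q \<partial>(?K u \<bind> (\<lambda>y.
        ?ret (extend h n p u y))) \<partial>\<pi> (h + n) (fst p (h + n)))"
    unfolding path_step_def split_def
    using measurable_prob_algebraD[OF path_step_measurable(2)[OF \<pi> n p]]
    by (intro nn_integral_bind[OF \<Phi>]) (simp add: measurable_cong_sets[OF \<pi>n(2) refl])
  also have "\<dots> = (\<integral>\<^sup>+u. \<integral>\<^sup>+y. \<Phi> (extend h n p u y)
     \<partial>?K u \<partial>\<pi> (h + n) (fst p (h + n)))"
  proof (rule nn_integral_cong)
    fix u assume "u \<in> space (\<pi> (h + n) (fst p (h + n)))"
    then have u: "u \<in> actions M" using \<pi>n by simp
    have ext: "extend h n p u \<in> stateM M \<rightarrow>\<^sub>M pathM M h (Suc n)"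
      using measurable_Pair2[OF path_extend_measurable, of "(p, u)" h n] p u
      by (simp add: space_pair_measure space_actionM)
    have "(\<integral>\<^sup>+q. \<Phi> q \<partial>(?K u \<bind> (\<lambda>y.
        ?ret (extend h n p u y))))
      = (\<integral>\<^sup>+y. \<integral>\<^sup>+q. \<Phi> q \<partial>?ret (extend h n p u y)
         \<partial>?K u)"
      using measurable_compose[OF ext return_measurable]
      by (intro nn_integral_bind[OF \<Phi>]) (simp add: measurable_cong_sets[OF sets_trans_kernel refl])
    also have "\<dots> = (\<integral>\<^sup>+y. \<Phi> (extend h n p u y) \<partial>?K u)"
      using measurable_space[OF ext]
      by (intro nn_integral_cong nn_integral_return[OF _ \<Phi>]) (simp add: space_trans_kernel space_stateM)
    finally show "(\<integral>\<^sup>+q. \<Phi> q \<partial>(?K u \<bind> (\<lambda>y.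
        ?ret (extend h n p u y))))
      = (\<integral>\<^sup>+y. \<Phi> (extend h n p u y) \<partial>?K u)" .
  qed
  finally show ?thesis by (simp add: step_integral_def)
qed

lemma step_integral_measurable:
  assumes \<pi>: "\<pi> \<in> policies M" and n: "h + n < horizon M" and \<Phi>: "\<Phi> \<in> borel_measurable (pathM M h (Suc n))"
  shows "step_integral \<pi> h n \<Phi> \<in> borel_measurable (pathM M h n)"
proof -
  have "(\<lambda>p. \<integral>\<^sup>+q. \<Phi> q \<partial>path_step \<pi> h n p) \<in> borel_measurable (pathM M h n)"
    using measurable_compose[OF measurable_prob_algebraD[OF path_step_measurable(1)[OF \<pi> n]]
      nn_integral_measurable_subprob_algebra[OF \<Phi>]] by simp
  then show ?thesis using nn_integral_path_step[OF \<pi> n \<Phi>] by (simp cong: measurable_cong)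
qed

lemma nn_integral_path_law_Suc:
  assumes \<pi>: "\<pi> \<in> policies M" and x: "x \<in> states M" and n: "h + n < horizon M"
    and \<Phi>: "\<Phi> \<in> borel_measurable (pathM M h (Suc n))"
  shows "(\<integral>\<^sup>+p. \<Phi> p \<partial>path_law M \<pi> h x (Suc n)) = (\<integral>\<^sup>+p. step_integral \<pi> h n \<Phi> p \<partial>path_law M \<pi> h x n)"
proof -
  have sets: "sets (path_law M \<pi> h x n) = sets (pathM M h n)" using sets_path_law[OF \<pi> x] n by simp
  have "(\<integral>\<^sup>+p. \<Phi> p \<partial>path_law M \<pi> h x (Suc n)) = (\<integral>\<^sup>+p. \<integral>\<^sup>+q. \<Phi> q \<partial>path_step \<pi> h n p \<partial>path_law M \<pi> h x n)"
    unfolding path_law_Suc using measurable_prob_algebraD[OF path_step_measurable(1)[OF \<pi> n]]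
    by (intro nn_integral_bind[OF \<Phi>]) (simp add: measurable_cong_sets[OF sets refl])
  also have "\<dots> = (\<integral>\<^sup>+p. step_integral \<pi> h n \<Phi> p \<partial>path_law M \<pi> h x n)"
    using nn_integral_path_step[OF \<pi> n \<Phi>] by (intro nn_integral_cong) (simp add: sets_eq_imp_space_eq[OF sets])
  finally show ?thesis .
qed

text \<open>Later steps leave early states alone: integrating over probability kernels returns a
  function that does not depend on the new action and state. Two time indices are provided for the
  joint law of consecutive states; a function of a single state is the case where the second
  argument is ignored.\<close>

lemma nn_integral_path_law_marginal:
  fixes F :: "vec \<Rightarrow> vec \<Rightarrow> ennreal"
  assumes \<pi>: "\<pi> \<in> policies M" and x: "x \<in> states M"
    and F: "(\<lambda>(y, z). F y z) \<in> borel_measurable (stateM M \<Otimes>\<^sub>M stateM M)"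
    and ij: "h \<le> i" "h \<le> j" "i \<le> h + m" "j \<le> h + m" and "m \<le> n" "h + n \<le> horizon M"
  shows "(\<integral>\<^sup>+p. F (fst p i) (fst p j) \<partial>path_law M \<pi> h x n) = (\<integral>\<^sup>+p. F (fst p i) (fst p j) \<partial>path_law M \<pi> h x m)"
  using \<open>m \<le> n\<close> \<open>h + n \<le> horizon M\<close>
proof (induction n rule: dec_induct)
  case (step n)
  have n: "h + n < horizon M" using step by simp
  have Fm: "(\<lambda>p. F (fst p i) (fst p j)) \<in> borel_measurable (pathM M h (Suc n))"
  proof -
    have "(\<lambda>p. (fst p i, fst p j)) \<in> pathM M h (Suc n) \<rightarrow>\<^sub>M stateM M \<Otimes>\<^sub>M stateM M"
      using ij step by (intro measurable_Pair path_state_measurable) auto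
    from measurable_compose[OF this F] show ?thesis by simp
  qed
  have sets: "sets (path_law M \<pi> h x n) = sets (pathM M h n)" using sets_path_law[OF \<pi> x] n by simp
  have "step_integral \<pi> h n (\<lambda>p. F (fst p i) (fst p j)) p = F (fst p i) (fst p j)"
    if "p \<in> space (path_law M \<pi> h x n)" for p
  proof -
    have pn: "fst p (h + n) \<in> states M"
      using that space_pathM_state[of p h n] by (simp add: sets_eq_imp_space_eq[OF sets])
    note \<pi>n = policy_at[OF \<pi> n pn]
    have "step_integral \<pi> h n (\<lambda>p. F (fst p i) (fst p j)) p = (\<integral>\<^sup>+u. F (fst p i) (fst p j) \<partial>\<pi> (h + n) (fst p (h + n)))"
      unfolding step_integral_def
    proof (rule nn_integral_cong)
      fix u assume "u \<in> space (\<pi> (h + n) (fst p (h + n)))"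
      then have "u \<in> actions M" using \<pi>n by simp
      then interpret K: prob_space "trans_kernel M (Suc (h + n)) (fst p (h + n)) u"
        using n pn by (intro prob_space_trans_kernel) auto
      show "(\<integral>\<^sup>+y. F (fst (extend h n p u y) i)
          (fst (extend h n p u y) j) \<partial>trans_kernel M (Suc (h + n)) (fst p (h + n)) u)
        = F (fst p i) (fst p j)"
        using ij step K.emeasure_space_1 by simp
    qed
    also have "\<dots> = F (fst p i) (fst p j)" using prob_space.emeasure_space_1[OF \<pi>n(1)] by simp
    finally show ?thesis .
  qed
  then have "(\<integral>\<^sup>+p. F (fst p i) (fst p j) \<partial>path_law M \<pi> h x (Suc n)) = (\<integral>\<^sup>+p. F (fst p i) (fst p j) \<partial>path_law M \<pi> h x n)"
    unfolding nn_integral_path_law_Suc[OF \<pi> x n Fm] by (intro nn_integral_cong)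
  then show ?case using step by simp
qed simp

lemma const_policy:
  assumes "\<And>t. t < horizon M \<Longrightarrow> b t \<in> actions M"
  shows "(\<lambda>t _. return (actionM M) (b t)) \<in> policies M"
  unfolding policies_def using assms
  by (auto simp: space_prob_algebra space_actionM intro!: measurable_const prob_space_return)

text \<open>The path is cut after time \<open>j + 1\<close>, where the last step can be integrated
  explicitly because the control is a point mass; the resulting function of the state at time
  \<open>j\<close> is then moved back to the full horizon. The identity is what
  \<open>mesh_step\<close> requires as \<open>markov\<close>.\<close>

lemma markov_property:
  fixes F :: "vec \<times> vec \<Rightarrow> ennreal"
  assumes b: "\<And>t. t < horizon M \<Longrightarrow> b t \<in> actions M" and x: "x \<in> states M"
    and j: "j < horizon M" and F: "F \<in> borel_measurable (stateM M \<Otimes>\<^sub>M stateM M)"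
  defines "P \<equiv> path_law M (\<lambda>t _. return (actionM M) (b t)) 0 x (horizon M)"
  shows "(\<integral>\<^sup>+p. F (fst p j, fst p (Suc j)) \<partial>P) =
    (\<integral>\<^sup>+p. \<integral>\<^sup>+y. F (fst p j, y) * ennreal (dens M (Suc j) (b j) (fst p j) y) \<partial>stateM M \<partial>P)"
proof -
  let ?\<pi> = "\<lambda>t _. return (actionM M) (b t)"
  interpret sigma_finite_measure "stateM M" by (rule sigma_finite_stateM)
  note \<pi> = const_policy[of b, OF b]
  have bj: "b j \<in> actions M" using b j by simp
  have Suc_j: "Suc j \<in> {1..horizon M}" using j by simp
  define G where "G y = (\<integral>\<^sup>+z. F (y, z) * ennreal (dens M (Suc j) (b j) y z) \<partial>stateM M)" for y
  have G: "G \<in> borel_measurable (stateM M)"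
  proof -
    have "(\<lambda>(y, z). ((y, b j), z)) \<in> stateM M \<Otimes>\<^sub>M stateM M \<rightarrow>\<^sub>M (stateM M \<Otimes>\<^sub>M actionM M) \<Otimes>\<^sub>M stateM M"
      using bj unfolding split_def by (intro measurable_Pair measurable_fst measurable_snd measurable_const) (auto simp: space_actionM)
    from measurable_compose[OF this dens_measurable[OF Suc_j]]
    have "(\<lambda>(y, z). F (y, z) * ennreal (dens M (Suc j) (b j) y z)) \<in> borel_measurable (stateM M \<Otimes>\<^sub>M stateM M)"
      using F by (auto simp: split_def intro!: borel_measurable_times_ennreal)
    then show ?thesis unfolding G_def[abs_def] by (rule borel_measurable_nn_integral)
  qed
  have GG: "(\<lambda>(y, z). G y) \<in> borel_measurable (stateM M \<Otimes>\<^sub>M stateM M)"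
    using measurable_compose[OF measurable_fst G] by (simp add: split_def)
  have FF: "(\<lambda>(y, z). F (y, z)) \<in> borel_measurable (stateM M \<Otimes>\<^sub>M stateM M)" using F by simp
  have "(\<integral>\<^sup>+p. F (fst p j, fst p (Suc j)) \<partial>P) = (\<integral>\<^sup>+p. F (fst p j, fst p (Suc j)) \<partial>path_law M ?\<pi> 0 x (Suc j))"
    unfolding P_def using nn_integral_path_law_marginal[OF \<pi> x FF, of 0 j "Suc j" "Suc j" "horizon M"] j by simp
  also have "\<dots> = (\<integral>\<^sup>+p. step_integral ?\<pi> 0 j (\<lambda>p. F (fst p j, fst p (Suc j))) p \<partial>path_law M ?\<pi> 0 x j)"
  proof (rule nn_integral_path_law_Suc[OF \<pi> x])
    have "(\<lambda>p. (fst p j, fst p (Suc j))) \<in> pathM M 0 (Suc j) \<rightarrow>\<^sub>M stateM M \<Otimes>\<^sub>M stateM M"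
      by (intro measurable_Pair path_state_measurable) auto
    from measurable_compose[OF this F]
    show "(\<lambda>p. F (fst p j, fst p (Suc j))) \<in> borel_measurable (pathM M 0 (Suc j))" .
  qed (use j in auto)
  also have "\<dots> = (\<integral>\<^sup>+p. G (fst p j) \<partial>path_law M ?\<pi> 0 x j)"
  proof (rule nn_integral_cong)
    fix p assume "p \<in> space (path_law M ?\<pi> 0 x j)"
    then have pj: "fst p j \<in> states M"
      using space_pathM_state[of p 0 j j] sets_path_law[OF \<pi> x, of 0 j] j by (auto dest: sets_eq_imp_space_eq)
    have Fp: "(\<lambda>y. F (fst p j, y)) \<in> borel_measurable (stateM M)"
      using F pj by (intro measurable_Pair2) (auto simp: space_stateM)
    have K: "(\<lambda>u. \<integral>\<^sup>+y. F (fst p j, y) \<partial>trans_kernel M (Suc j) (fst p j) u) \<in> borel_measurable (actionM M)"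
      using measurable_compose[OF measurable_prob_algebraD[OF measurable_Pair2[OF trans_kernel_measurable[OF Suc_j], of "fst p j"]]
        nn_integral_measurable_subprob_algebra[OF Fp]] pj by (simp add: space_stateM)
    show "step_integral ?\<pi> 0 j (\<lambda>p. F (fst p j, fst p (Suc j))) p = G (fst p j)"
      unfolding step_integral_def G_def
      using K bj nn_integral_trans_kernel[OF Suc_j pj bj Fp] by (simp add: nn_integral_return space_actionM)
  qed
  also have "\<dots> = (\<integral>\<^sup>+p. G (fst p j) \<partial>P)"
    unfolding P_def using nn_integral_path_law_marginal[OF \<pi> x GG, of 0 j j j "horizon M"] j by simp
  finally show ?thesis by (simp add: G_def)
qed

end

subsection \<open>The reflected process\<close>

declare path_law.simps(2) [simp del]

locale reflection = valid_mdp +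
  fixes D :: "vec set" and \<delta> \<Lambda> L :: real and Lf :: "vec \<Rightarrow> real"
  assumes D: "compact_pos M D" and bounds: "local_bounds M D \<delta> \<Lambda> L Lf"
    and actions_ne: "actions M \<noteq> {}"
begin

abbreviation "MD \<equiv> reflected M D"
abbreviation "d \<equiv> sdim M"

lemma reflected_simps [simp]:
  "states MD = D" "actions MD = actions M" "sdim MD = d" "adim MD = adim M"
  "horizon MD = horizon M" "adist MD = adist M" "reward MD = reward M" "terminal MD = terminal M"
  "actionM MD = actionM M"
  by (simp_all add: reflected_def actionM_def)

section \<open>The volume of \<open>D\<close> and the reflected densities\<close>

lemma D_subset: "D \<subseteq> states M" and D_pos: "0 < emeasure (leb d) D"
  using D by (auto simp: compact_pos_def)

lemma D_sets: "D \<in> sets (leb d)"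
  using D_pos emeasure_notin_sets by force

lemma D_space: "D \<subseteq> space (leb d)"
  by (rule sets.sets_into_space[OF D_sets])

lemma D_ne: "D \<noteq> {}"
  using D_pos by auto

lemma const_pos: "0 < \<delta>" "0 < \<Lambda>" "0 < L"
  using bounds by (auto simp: local_bounds_def)

lemma dens_bounds:
  assumes "h \<in> {1..horizon M}" "a \<in> actions M" "x \<in> D" "z \<in> D"
  shows "\<delta> \<le> dens M h a x z" "dens M h a x z \<le> \<Lambda>"
  using bounds assms unfolding local_bounds_def by blast+

lemma horizon_pos: "1 \<le> horizon M"
  using M by (simp add: is_mdp_def)

definition vol :: real where "vol = measure (leb d) D"

text \<open>A density that is at least \<open>\<delta>\<close> on \<open>D\<close> cannot have mass
  more than one there. Finiteness of the volume of \<open>D\<close> is read off from this.\<close>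

lemma D_emeasure_le: "ennreal \<delta> * emeasure (leb d) D \<le> 1"
proof -
  obtain x a where xa: "x \<in> D" "a \<in> actions M" using D_ne actions_ne by blast
  have h: "1 \<in> {1..horizon M}" using horizon_pos by simp
  have "ennreal \<delta> * emeasure (leb d) D = (\<integral>\<^sup>+y. ennreal \<delta> * indicator D y \<partial>leb d)"
    using D_sets by (simp add: nn_integral_cmult_indicator)
  also have "\<dots> \<le> (\<integral>\<^sup>+y. ennreal (dens M 1 a x y) \<partial>leb d)"
    using dens_bounds(1)[OF h xa(2) xa(1)] by (intro nn_integral_mono) (auto simp: indicator_def intro!: ennreal_leI)
  also have "\<dots> = 1" using nn_integral_dens[OF h _ xa(2)] xa(1) D_subset by auto
  finally show ?thesis .
qed

lemma emeasure_D: "emeasure (leb d) D = ennreal vol" and vol_pos: "0 < vol" and vol_le: "\<delta> * vol \<le> 1"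
proof -
  have "emeasure (leb d) D \<noteq> \<infinity>"
    using D_emeasure_le const_pos by (auto simp: ennreal_mult_top top_unique)
  then show eq: "emeasure (leb d) D = ennreal vol"
    unfolding vol_def by (simp add: emeasure_eq_ennreal_measure)
  show "0 < vol" using D_pos unfolding eq by simp
  show "\<delta> * vol \<le> 1"
    using D_emeasure_le const_pos \<open>0 < vol\<close> unfolding eq by (simp flip: ennreal_mult)
qed

definition inside :: "nat \<Rightarrow> vec \<Rightarrow> vec \<Rightarrow> real" where
  "inside h a x = (LINT y:D|leb d. dens M h a x y)"

definition outside :: "nat \<Rightarrow> vec \<Rightarrow> vec \<Rightarrow> real" where
  "outside h a x = (LINT z:space (leb d) - D|leb d. dens M h a x z)"

lemma dens_reflected: "dens MD h a x y = (if y \<in> D then dens M h a x y + outside h a x / vol else 0)"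
  by (simp add: reflected_def outside_def vol_def)

lemma dens_integrable:
  assumes "h \<in> {1..horizon M}" "a \<in> actions M" "x \<in> D"
  shows "integrable (leb d) (dens M h a x)" "(\<integral>y. dens M h a x y \<partial>leb d) = 1"
proof -
  have x: "x \<in> states M" using assms D_subset by auto
  show i: "integrable (leb d) (dens M h a x)"
    using nn_integral_dens[OF assms(1) x assms(2)] dens_section_leb[OF assms(1) x assms(2)]
      dens_nonneg[OF assms(1) x assms(2)] by (intro integrableI_nonneg) auto
  have "ennreal (\<integral>y. dens M h a x y \<partial>leb d) = ennreal 1"
    using nn_integral_eq_integral[OF i] dens_nonneg[OF assms(1) x assms(2)]
      nn_integral_dens[OF assms(1) x assms(2)] by simp
  then show "(\<integral>y. dens M h a x y \<partial>leb d) = 1"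
    by (subst (asm) ennreal_inj) (auto intro!: integral_nonneg_AE AE_I2 dens_nonneg assms x)
qed

lemma set_integrable_dens:
  assumes "h \<in> {1..horizon M}" "a \<in> actions M" "x \<in> D" "A \<in> sets (leb d)"
  shows "set_integrable (leb d) A (dens M h a x)"
  unfolding set_integrable_def using assms(4) dens_integrable(1)[OF assms(1-3)]
  by (rule integrable_mult_indicator)

lemma inside_outside:
  assumes "h \<in> {1..horizon M}" "a \<in> actions M" "x \<in> D"
  shows "inside h a x + outside h a x = 1" "0 \<le> outside h a x" "\<delta> * vol \<le> inside h a x" "inside h a x \<le> \<Lambda> * vol"
proof -
  have x: "x \<in> states M" using assms D_subset by auto
  have D': "space (leb d) - D \<in> sets (leb d)" using D_sets by auto
  have "inside h a x + outside h a x = (LINT y:D \<union> (space (leb d) - D)|leb d. dens M h a x y)"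
    unfolding inside_def outside_def
    by (intro set_integral_Un[symmetric] set_integrable_dens[OF assms] D_sets D') auto
  also have "D \<union> (space (leb d) - D) = space (leb d)" using D_space by auto
  also have "(LINT y:space (leb d)|leb d. dens M h a x y) = 1"
    using dens_integrable[OF assms] by (simp add: set_integral_space)
  finally show "inside h a x + outside h a x = 1" .
  show "0 \<le> outside h a x"
    unfolding outside_def set_lebesgue_integral_def
    by (intro integral_nonneg_AE AE_I2) (auto simp: indicator_def intro!: dens_nonneg assms x)
  have const: "set_integrable (leb d) D (\<lambda>_. c)" "(LINT y:D|leb d. c) = c * vol" for c :: real
    unfolding set_integrable_def set_lebesgue_integral_def
    using D_sets emeasure_D by (auto simp: vol_def mult.commute)
  show "\<delta> * vol \<le> inside h a x"
    unfolding inside_def const(2)[symmetric]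
    by (intro set_integral_mono const set_integrable_dens[OF assms D_sets]) (use dens_bounds assms in auto)
  show "inside h a x \<le> \<Lambda> * vol"
    unfolding inside_def const(2)[symmetric]
    by (intro set_integral_mono const set_integrable_dens[OF assms D_sets]) (use dens_bounds assms in auto)
qed

text \<open>\<open>\<delta>\<close> plus a lower bound for the escape term, which is nonnegative and
  at least \<open>1 / vol - \<Lambda>\<close>.\<close>

definition \<delta>' :: real where "\<delta>' = \<delta> + max 0 (1 / vol - \<Lambda>)"

lemma \<delta>'_ge: "\<delta> \<le> \<delta>'" by (simp add: \<delta>'_def)

text \<open>
  The escape term \<open>outside h a x / vol\<close> need not be bounded by \<open>\<Lambda>\<close>, but as the total mass is one it
  lies between \<open>1 / vol - \<Lambda>\<close> and \<open>1 / vol - \<delta>\<close>; this keeps the ratio of the bounds below \<open>2 * \<Lambda> / \<delta>\<close>.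
\<close>

lemma reflected_bounds:
  assumes h: "h \<in> {1..horizon M}" and a: "a \<in> actions M" and x: "x \<in> D" and y: "y \<in> D"
  shows "\<delta>' \<le> dens MD h a x y" "dens MD h a x y \<le> 2 * \<Lambda> / \<delta> * \<delta>'"
proof -
  note io = inside_outside[OF h a x] and b = dens_bounds[OF h a x y]
  have "outside h a x / vol = 1 / vol - inside h a x / vol"
    using io(1) by (simp add: eq_diff_eq flip: add_divide_distrib) (simp add: add.commute)?
  moreover have "\<delta> \<le> inside h a x / vol" "inside h a x / vol \<le> \<Lambda>"
    using io vol_pos by (auto simp: field_simps)
  ultimately have e: "1 / vol - \<Lambda> \<le> outside h a x / vol" "outside h a x / vol \<le> 1 / vol - \<delta>" by auto
  have e0: "0 \<le> outside h a x / vol" using io vol_pos by simp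
  have "dens MD h a x y = dens M h a x y + outside h a x / vol" using y by (simp add: dens_reflected)
  then show "\<delta>' \<le> dens MD h a x y" using e e0 b by (simp add: \<delta>'_def)
  have "dens MD h a x y \<le> \<Lambda> + (1 / vol - \<delta>)" using e b y by (simp add: dens_reflected)
  \<comment> \<open>Here \<open>1 / vol \<le> \<Lambda> + max 0 (1 / vol - \<Lambda>)\<close>. Since
    \<open>\<delta> \<le> \<Lambda>\<close>, the maximum may afterwards be multiplied by
    \<open>2 * \<Lambda> / \<delta> \<ge> 1\<close>, and the sum becomes a multiple of
    \<open>\<delta>'\<close>.\<close>
  also have "\<dots> \<le> 2 * \<Lambda> + max 0 (1 / vol - \<Lambda>)" using const_pos by (simp add: max_def)
  also have "\<dots> \<le> 2 * \<Lambda> + (2 * \<Lambda> / \<delta>) * max 0 (1 / vol - \<Lambda>)"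
  proof -
    have "1 \<le> 2 * \<Lambda> / \<delta>" using b const_pos by (simp add: divide_simps)
    then show ?thesis using mult_right_mono[of 1 "2 * \<Lambda> / \<delta>" "max 0 (1 / vol - \<Lambda>)"] by simp
  qed
  also have "\<dots> = 2 * \<Lambda> / \<delta> * \<delta>'" using const_pos by (simp add: \<delta>'_def distrib_left)
  finally show "dens MD h a x y \<le> 2 * \<Lambda> / \<delta> * \<delta>'" .
qed

lemma stateM_reflected: "stateM MD = restrict_space (leb d) D" "stateM MD = restrict_space (stateM M) D"
proof -
  show "stateM MD = restrict_space (leb d) D" by (simp add: stateM_def)
  also have "\<dots> = restrict_space (stateM M) D"
    unfolding stateM_def using states_sets D_sets D_subset
    by (subst restrict_restrict_space) (auto simp: Int_absorb1 Int_absorb2 states_subset D_space)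
  finally show "stateM MD = restrict_space (stateM M) D" .
qed

lemma D_sets_stateM: "D \<in> sets (stateM M)"
  unfolding stateM_def using states_sets D_sets D_subset
  by (subst sets_restrict_space_iff) (auto simp: Int_absorb2 states_subset)

lemma space_stateM_reflected: "space (stateM MD) = D"
  unfolding stateM_reflected(1) space_restrict_space using D_space by auto

lemma ident_reflected [measurable]: "(\<lambda>x. x) \<in> stateM MD \<rightarrow>\<^sub>M stateM M"
  unfolding stateM_reflected(2) by (rule measurable_restrict_space1) simp

lemma nn_integral_stateM_reflected:
  "(\<integral>\<^sup>+y. f y \<partial>stateM MD) = (\<integral>\<^sup>+y. f y * indicator D y \<partial>leb d)"
  unfolding stateM_reflected(1) using D_sets D_space by (subst nn_integral_restrict_space) (auto simp: Int_absorb2)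

lemma outside_measurable:
  assumes h: "h \<in> {1..horizon M}"
  shows "(\<lambda>(x, a). outside h a x) \<in> borel_measurable (stateM MD \<Otimes>\<^sub>M actionM M)"
proof -
  interpret sigma_finite_measure "leb d" by (rule sigma_finite_leb)
  have "(\<lambda>q. ((fst (fst q), snd (fst q)), snd q)) \<in> (stateM MD \<Otimes>\<^sub>M actionM M) \<Otimes>\<^sub>M leb d
      \<rightarrow>\<^sub>M (stateM M \<Otimes>\<^sub>M actionM M) \<Otimes>\<^sub>M leb d"
    by (intro measurable_Pair measurable_snd measurable_compose[OF measurable_fst measurable_snd]
      measurable_compose[OF measurable_compose[OF measurable_fst measurable_fst] ident_reflected])
  from measurable_compose[OF this dens_measurable_leb[OF h]]
  have "(\<lambda>(p, z). indicator (space (leb d) - D) z *\<^sub>R dens M h (snd p) (fst p) z)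
      \<in> borel_measurable ((stateM MD \<Otimes>\<^sub>M actionM M) \<Otimes>\<^sub>M leb d)"
    using D_sets unfolding split_def
    by (intro borel_measurable_scaleR measurable_compose[OF measurable_snd borel_measurable_indicator]) auto
  then show ?thesis
    unfolding outside_def set_lebesgue_integral_def split_def by (rule borel_measurable_lebesgue_integral[unfolded split_def])
qed

text \<open>The uniform redistribution returns to \<open>D\<close> exactly the mass that escapes.
  Being an MDP again, the reflected process inherits all facts about path laws through the sublocale
  below, with the prefix \<open>refl\<close>.\<close>

lemma is_mdp_reflected: "is_mdp MD"
proof -
  have "(\<lambda>(x, a, y). dens MD h a x y) \<in> borel_measurable (stateM MD \<Otimes>\<^sub>M actionM M \<Otimes>\<^sub>M leb d)"
    if h: "h \<in> {1..horizon M}" for h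
  proof -
    let ?B = "stateM MD \<Otimes>\<^sub>M actionM M \<Otimes>\<^sub>M leb d"
    have m: "(\<lambda>(x, a, y). dens M h a x y) \<in> borel_measurable (stateM M \<Otimes>\<^sub>M actionM M \<Otimes>\<^sub>M leb d)"
      using M h unfolding is_mdp_def by blast
    have "(\<lambda>q. (fst q, snd q)) \<in> ?B \<rightarrow>\<^sub>M stateM M \<Otimes>\<^sub>M actionM M \<Otimes>\<^sub>M leb d"
      by (intro measurable_Pair measurable_snd measurable_compose[OF measurable_fst ident_reflected])
    from measurable_compose[OF this m]
    have 1: "(\<lambda>q. dens M h (fst (snd q)) (fst q) (snd (snd q))) \<in> borel_measurable ?B"
      by (simp add: split_def)
    have "(\<lambda>q. (fst q, fst (snd q))) \<in> ?B \<rightarrow>\<^sub>M stateM MD \<Otimes>\<^sub>M actionM M"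
      by measurable
    from measurable_compose[OF this outside_measurable[OF h]]
    have 2: "(\<lambda>q. outside h (fst (snd q)) (fst q)) \<in> borel_measurable ?B" by simp
    have 3: "(\<lambda>q. snd (snd q)) \<in> ?B \<rightarrow>\<^sub>M leb d" by measurable
    have "(\<lambda>(x, a, y). dens MD h a x y) =
        (\<lambda>q. indicator D (snd (snd q)) * (dens M h (fst (snd q)) (fst q) (snd (snd q)) + outside h (fst (snd q)) (fst q) / vol))"
      by (auto simp: dens_reflected fun_eq_iff indicator_def)
    then show ?thesis
      using 1 2 measurable_compose[OF 3 borel_measurable_indicator[OF D_sets]]
      by (simp only:) (intro borel_measurable_times borel_measurable_add borel_measurable_divide borel_measurable_const)
  qed
  moreover have "0 \<le> dens MD h a x y"
    if "h \<in> {1..horizon M}" "x \<in> D" "a \<in> actions M" for h x a y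
    using reflected_bounds(1)[of h a x y] that \<delta>'_ge const_pos by (auto simp: dens_reflected)
  moreover have "(\<integral>\<^sup>+y. ennreal (dens MD h a x y) \<partial>leb d) = 1"
    if h: "h \<in> {1..horizon M}" and x: "x \<in> D" and a: "a \<in> actions M" for h x a
  proof -
    note io = inside_outside[OF h a x]
    have i: "integrable (leb d) (\<lambda>y. indicator D y *\<^sub>R dens M h a x y + indicator D y *\<^sub>R (outside h a x / vol))"
      using set_integrable_dens[OF h a x D_sets] D_sets emeasure_D unfolding set_integrable_def
      by (intro Bochner_Integration.integrable_add) auto
    have "(\<integral>\<^sup>+y. ennreal (dens MD h a x y) \<partial>leb d)
      = (\<integral>\<^sup>+y. ennreal (indicator D y *\<^sub>R dens M h a x y + indicator D y *\<^sub>R (outside h a x / vol)) \<partial>leb d)"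
      by (intro nn_integral_cong) (auto simp: dens_reflected indicator_def)
    also have "\<dots> = ennreal (\<integral>y. indicator D y *\<^sub>R dens M h a x y + indicator D y *\<^sub>R (outside h a x / vol) \<partial>leb d)"
      using less_imp_le[OF less_le_trans[OF const_pos(1) dens_bounds(1)[OF h a x]]] io vol_pos
      by (intro nn_integral_eq_integral[OF i] AE_I2) (auto simp: indicator_def intro!: add_nonneg_nonneg)
    also have "(\<integral>y. indicator D y *\<^sub>R dens M h a x y + indicator D y *\<^sub>R (outside h a x / vol) \<partial>leb d)
      = inside h a x + vol * (outside h a x / vol)"
      unfolding inside_def set_lebesgue_integral_def
      using set_integrable_dens[OF h a x D_sets] D_sets emeasure_D unfolding set_integrable_def
      by (subst Bochner_Integration.integral_add) (auto simp: vol_def)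
    also have "\<dots> = 1" using io vol_pos by simp
    finally show ?thesis by simp
  qed
  moreover have "dens MD h a x y = 0" if "y \<notin> D" for h a x y
    using that by (simp add: dens_reflected)
  ultimately have "\<forall>h\<in>{1..horizon M}.
        (\<lambda>(x, a, y). dens MD h a x y) \<in> borel_measurable (stateM MD \<Otimes>\<^sub>M actionM M \<Otimes>\<^sub>M leb d) \<and>
        (\<forall>x\<in>D. \<forall>a\<in>actions M. (\<forall>y\<in>space (leb d). 0 \<le> dens MD h a x y) \<and>
           (\<forall>y\<in>space (leb d) - D. dens MD h a x y = 0) \<and> (\<integral>\<^sup>+y. ennreal (dens MD h a x y) \<partial>leb d) = 1)"
    by blast
  then show ?thesis
    using M D_sets unfolding is_mdp_def reflected_simps by blast
qed

sublocale refl: valid_mdp MD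
  by standard (rule is_mdp_reflected)

lemma finite_measure_stateM_reflected: "finite_measure (stateM MD)"
  using emeasure_D D_sets D_space
  by (intro finite_measureI) (simp add: stateM_reflected(1) emeasure_restrict_space space_restrict_space Int_absorb2)

text \<open>The essential supremum controls \<open>Lf\<close> only almost everywhere on
  \<open>D\<close>, so the Lipschitz bound is claimed on the set \<open>E\<close> where
  \<open>Lf\<close> stays below it. This set serves all times, states and actions at once. The
  escape term contributes the integral of \<open>Lf\<close> outside \<open>D\<close> divided by the
  volume, and \<open>L\<close> was assumed to bound the sum of the two.\<close>

lemma reflected_lipschitz:
  obtains E where "E \<in> sets (stateM MD)" "AE y in stateM MD. y \<in> E"
    "\<And>h a1 a2 x1 x2 y. h \<in> {1..horizon M} \<Longrightarrow> a1 \<in> actions M \<Longrightarrow> a2 \<in> actions M \<Longrightarrow> x1 \<in> D \<Longrightarrow> x2 \<in> D \<Longrightarrow>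
      y \<in> E \<Longrightarrow> \<bar>dens MD h a1 x1 y - dens MD h a2 x2 y\<bar> \<le> L * (edist d x1 x2 + adist M a1 a2)"
proof -
  let ?C = "space (leb d) - D"
  have Lf0: "0 \<le> Lf y" if "y \<in> space (leb d)" for y
    using bounds that unfolding local_bounds_def by blast+
  have Lf_meas: "Lf \<in> borel_measurable (leb d)"
    using bounds unfolding local_bounds_def by blast
  define I where "I = (\<integral>\<^sup>+y\<in>?C. ennreal (Lf y) \<partial>leb d)"
  define e where "e = esssup (stateM MD) (\<lambda>y. ennreal (Lf y))"
  have le: "e + I / ennreal vol \<le> ennreal L"
    using bounds unfolding local_bounds_def e_def I_def stateM_reflected(1) emeasure_D by blast
  define E where "E = {y \<in> space (stateM MD). ennreal (Lf y) \<le> e}"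
  have "Lf \<in> borel_measurable (stateM MD)"
    using Lf_meas unfolding stateM_reflected(1) by (rule measurable_restrict_space1)
  then have E: "E \<in> sets (stateM MD)" unfolding E_def by measurable
  have AE: "AE y in stateM MD. y \<in> E"
    using esssup_AE[of "\<lambda>y. ennreal (Lf y)" "stateM MD"] AE_space by eventually_elim (simp add: E_def e_def)
  have "I \<noteq> \<infinity>"
  proof
    assume "I = \<infinity>"
    then have "I / ennreal vol = \<infinity>" by (simp add: ennreal_top_divide)
    with le show False by (simp add: top_unique)
  qed
  then obtain i where i: "I = ennreal i" "0 \<le> i" by (cases I) auto
  have C: "?C \<in> sets (leb d)" using D_sets by auto
  have Lf_int: "integrable (leb d) (\<lambda>y. indicator ?C y * Lf y)"
    and Lf_i: "(\<integral>y. indicator ?C y * Lf y \<partial>leb d) = i"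
  proof -
    have eq: "(\<integral>\<^sup>+y. ennreal (indicator ?C y * Lf y) \<partial>leb d) = ennreal i"
      unfolding i(1)[symmetric] I_def by (intro nn_integral_cong) (auto simp: indicator_def)
    have m: "(\<lambda>y. indicator ?C y * Lf y) \<in> borel_measurable (leb d)" using Lf_meas C by measurable
    have nn: "AE y in leb d. 0 \<le> indicator ?C y * Lf y" by (intro AE_I2) (auto simp: indicator_def Lf0)
    show "integrable (leb d) (\<lambda>y. indicator ?C y * Lf y)"
      using eq m nn by (intro integrableI_nonneg) auto
    then show "(\<integral>y. indicator ?C y * Lf y \<partial>leb d) = i"
      using eq m nn i(2) by (simp add: integral_eq_nn_integral)
  qed
  have lip: "\<bar>dens MD h a1 x1 y - dens MD h a2 x2 y\<bar> \<le> L * (edist d x1 x2 + adist M a1 a2)"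
    if h: "h \<in> {1..horizon M}" and a: "a1 \<in> actions M" "a2 \<in> actions M" and x: "x1 \<in> D" "x2 \<in> D" and y: "y \<in> E"
    for h a1 a2 x1 x2 y
  proof -
    define r where "r = edist d x1 x2 + adist M a1 a2"
    have "0 \<le> adist M a1 a2"
      using M Metric_space.nonneg[of "actions M" "adist M"] by (simp add: is_mdp_def)
    then have r0: "0 \<le> r" by (simp add: r_def edist_def)
    have yD: "y \<in> D" and yl: "y \<in> space (leb d)" using y D_space by (auto simp: E_def space_stateM_reflected)
    have pl: "\<bar>dens M h a1 x1 z - dens M h a2 x2 z\<bar> \<le> Lf z * r" if "z \<in> space (leb d)" for z
      using bounds h a x that unfolding local_bounds_def r_def by blast
    have "outside h a1 x1 - outside h a2 x2 = (\<integral>z. indicator ?C z * dens M h a1 x1 z - indicator ?C z * dens M h a2 x2 z \<partial>leb d)"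
      unfolding outside_def set_lebesgue_integral_def
      using set_integrable_dens[OF h a(1) x(1) C] set_integrable_dens[OF h a(2) x(2) C]
      unfolding set_integrable_def by (subst Bochner_Integration.integral_diff) auto
    also have "\<bar>\<dots>\<bar> \<le> (\<integral>z. \<bar>indicator ?C z * dens M h a1 x1 z - indicator ?C z * dens M h a2 x2 z\<bar> \<partial>leb d)"
      by (rule integral_abs_bound)
    also have "\<dots> \<le> (\<integral>z. (indicator ?C z * Lf z) * r \<partial>leb d)"
    proof (rule integral_mono)
      show "integrable (leb d) (\<lambda>z. \<bar>indicator ?C z * dens M h a1 x1 z - indicator ?C z * dens M h a2 x2 z\<bar>)"
        using set_integrable_dens[OF h a(1) x(1) C] set_integrable_dens[OF h a(2) x(2) C]
        unfolding set_integrable_def by (intro integrable_abs Bochner_Integration.integrable_diff) auto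
      show "integrable (leb d) (\<lambda>z. (indicator ?C z * Lf z) * r)" using Lf_int by simp
    qed (use pl in \<open>auto simp: indicator_def\<close>)
    also have "\<dots> = i * r" using Lf_i by simp
    finally have out: "\<bar>outside h a1 x1 - outside h a2 x2\<bar> \<le> i * r" .
    have "ennreal (Lf y) + ennreal (i / vol) \<le> ennreal L"
      using order_trans[OF add_right_mono le] y vol_pos i by (simp add: E_def divide_ennreal)
    then have Ly: "Lf y + i / vol \<le> L"
      using Lf0[OF yl] vol_pos i const_pos by (simp flip: ennreal_plus)
    have "\<bar>dens MD h a1 x1 y - dens MD h a2 x2 y\<bar>
        \<le> \<bar>dens M h a1 x1 y - dens M h a2 x2 y\<bar> + \<bar>outside h a1 x1 - outside h a2 x2\<bar> / vol"
    proof -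
      have "dens MD h a1 x1 y - dens MD h a2 x2 y
        = (dens M h a1 x1 y - dens M h a2 x2 y) + (outside h a1 x1 - outside h a2 x2) / vol"
        using yD by (simp add: dens_reflected diff_divide_distrib)
      then show ?thesis using abs_triangle_ineq vol_pos by (metis abs_divide abs_of_pos)
    qed
    also have "\<dots> \<le> Lf y * r + i * r / vol"
      using pl[OF yl] out vol_pos by (intro add_mono divide_right_mono) auto
    also have "\<dots> = (Lf y + i / vol) * r" by (simp add: distrib_right)
    also have "\<dots> \<le> L * r" using Ly r0 by (rule mult_right_mono)
    finally show ?thesis by (simp add: r_def)
  qed
  show thesis using that[OF E AE lip] .
qed

section \<open>Comparison of the path laws\<close>

lemma path_ident_measurable: "(\<lambda>p. p) \<in> pathM MD h n \<rightarrow>\<^sub>M pathM M h n"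
proof -
  have "(\<lambda>s. \<lambda>i\<in>{h..h + n}. s i) \<in> Pi\<^sub>M {h..h + n} (\<lambda>_. stateM MD) \<rightarrow>\<^sub>M Pi\<^sub>M {h..h + n} (\<lambda>_. stateM M)"
  proof (rule measurable_restrict)
    fix i assume "i \<in> {h..h + n}"
    then have "(\<lambda>s. s i) \<in> Pi\<^sub>M {h..h + n} (\<lambda>_. stateM MD) \<rightarrow>\<^sub>M stateM MD"
      by (rule measurable_component_singleton)
    from measurable_compose[OF this ident_reflected]
    show "(\<lambda>s. s i) \<in> Pi\<^sub>M {h..h + n} (\<lambda>_. stateM MD) \<rightarrow>\<^sub>M stateM M" .
  qed
  then have "(\<lambda>s. s) \<in> Pi\<^sub>M {h..h + n} (\<lambda>_. stateM MD) \<rightarrow>\<^sub>M Pi\<^sub>M {h..h + n} (\<lambda>_. stateM M)"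
    by (rule measurable_cong[THEN iffD1, rotated]) (auto simp: space_PiM PiE_restrict)
  then have "(\<lambda>p. (fst p, snd p)) \<in> pathM MD h n \<rightarrow>\<^sub>M pathM M h n"
    unfolding pathM_def reflected_simps by (intro measurable_Pair measurable_snd measurable_compose[OF measurable_fst])
  then show ?thesis by simp
qed

lemma path_measurable_reflected:
  assumes "\<Phi> \<in> pathM M h n \<rightarrow>\<^sub>M N"
  shows "\<Phi> \<in> pathM MD h n \<rightarrow>\<^sub>M N"
  by (rule measurable_compose[OF path_ident_measurable assms])

definition stay :: "nat \<Rightarrow> ((nat \<Rightarrow> vec) \<times> (nat \<Rightarrow> vec)) set" where
  "stay n = {p. \<forall>i\<le>n. fst p i \<in> D}"

lemma in_D_measurable:
  assumes "i \<le> n"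
  shows "{p \<in> space (pathM M 0 n). fst p i \<in> D} \<in> sets (pathM M 0 n)"
  using measurable_sets[OF path_state_measurable[of 0 i n] D_sets_stateM] assms
  by (simp add: vimage_def Int_def conj_commute)

lemma stay_measurable: "stay n \<inter> space (pathM M 0 n) \<in> sets (pathM M 0 n)"
proof -
  have "stay n \<inter> space (pathM M 0 n) = (\<Inter>i\<in>{..n}. {p \<in> space (pathM M 0 n). fst p i \<in> D})"
    by (auto simp: stay_def)
  then show ?thesis using in_D_measurable by (auto intro!: sets.finite_INT)
qed

text \<open>The induction is over all \<open>\<Phi>\<close> because the hypothesis for paths of
  length \<open>n\<close> is applied to the one-step integral of \<open>\<Phi>\<close>. On
  \<open>D\<close> the two policies choose actions by the same law, so only the densities have to be
  compared.\<close>

lemma reflected_path_law_dominates: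
  assumes \<pi>: "\<pi> \<in> policies M" and \<pi>': "\<pi>' \<in> policies MD"
    and eq: "\<And>t x. t < horizon M \<Longrightarrow> x \<in> D \<Longrightarrow> \<pi>' t x = \<pi> t x"
    and x: "x \<in> D" and "n \<le> horizon M" and "\<Phi> \<in> borel_measurable (pathM M 0 n)"
  shows "(\<integral>\<^sup>+p. \<Phi> p * indicator (stay n) p \<partial>path_law M \<pi> 0 x n) \<le> (\<integral>\<^sup>+p. \<Phi> p \<partial>path_law MD \<pi>' 0 x n)"
  using assms(5,6)
proof (induction n arbitrary: \<Phi>)
  case 0
  have xM: "x \<in> states M" using x D_subset by auto
  have sp: "((\<lambda>i\<in>{0}. x), (\<lambda>i. undefined)) \<in> space (pathM MD 0 0)" "((\<lambda>i\<in>{0}. x), (\<lambda>i. undefined)) \<in> space (pathM M 0 0)"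
    using x xM by (auto simp: pathM_def space_pair_measure space_PiM space_stateM space_stateM_reflected)
  have "(\<integral>\<^sup>+p. \<Phi> p * indicator (stay 0) p \<partial>path_law M \<pi> 0 x 0) \<le> (\<integral>\<^sup>+p. \<Phi> p \<partial>path_law M \<pi> 0 x 0)"
    by (intro nn_integral_mono) (auto simp: indicator_def)
  also have "\<dots> = (\<integral>\<^sup>+p. \<Phi> p \<partial>path_law MD \<pi>' 0 x 0)"
    using sp 0 path_measurable_reflected[OF 0(2)] by (simp add: nn_integral_return)
  finally show ?case .
next
  case (Suc n)
  have n: "0 + n < horizon M" "n < horizon M" "n \<le> horizon M" using Suc by auto
  have xM: "x \<in> states M" using x D_subset by auto
  \<comment> \<open>Staying in \<open>D\<close> up to time \<open>n + 1\<close> is split: the last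
    state is tested inside \<open>\<Phi>D\<close>, and the test of the first \<open>n + 1\<close>
    states remains as the indicator that the induction hypothesis expects.\<close>
  define \<Phi>D where "\<Phi>D p = \<Phi> p * indicator {p \<in> space (pathM M 0 (Suc n)). fst p (Suc n) \<in> D} p" for p
  have \<Phi>D: "\<Phi>D \<in> borel_measurable (pathM M 0 (Suc n))"
    unfolding \<Phi>D_def[abs_def] using Suc.prems in_D_measurable[of "Suc n" "Suc n"] by measurable
  have \<Phi>s: "(\<lambda>p. \<Phi> p * indicator (stay (Suc n) \<inter> space (pathM M 0 (Suc n))) p) \<in> borel_measurable (pathM M 0 (Suc n))"
    using Suc.prems stay_measurable[of "Suc n"] by measurable
  have sets: "sets (path_law M \<pi> 0 x n) = sets (pathM M 0 n)" using sets_path_law[OF \<pi> xM] n by simp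
  have sets': "sets (path_law MD \<pi>' 0 x n) = sets (pathM MD 0 n)" using refl.sets_path_law[OF \<pi>'] x n by simp
  have sets_S: "sets (path_law M \<pi> 0 x (Suc n)) = sets (pathM M 0 (Suc n))" using sets_path_law[OF \<pi> xM, of 0 "Suc n"] n by simp
  have "(\<integral>\<^sup>+p. \<Phi> p * indicator (stay (Suc n)) p \<partial>path_law M \<pi> 0 x (Suc n))
      = (\<integral>\<^sup>+p. \<Phi> p * indicator (stay (Suc n) \<inter> space (pathM M 0 (Suc n))) p \<partial>path_law M \<pi> 0 x (Suc n))"
    by (intro nn_integral_cong) (simp add: sets_eq_imp_space_eq[OF sets_S] indicator_def)
  also have "\<dots> = (\<integral>\<^sup>+p. step_integral \<pi> 0 n (\<lambda>p. \<Phi> p * indicator (stay (Suc n) \<inter> space (pathM M 0 (Suc n))) p) p \<partial>path_law M \<pi> 0 x n)"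
    by (rule nn_integral_path_law_Suc[OF \<pi> xM n(1) \<Phi>s])
  also have "\<dots> \<le> (\<integral>\<^sup>+p. step_integral \<pi> 0 n \<Phi>D p * indicator (stay n) p \<partial>path_law M \<pi> 0 x n)"
  proof (rule nn_integral_mono)
    fix p
    show "step_integral \<pi> 0 n (\<lambda>p. \<Phi> p * indicator (stay (Suc n) \<inter> space (pathM M 0 (Suc n))) p) p
        \<le> step_integral \<pi> 0 n \<Phi>D p * indicator (stay n) p"
    proof (cases "p \<in> stay n")
      case True
      then show ?thesis unfolding step_integral_def \<Phi>D_def
        by (auto intro!: nn_integral_mono mult_left_mono simp: indicator_def stay_def)
    next
      case False
      then obtain i where i: "i \<le> n" "fst p i \<notin> D" by (auto simp: stay_def)
      have "((fst p)(Suc n := y), a) \<notin> stay (Suc n)" for y a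
        using i by (auto simp: stay_def intro!: exI[of _ i])
      then show ?thesis unfolding step_integral_def by (simp add: indicator_def)
    qed
  qed
  also have "\<dots> \<le> (\<integral>\<^sup>+p. step_integral \<pi> 0 n \<Phi>D p \<partial>path_law MD \<pi>' 0 x n)"
    by (rule Suc.IH[OF n(3) step_integral_measurable[OF \<pi> n(1) \<Phi>D]])
  also have "\<dots> \<le> (\<integral>\<^sup>+p. refl.step_integral \<pi>' 0 n \<Phi> p \<partial>path_law MD \<pi>' 0 x n)"
  proof (rule nn_integral_mono)
    fix p assume "p \<in> space (path_law MD \<pi>' 0 x n)"
    then have p': "p \<in> space (pathM MD 0 n)" by (simp add: sets_eq_imp_space_eq[OF sets'])
    then have p: "p \<in> space (pathM M 0 n)" using measurable_space[OF path_ident_measurable] by blast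
    have pD: "fst p n \<in> D" using refl.space_pathM_state[OF p', of n] by simp
    then have pM: "fst p n \<in> states M" using D_subset by auto
    have h: "Suc n \<in> {1..horizon M}" using n by simp
    show "step_integral \<pi> 0 n \<Phi>D p \<le> refl.step_integral \<pi>' 0 n \<Phi> p"
      unfolding step_integral_def refl.step_integral_def eq[OF n(2) pD, simplified] add_0
    proof (rule nn_integral_mono)
      fix u assume "u \<in> space (\<pi> n (fst p n))"
      then have u: "u \<in> actions M" using policy_at(3)[OF \<pi> n(2) pM] by simp
      let ?e = "\<lambda>y. ((fst p)(Suc n := y), (snd p)(n := u))"
      have e: "?e \<in> stateM M \<rightarrow>\<^sub>M pathM M 0 (Suc n)"
        using measurable_Pair2[OF path_extend_measurable, of "(p, u)" 0 n] p u
        by (simp add: space_pair_measure space_actionM)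
      have m1: "(\<lambda>y. \<Phi>D (?e y)) \<in> borel_measurable (stateM M)" using measurable_compose[OF e \<Phi>D] .
      have m2: "(\<lambda>y. \<Phi> (?e y)) \<in> borel_measurable (stateM MD)"
        using measurable_compose[OF ident_reflected measurable_compose[OF e Suc.prems(2)]] .
      have "(\<integral>\<^sup>+y. \<Phi>D (?e y) \<partial>trans_kernel M (Suc n) (fst p n) u)
          = (\<integral>\<^sup>+y. \<Phi>D (?e y) * ennreal (dens M (Suc n) u (fst p n) y) * indicator (states M) y \<partial>leb d)"
        using nn_integral_trans_kernel[OF h pM u m1] by (simp add: nn_integral_stateM)
      also have "\<dots> \<le> (\<integral>\<^sup>+y. \<Phi> (?e y) * ennreal (dens MD (Suc n) u (fst p n) y) * indicator D y \<partial>leb d)"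
      proof (rule nn_integral_mono)
        fix y
        show "\<Phi>D (?e y) * ennreal (dens M (Suc n) u (fst p n) y) * indicator (states M) y
          \<le> \<Phi> (?e y) * ennreal (dens MD (Suc n) u (fst p n) y) * indicator D y"
        proof (cases "y \<in> D")
          case True
          have "dens M (Suc n) u (fst p n) y \<le> dens MD (Suc n) u (fst p n) y"
            using True inside_outside(2)[OF h u pD] vol_pos by (simp add: dens_reflected)
          then show ?thesis using True
            by (auto simp: \<Phi>D_def indicator_def intro!: mult_left_mono ennreal_leI)
        qed (simp add: \<Phi>D_def)
      qed
      also have "\<dots> = (\<integral>\<^sup>+y. \<Phi> (?e y) \<partial>trans_kernel MD (Suc n) (fst p n) u)"
        using refl.nn_integral_trans_kernel[of "Suc n" "fst p n" u, OF _ _ _ m2] h pD u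
        by (simp add: nn_integral_stateM_reflected)
      finally show "(\<integral>\<^sup>+y. \<Phi>D (?e y) \<partial>trans_kernel M (Suc n) (fst p n) u)
          \<le> (\<integral>\<^sup>+y. \<Phi> (?e y) \<partial>trans_kernel MD (Suc n) (fst p n) u)" .
    qed
  qed
  also have "\<dots> = (\<integral>\<^sup>+p. \<Phi> p \<partial>path_law MD \<pi>' 0 x (Suc n))"
    using refl.nn_integral_path_law_Suc[OF \<pi>', of x 0 n \<Phi>] x n path_measurable_reflected[OF Suc.prems(2)] by simp
  finally show ?case .
qed

text \<open>Domination gives only one inequality, and only for nonnegative functions. It is applied
  to \<open>K + W\<close> and \<open>K - W\<close>, which lie between 0 and \<open>2 * K\<close>, so
  the paths that leave \<open>D\<close> cost at most \<open>2 * K\<close> times their probability. A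
  union bound over the exit times gives the sum.\<close>

lemma reflected_expectation_close:
  assumes \<pi>: "\<pi> \<in> policies M" and \<pi>': "\<pi>' \<in> policies MD"
    and eq: "\<And>t x. t < horizon M \<Longrightarrow> x \<in> D \<Longrightarrow> \<pi>' t x = \<pi> t x"
    and x: "x \<in> D" and W: "W \<in> borel_measurable (pathM M 0 (horizon M))"
    and K: "\<And>p. p \<in> space (pathM M 0 (horizon M)) \<Longrightarrow> \<bar>W p\<bar> \<le> K"
  shows "ennreal \<bar>(\<integral>p. W p \<partial>path_law M \<pi> 0 x (horizon M)) - (\<integral>p. W p \<partial>path_law MD \<pi>' 0 x (horizon M))\<bar>
    \<le> ennreal (2 * K) * (\<Sum>l\<in>{0..horizon M}. exit_prob M D \<pi> x l)"
proof -
  let ?H = "horizon M"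
  let ?P = "path_law M \<pi> 0 x ?H" and ?Q = "path_law MD \<pi>' 0 x ?H"
  have xM: "x \<in> states M" using x D_subset by auto
  have sP: "sets ?P = sets (pathM M 0 ?H)" using sets_path_law[OF \<pi> xM] by simp
  have sQ: "sets ?Q = sets (pathM MD 0 ?H)" using refl.sets_path_law[OF \<pi>'] x by simp
  note spP = sets_eq_imp_space_eq[OF sP] and spQ = sets_eq_imp_space_eq[OF sQ]
  interpret P: prob_space ?P using prob_space_path_law[OF \<pi> xM] by simp
  interpret Q: prob_space ?Q using refl.prob_space_path_law[OF \<pi>'] x by simp
  obtain p0 where "p0 \<in> space ?P" using P.not_empty by blast
  then have K0: "0 \<le> K" using K[of p0] spP by simp
  let ?S = "stay ?H \<inter> space (pathM M 0 ?H)"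
  define ex where "ex = P.prob (space ?P - ?S)"
  have ex_sum: "ennreal ex \<le> (\<Sum>l\<in>{0..?H}. exit_prob M D \<pi> x l)"
  proof -
    have "ennreal ex = emeasure ?P (space ?P - ?S)" by (simp add: ex_def P.emeasure_eq_measure)
    also have "space ?P - ?S = (\<Union>l\<in>{0..?H}. {p \<in> space ?P. fst p l \<notin> D})"
      by (auto simp: stay_def spP)
    also have "emeasure ?P \<dots> \<le> (\<Sum>l\<in>{0..?H}. emeasure ?P {p \<in> space ?P. fst p l \<notin> D})"
    proof (rule emeasure_subadditive_finite)
      have "{p \<in> space ?P. fst p l \<notin> D} \<in> sets ?P" if "l \<le> ?H" for l
      proof -
        have "{p \<in> space ?P. fst p l \<notin> D} = space (pathM M 0 ?H) - {p \<in> space (pathM M 0 ?H). fst p l \<in> D}"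
          by (auto simp: spP)
        then show ?thesis using in_D_measurable[OF that] by (simp add: sP sets.Diff)
      qed
      then show "(\<lambda>l. {p \<in> space ?P. fst p l \<notin> D}) ` {0..?H} \<subseteq> sets ?P" by auto
    qed simp
    also have "\<dots> = (\<Sum>l\<in>{0..?H}. exit_prob M D \<pi> x l)"
      by (simp add: exit_prob_def Let_def split_def)
    finally show ?thesis .
  qed
  have one_sided: "(\<integral>p. U p \<partial>?P) \<le> (\<integral>p. U p \<partial>?Q) + 2 * K * ex"
    if U: "U \<in> borel_measurable (pathM M 0 ?H)" and UK: "\<And>p. p \<in> space (pathM M 0 ?H) \<Longrightarrow> \<bar>U p\<bar> \<le> K" for U
  proof -
    have UP: "U \<in> borel_measurable ?P" using U by (simp add: measurable_cong_sets[OF sP refl])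
    have UQ: "U \<in> borel_measurable ?Q" using path_measurable_reflected[OF U] by (simp add: measurable_cong_sets[OF sQ refl])
    have QK: "\<bar>U p\<bar> \<le> K" if "p \<in> space ?Q" for p
      using measurable_space[OF path_ident_measurable, of p 0 ?H] that UK by (simp add: spQ)
    have PK: "\<bar>U p\<bar> \<le> K" if "p \<in> space ?P" for p using UK that by (simp add: spP)
    have iP: "integrable ?P U" and iQ: "integrable ?Q U"
      using UP PK UQ QK by (auto intro!: P.integrable_const_bound[of _ K] Q.integrable_const_bound[of _ K])
    have P0: "0 \<le> K + U p" if "p \<in> space ?P" for p using PK[OF that] by linarith
    have Q0: "0 \<le> K + U p" if "p \<in> space ?Q" for p using QK[OF that] by linarith
    have nP: "(\<integral>\<^sup>+p. ennreal (K + U p) \<partial>?P) = ennreal (K + (\<integral>p. U p \<partial>?P))"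
      using iP P0 by (subst nn_integral_eq_integral) (auto simp: P.prob_space)
    have nQ: "(\<integral>\<^sup>+p. ennreal (K + U p) \<partial>?Q) = ennreal (K + (\<integral>p. U p \<partial>?Q))"
      using iQ Q0 by (subst nn_integral_eq_integral) (auto simp: Q.prob_space)
    have "(\<integral>\<^sup>+p. ennreal (K + U p) \<partial>?P)
        \<le> (\<integral>\<^sup>+p. ennreal (K + U p) * indicator (stay ?H) p + ennreal (2 * K) * indicator (space ?P - ?S) p \<partial>?P)"
    proof (rule nn_integral_mono)
      fix p assume "p \<in> space ?P"
      then show "ennreal (K + U p) \<le> ennreal (K + U p) * indicator (stay ?H) p + ennreal (2 * K) * indicator (space ?P - ?S) p"
        using PK[of p] by (auto simp: indicator_def spP intro!: ennreal_leI)
    qed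
    also have "\<dots> = (\<integral>\<^sup>+p. ennreal (K + U p) * indicator (stay ?H) p \<partial>?P) + ennreal (2 * K) * ennreal ex"
    proof (subst nn_integral_add)
      have "(\<lambda>p. ennreal (K + U p) * indicator ?S p) \<in> borel_measurable ?P"
        using UP stay_measurable[of ?H]
        by (intro borel_measurable_times_ennreal borel_measurable_indicator measurable_compose[OF _ measurable_ennreal]
          borel_measurable_add borel_measurable_const) (simp_all add: sP)
      then show "(\<lambda>p. ennreal (K + U p) * indicator (stay ?H) p) \<in> borel_measurable ?P"
        by (rule measurable_cong[THEN iffD1, rotated]) (simp add: indicator_def spP)
      have S: "space ?P - ?S \<in> sets ?P" using stay_measurable[of ?H] by (simp add: sP spP sets.Diff)
      then show "(\<lambda>p. ennreal (2 * K) * indicator (space ?P - ?S) p) \<in> borel_measurable ?P" by measurable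
      show "(\<integral>\<^sup>+p. ennreal (K + U p) * indicator (stay ?H) p \<partial>?P) + (\<integral>\<^sup>+p. ennreal (2 * K) * indicator (space ?P - ?S) p \<partial>?P)
        = (\<integral>\<^sup>+p. ennreal (K + U p) * indicator (stay ?H) p \<partial>?P) + ennreal (2 * K) * ennreal ex"
        using S by (simp add: nn_integral_cmult_indicator ex_def P.emeasure_eq_measure)
    qed
    also have "\<dots> \<le> (\<integral>\<^sup>+p. ennreal (K + U p) \<partial>?Q) + ennreal (2 * K) * ennreal ex"
      using U by (intro add_right_mono reflected_path_law_dominates[OF \<pi> \<pi>' eq x]) auto
    finally have "ennreal (K + (\<integral>p. U p \<partial>?P)) \<le> ennreal (K + (\<integral>p. U p \<partial>?Q)) + ennreal (2 * K * ex)"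
      using K0 unfolding nP nQ by (simp add: ennreal_mult ex_def)
    \<comment> \<open>Needed to return from extended nonnegative reals to reals: \<open>K\<close>
      plus the integral must not be truncated at 0.\<close>
    moreover have "- K \<le> (\<integral>p. U p \<partial>?Q)" using Q.abs_expectation_le[of U K] QK by (simp add: abs_le_iff)
    ultimately show ?thesis using K0 by (simp flip: ennreal_plus add: ex_def)
  qed
  have "\<bar>(\<integral>p. W p \<partial>?P) - (\<integral>p. W p \<partial>?Q)\<bar> \<le> 2 * K * ex"
  proof -
    have "(\<integral>p. - W p \<partial>?P) \<le> (\<integral>p. - W p \<partial>?Q) + 2 * K * ex"
      using W K by (intro one_sided) auto
    then show ?thesis using one_sided[OF W K] by simp
  qed
  then have "ennreal \<bar>(\<integral>p. W p \<partial>?P) - (\<integral>p. W p \<partial>?Q)\<bar> \<le> ennreal (2 * K) * ennreal ex"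
    using K0 by (simp flip: ennreal_mult' add: ennreal_leI)
  also have "\<dots> \<le> ennreal (2 * K) * (\<Sum>l\<in>{0..?H}. exit_prob M D \<pi> x l)"
    by (intro mult_left_mono ex_sum) simp
  finally show ?thesis .
qed

end

subsection \<open>Error bounds\<close>

text \<open>The bound \<open>K\<close> does not enter the estimate. It guarantees that both families
  are bounded above, so that their real suprema are genuine ones.\<close>

lemma abs_cSUP_diff_le:
  fixes f g :: "'a \<Rightarrow> real"
  assumes ne: "A \<noteq> {}" and g: "\<And>a. a \<in> A \<Longrightarrow> \<bar>g a\<bar> \<le> K" and fg: "\<And>a. a \<in> A \<Longrightarrow> \<bar>f a - g a\<bar> \<le> c"
  shows "\<bar>(SUP a\<in>A. f a) - (SUP a\<in>A. g a)\<bar> \<le> c"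
proof -
  have bg: "bdd_above (g ` A)" using g by (intro bdd_aboveI2[of _ _ K]) (meson abs_le_D1)
  have bf: "bdd_above (f ` A)"
  proof (rule bdd_aboveI2)
    show "f a \<le> K + c" if "a \<in> A" for a using g[OF that] fg[OF that] by linarith
  qed
  have "(SUP a\<in>A. f a) \<le> (SUP a\<in>A. g a) + c"
  proof (rule cSUP_least[OF ne])
    fix a assume a: "a \<in> A"
    show "f a \<le> (SUP a\<in>A. g a) + c" using cSUP_upper[OF a bg] fg[OF a] by linarith
  qed
  moreover have "(SUP a\<in>A. g a) \<le> (SUP a\<in>A. f a) + c"
  proof (rule cSUP_least[OF ne])
    fix a assume a: "a \<in> A"
    show "g a \<le> (SUP a\<in>A. f a) + c" using cSUP_upper[OF a bf] fg[OF a] by linarith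
  qed
  ultimately show ?thesis by linarith
qed

text \<open>\<open>edist\<close> compares only the first \<open>sdim M\<close> coordinates. It
  separates points of \<open>X\<close> because vectors in the underlying space are extensional, that
  is, fixed outside these coordinates.\<close>

lemma metric_space_sa_dist:
  assumes X: "X \<subseteq> space (leb (sdim M))" and A: "Metric_space A (adist M)"
  shows "Metric_space (X \<times> A) (sa_dist M)"
proof
  interpret A: Metric_space A "adist M" by fact
  let ?e = "edist (sdim M)"
  have e0: "0 \<le> ?e x y" for x y by (simp add: edist_def)
  have ec: "?e x y = ?e y x" for x y
    unfolding edist_def L2_set_def by (simp add: power2_commute)
  have et: "?e x z \<le> ?e x y + ?e y z" for x y z
    using L2_set_triangle_ineq[of "\<lambda>i. x i - y i" "\<lambda>i. y i - z i" "{..<sdim M}"] by (simp add: edist_def)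
  have ez: "?e x y = 0 \<longleftrightarrow> x = y" if "x \<in> X" "y \<in> X" for x y
  proof
    assume "?e x y = 0"
    then have "\<forall>i<sdim M. x i = y i" by (auto simp: edist_def L2_set_eq_0_iff)
    moreover have "x \<in> extensional {..<sdim M}" "y \<in> extensional {..<sdim M}"
      using that X by (auto simp: space_PiM PiE_def)
    ultimately show "x = y" by (intro extensionalityI[of _ "{..<sdim M}"]) auto
  qed (simp add: edist_def L2_set_eq_0_iff)
  show "0 \<le> sa_dist M p q" for p q by (simp add: sa_dist_def split_def e0)
  show "sa_dist M p q = sa_dist M q p" for p q by (simp add: sa_dist_def split_def ec A.commute)
  show "sa_dist M p q = 0 \<longleftrightarrow> p = q" if "p \<in> X \<times> A" "q \<in> X \<times> A" for p q
    using that e0[of "fst p" "fst q"] A.nonneg[of "snd p" "snd q"] ez[of "fst p" "fst q"] A.zero[of "snd p" "snd q"]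
    by (auto simp: sa_dist_def split_def add_nonneg_eq_0_iff prod_eq_iff)
  show "sa_dist M p r \<le> sa_dist M p q + sa_dist M q r" if "p \<in> X \<times> A" "q \<in> X \<times> A" "r \<in> X \<times> A" for p q r
    using that et[of "fst p" "fst r" "fst q"] A.triangle[of "snd p" "snd q" "snd r"]
    by (auto simp: sa_dist_def split_def)
qed

context valid_mdp
begin

lemma value_fun_bounded:
  assumes reg: "regular_mdp M" and ne: "actions M \<noteq> {}"
    and R: "\<And>h s a. h < horizon M \<Longrightarrow> s \<in> states M \<Longrightarrow> a \<in> actions M \<Longrightarrow> \<bar>reward M h s a\<bar> \<le> G"
    and F: "\<And>s. s \<in> states M \<Longrightarrow> \<bar>terminal M s\<bar> \<le> G"
    and "h \<le> horizon M" "x \<in> states M"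
  shows "\<bar>value_fun M h x\<bar> \<le> real (horizon M - h + 1) * G"
  using assms(5,6)
proof (induction h arbitrary: x rule: inc_induct)
  case base
  then show ?case using reg F by (simp add: regular_mdp_def)
next
  case (step h)
  let ?K = "real (horizon M - Suc h + 1) * G"
  define f where "f a = reward M h x a + (\<integral>y. value_fun M (Suc h) y \<partial>trans_kernel M (Suc h) x a)" for a
  have V: "value_fun M h x = (SUP a\<in>actions M. f a)"
    using reg step unfolding regular_mdp_def f_def by blast
  have f: "\<bar>f a\<bar> \<le> G + ?K" if a: "a \<in> actions M" for a
  proof -
    interpret K: prob_space "trans_kernel M (Suc h) x a"
      using step a by (intro prob_space_trans_kernel) auto
    have b: "\<bar>value_fun M (Suc h) y\<bar> \<le> ?K" if "y \<in> space (trans_kernel M (Suc h) x a)" for y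
      using step.IH that by (simp add: space_trans_kernel)
    show ?thesis using K.abs_expectation_le[of "value_fun M (Suc h)", OF b] R[of h x a] step a unfolding f_def by linarith
  qed
  have "\<bar>SUP a\<in>actions M. f a\<bar> \<le> G + ?K"
    using abs_cSUP_diff_le[OF ne, of "\<lambda>_. 0" 0 f "G + ?K"] f ne by simp
  moreover have "horizon M - h = Suc (horizon M - Suc h)" using step by simp
  ultimately show ?case unfolding V by (simp add: algebra_simps)
qed

end

context reflection
begin

section \<open>Reflection error of the value function\<close>

lemma policies_restrict: "\<pi> \<in> policies M \<Longrightarrow> \<pi> \<in> policies MD"
  unfolding policies_def using measurable_compose[OF ident_reflected] by auto

text \<open>The comparison of path laws asks for agreement on \<open>D\<close> only, so off
  \<open>D\<close> any fixed action will do, and measurability is immediate.\<close>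

lemma policies_extend:
  assumes \<pi>: "\<pi> \<in> policies MD" and a: "a \<in> actions M"
  shows "(\<lambda>t x. if x \<in> D then \<pi> t x else return (actionM M) a) \<in> policies M"
proof -
  have "(\<lambda>x. if x \<in> D then \<pi> t x else return (actionM M) a) \<in> stateM M \<rightarrow>\<^sub>M prob_algebra (actionM M)"
    if "t < horizon M" for t
  proof -
    have "D \<inter> space (stateM M) \<in> sets (stateM M)" using D_sets_stateM by auto
    moreover have "return (actionM M) a \<in> space (prob_algebra (actionM M))"
      using a by (auto simp: space_prob_algebra space_actionM intro: prob_space_return)
    moreover have "\<pi> t \<in> restrict_space (stateM M) D \<rightarrow>\<^sub>M prob_algebra (actionM M)"
      using \<pi> that by (simp add: policies_def flip: stateM_reflected(2))
    ultimately show ?thesis by (simp add: measurable_restrict_space_iff)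
  qed
  then show ?thesis by (simp add: policies_def)
qed

lemma exit_prob_le_1: "\<pi> \<in> policies M \<Longrightarrow> x \<in> states M \<Longrightarrow> exit_prob M D \<pi> x l \<le> 1"
  using prob_space_path_law[of \<pi> x 0 "horizon M"] unfolding exit_prob_def Let_def
  by (intro prob_space.measure_le_1) auto

text \<open>This works with the definition of the value function as a supremum over policies, not
  with the Bellman equations. Restricting policies to \<open>D\<close> gives one inequality between
  the suprema and extending them gives the other. The constant arises from
  \<open>2 * (H + 1) * G \<le> 4 * H * G\<close>, as \<open>H \<ge> 1\<close>.\<close>

lemma reflected_value_close:
  assumes reg: "regular_mdp M" and G: "0 < G"
    and R: "\<And>h s a. h < horizon M \<Longrightarrow> s \<in> states M \<Longrightarrow> a \<in> actions M \<Longrightarrow> \<bar>reward M h s a\<bar> \<le> G"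
    and F: "\<And>s. s \<in> states M \<Longrightarrow> \<bar>terminal M s\<bar> \<le> G"
    and x: "x \<in> D"
  shows "ennreal \<bar>value_fun MD 0 x - value_fun M 0 x\<bar> \<le> ennreal (4 * real (horizon M) * G) *
    (\<Sum>l\<in>{0..horizon M}. SUP \<pi>\<in>policies M. exit_prob M D \<pi> x l)"
proof -
  let ?H = "horizon M"
  define K where "K = real (?H + 1) * G"
  have K0: "0 \<le> K" using G by (simp add: K_def)
  have K4: "2 * K \<le> 4 * real ?H * G"
    using horizon_pos G by (simp add: K_def)
  have xM: "x \<in> states M" using x D_subset by auto
  define W where "W p = (\<Sum>t\<in>{0..<?H}. reward M t (fst p t) (snd p t)) + terminal M (fst p ?H)" for p
  have W: "W \<in> borel_measurable (pathM M 0 ?H)"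
    unfolding W_def[abs_def]
  proof (intro borel_measurable_add borel_measurable_sum)
    fix t assume t: "t \<in> {0..<?H}"
    then have "(\<lambda>p. (fst p t, snd p t)) \<in> pathM M 0 ?H \<rightarrow>\<^sub>M stateM M \<Otimes>\<^sub>M actionM M"
      by (intro measurable_Pair path_state_measurable path_action_measurable) auto
    moreover have "(\<lambda>(x, a). reward M t x a) \<in> borel_measurable (stateM M \<Otimes>\<^sub>M actionM M)"
      using reg t by (simp add: regular_mdp_def)
    ultimately show "(\<lambda>p. reward M t (fst p t) (snd p t)) \<in> borel_measurable (pathM M 0 ?H)"
      by (auto dest: measurable_compose)
  next
    have "terminal M \<in> borel_measurable (stateM M)" using reg by (simp add: regular_mdp_def)
    then show "(\<lambda>p. terminal M (fst p ?H)) \<in> borel_measurable (pathM M 0 ?H)"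
      by (intro measurable_compose[OF path_state_measurable]) auto
  qed
  have WK: "\<bar>W p\<bar> \<le> K" if p: "p \<in> space (pathM M 0 ?H)" for p
  proof -
    have "\<bar>\<Sum>t\<in>{0..<?H}. reward M t (fst p t) (snd p t)\<bar> \<le> (\<Sum>t\<in>{0..<?H}. G)"
      using R space_pathM_state[OF p] space_pathM_action[OF p]
      by (intro order_trans[OF sum_abs] sum_mono) auto
    moreover have "\<bar>terminal M (fst p ?H)\<bar> \<le> G" using F space_pathM_state[OF p] by auto
    ultimately have "\<bar>W p\<bar> \<le> real ?H * G + G"
      unfolding W_def by (intro order_trans[OF abs_triangle_ineq] add_mono) auto
    then show ?thesis by (simp add: K_def distrib_right)
  qed
  define J where "J \<pi> = (\<integral>p. W p \<partial>path_law M \<pi> 0 x ?H)" for \<pi>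
  define J' where "J' \<pi> = (\<integral>p. W p \<partial>path_law MD \<pi> 0 x ?H)" for \<pi>
  have V: "value_fun M 0 x = (SUP \<pi>\<in>policies M. J \<pi>)" "value_fun MD 0 x = (SUP \<pi>\<in>policies MD. J' \<pi>)"
    by (simp_all add: value_fun_def J_def J'_def W_def split_def)
  have JK: "J \<pi> \<le> K" if "\<pi> \<in> policies M" for \<pi>
    using prob_space.abs_expectation_le[OF prob_space_path_law[OF that xM, of 0 ?H], of W K] WK
      sets_eq_imp_space_eq[OF sets_path_law[OF that xM, of 0 ?H]] unfolding J_def by (simp add: abs_le_iff)
  have J'K: "J' \<pi> \<le> K" if "\<pi> \<in> policies MD" for \<pi>
    using prob_space.abs_expectation_le[OF refl.prob_space_path_law[OF that, of x 0 ?H], of W K] WK x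
      measurable_space[OF path_ident_measurable, of _ 0 ?H]
      sets_eq_imp_space_eq[OF refl.sets_path_law[OF that, of x 0 ?H]] unfolding J'_def by (simp add: abs_le_iff)
  have bdd: "bdd_above (J ` policies M)" "bdd_above (J' ` policies MD)"
    using JK J'K by (auto intro!: bdd_aboveI2[of _ _ K])
  \<comment> \<open>Each exit probability is at most 1, so the sum is finite and the two
    inequalities can be proved in real arithmetic.\<close>
  define X where "X = (\<Sum>l\<in>{0..?H}. SUP \<pi>\<in>policies M. exit_prob M D \<pi> x l)"
  have "X \<le> (\<Sum>l\<in>{0..?H}. 1)"
    unfolding X_def using exit_prob_le_1[OF _ xM] by (intro sum_mono SUP_least) auto
  then have "X \<noteq> \<infinity>" by (auto simp: top_unique)
  then obtain \<xi> where \<xi>: "X = ennreal \<xi>" "0 \<le> \<xi>" by (cases X) auto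
  have close: "\<bar>J \<pi> - J' \<pi>'\<bar> \<le> 2 * K * \<xi>"
    if \<pi>: "\<pi> \<in> policies M" "\<pi>' \<in> policies MD" "\<And>t x. t < ?H \<Longrightarrow> x \<in> D \<Longrightarrow> \<pi>' t x = \<pi> t x" for \<pi> \<pi>'
  proof -
    have "ennreal \<bar>J \<pi> - J' \<pi>'\<bar> \<le> ennreal (2 * K) * (\<Sum>l\<in>{0..?H}. exit_prob M D \<pi> x l)"
      unfolding J_def J'_def by (rule reflected_expectation_close[OF \<pi> x W WK])
    also have "\<dots> \<le> ennreal (2 * K) * X"
      unfolding X_def using \<pi>(1) by (intro mult_left_mono sum_mono SUP_upper) auto
    also have "\<dots> = ennreal (2 * K * \<xi>)" using K0 \<xi> by (simp add: ennreal_mult)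
    finally show ?thesis using K0 \<xi> by simp
  qed
  obtain a where a: "a \<in> actions M" using actions_ne by blast
  have ne: "policies M \<noteq> {}" using const_policy[of "\<lambda>_. a"] a by blast
  have "value_fun M 0 x \<le> value_fun MD 0 x + 2 * K * \<xi>"
    unfolding V(1)
  proof (rule cSUP_least[OF ne])
    fix \<pi> assume \<pi>: "\<pi> \<in> policies M"
    show "J \<pi> \<le> value_fun MD 0 x + 2 * K * \<xi>"
      using close[OF \<pi> policies_restrict[OF \<pi>]] cSUP_upper[OF policies_restrict[OF \<pi>] bdd(2)] V(2) by force
  qed
  moreover have "value_fun MD 0 x \<le> value_fun M 0 x + 2 * K * \<xi>"
    unfolding V(2)
  proof (rule cSUP_least)
    show "policies MD \<noteq> {}" using ne policies_restrict by blast
    fix \<pi> assume \<pi>: "\<pi> \<in> policies MD"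
    note e = policies_extend[OF \<pi> a]
    show "J' \<pi> \<le> value_fun M 0 x + 2 * K * \<xi>"
      using close[OF e \<pi>] cSUP_upper[OF e bdd(1)] V(1) by force
  qed
  ultimately have "\<bar>value_fun MD 0 x - value_fun M 0 x\<bar> \<le> 2 * K * \<xi>" by linarith
  also have "\<dots> \<le> 4 * real ?H * G * \<xi>" using K4 \<xi> by (intro mult_right_mono) auto
  finally have "ennreal \<bar>value_fun MD 0 x - value_fun M 0 x\<bar> \<le> ennreal (4 * real ?H * G * \<xi>)" by (rule ennreal_leI)
  also have "\<dots> = ennreal (4 * real ?H * G) * X" using \<xi> G by (simp add: ennreal_mult)
  finally show ?thesis by (simp add: X_def)
qed

section \<open>Mesh error of one step and its propagation\<close>

abbreviation entropy_term :: ennreal where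
  "entropy_term \<equiv> ennreal (112 * L / \<delta>') * dudley (D \<times> actions M) (sa_dist M) + ennreal (16 * (\<Lambda> / \<delta>) + 8 * (\<Lambda> / \<delta>)\<^sup>2)"

text \<open>All properties of one time step, at a fixed sample point, that the backward induction
  uses. The quantifiers over states and actions stand inside, so one null set per time step serves
  the whole uncountable family.\<close>

definition mesh_step_within ::
  "(nat \<Rightarrow> vec) \<Rightarrow> nat \<Rightarrow> (vec \<Rightarrow> real) \<Rightarrow> (nat \<Rightarrow> nat \<Rightarrow> vec) \<Rightarrow> nat \<Rightarrow> ennreal \<Rightarrow> bool"
where
  "mesh_step_within b N V \<omega> h e \<longleftrightarrow> (\<forall>x\<in>D. \<forall>a\<in>actions M.
       (\<forall>n\<in>{1..N}. 0 \<le> mesh_weight MD b N \<omega> h n x a) \<and> (\<Sum>n\<in>{1..N}. mesh_weight MD b N \<omega> h n x a) = 1 \<and>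
       ennreal \<bar>(\<Sum>n\<in>{1..N}. V (\<omega> n (Suc h)) * mesh_weight MD b N \<omega> h n x a) -
         (\<integral>y. V y \<partial>trans_kernel MD (Suc h) x a)\<bar> \<le> e)"

lemma trajectories:
  fixes x0 :: vec and b :: "nat \<Rightarrow> vec"
  assumes "x0 \<in> D" "\<And>t. t < horizon M \<Longrightarrow> b t \<in> actions M"
  defines "Q \<equiv> path_law MD (\<lambda>t _. return (actionM M) (b t)) 0 x0 (horizon M)"
  shows "fst \<in> Q \<rightarrow>\<^sub>M Pi\<^sub>M {0..horizon M} (\<lambda>_. stateM MD)"
    "prob_space (distr Q (Pi\<^sub>M {0..horizon M} (\<lambda>_. stateM MD)) fst)"
proof -
  have \<pi>: "(\<lambda>t _. return (actionM M) (b t)) \<in> policies MD" using refl.const_policy[of b] assms(2) by simp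
  then have sets: "sets Q = sets (pathM MD 0 (horizon M))"
    unfolding Q_def using refl.sets_path_law assms(1) by simp
  show fst: "fst \<in> Q \<rightarrow>\<^sub>M Pi\<^sub>M {0..horizon M} (\<lambda>_. stateM MD)"
    unfolding measurable_cong_sets[OF sets refl] pathM_def by simp
  have "prob_space Q" unfolding Q_def using refl.prob_space_path_law[OF \<pi>] assms(1) by simp
  then show "prob_space (distr Q (Pi\<^sub>M {0..horizon M} (\<lambda>_. stateM MD)) fst)"
    by (rule prob_space.prob_space_distr[OF _ fst])
qed

text \<open>Importance sampling is applied twice, to \<open>V\<close> for the numerator of the
  weighted sum and to the constant one for its normalisation; the second error is multiplied by the
  bound \<open>K\<close> for the weighted average. Hence the factor \<open>2 * K\<close>.\<close>

lemma mesh_step_error: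
  fixes x0 :: vec and b :: "nat \<Rightarrow> vec"
  assumes fin: "dudley (D \<times> actions M) (sa_dist M) < \<infinity>"
    and x0: "x0 \<in> D" and b: "\<And>t. t < horizon M \<Longrightarrow> b t \<in> actions M"
    and N: "2 \<le> N" and h: "h < horizon M"
    and V: "V \<in> borel_measurable (stateM MD)" "\<And>y. y \<in> D \<Longrightarrow> \<bar>V y\<bar> \<le> K" and K: "0 < K"
  obtains \<eta> where "\<eta> \<in> borel_measurable (mesh_law MD b x0 N)"
    "(\<integral>\<^sup>+\<omega>. \<eta> \<omega> \<partial>mesh_law MD b x0 N) \<le> ennreal (2 * K / sqrt N) *
       entropy_term"
    "AE \<omega> in mesh_law MD b x0 N. mesh_step_within b N V \<omega> h (\<eta> \<omega>)"
proof -
  let ?H = "horizon M" and ?S = "stateM MD" and ?q = "dens MD (Suc h)"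
  let ?\<pi> = "\<lambda>t _. return (actionM M) (b t)"
  define P where "P = distr (path_law MD ?\<pi> 0 x0 ?H) (Pi\<^sub>M {0..?H} (\<lambda>_. ?S)) fst"
  have mesh: "mesh_law MD b x0 N = Pi\<^sub>M {1..N} (\<lambda>_. P)" by (simp add: mesh_law_def P_def)
  have b': "b t \<in> actions MD" if "t < horizon MD" for t using b that by simp
  note fst = trajectories(1)[of x0 b, OF x0 b] and prob = trajectories(2)[of x0 b, OF x0 b, folded P_def]
  have Suc_h: "Suc h \<in> {1..horizon M}" using h by simp
  have X: "(\<lambda>w. w h) \<in> P \<rightarrow>\<^sub>M ?S" "(\<lambda>w. w (Suc h)) \<in> P \<rightarrow>\<^sub>M ?S"
    unfolding P_def measurable_distr_eq1 using h by (auto intro!: measurable_component_singleton)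
  have q_meas: "(\<lambda>(s, y). ?q a s y) \<in> borel_measurable (?S \<Otimes>\<^sub>M ?S)" if a: "a \<in> actions M" for a
  proof -
    have "(\<lambda>p. ((fst p, a), snd p)) \<in> ?S \<Otimes>\<^sub>M ?S \<rightarrow>\<^sub>M (?S \<Otimes>\<^sub>M actionM MD) \<Otimes>\<^sub>M ?S"
      using a by (intro measurable_Pair measurable_fst measurable_snd measurable_const) (simp add: space_actionM)
    from measurable_compose[OF this refl.dens_measurable[of "Suc h"]] show ?thesis using h by (simp add: split_def)
  qed
  have \<delta>': "0 < \<delta>'" using \<delta>'_ge const_pos by simp
  have \<Lambda>\<delta>: "2 * \<Lambda> / \<delta> * \<delta>' / \<delta>' = 2 * (\<Lambda> / \<delta>)" using \<delta>' by simp
  interpret fm: finite_measure ?S by (rule finite_measure_stateM_reflected)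
  interpret P: prob_space P by (rule prob)
  interpret ms: mesh_step ?S P "\<lambda>w. w h" "\<lambda>w. w (Suc h)" "\<lambda>s y. ?q (b h) s y" \<delta>' "2 * \<Lambda> / \<delta> * \<delta>'" N
  proof
    show "(\<lambda>w. w h) \<in> P \<rightarrow>\<^sub>M ?S" "(\<lambda>w. w (Suc h)) \<in> P \<rightarrow>\<^sub>M ?S" by (rule X)+
    show "(\<lambda>(s, y). ?q (b h) s y) \<in> borel_measurable (?S \<Otimes>\<^sub>M ?S)" using q_meas b h by blast
    show "0 < \<delta>'" by (rule \<delta>')
    show "\<delta>' \<le> ?q (b h) s y \<and> ?q (b h) s y \<le> 2 * \<Lambda> / \<delta> * \<delta>'" if "s \<in> space ?S" "y \<in> space ?S" for s y
      using reflected_bounds[OF Suc_h b[OF h]] that by (simp add: space_stateM_reflected)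
    show "(\<integral>\<^sup>+y. ennreal (?q (b h) s y) \<partial>?S) = 1" if "s \<in> space ?S" for s
      using refl.nn_integral_dens_stateM[of "Suc h" s "b h"] that b h by (simp add: space_stateM_reflected)
    show "2 \<le> N" by (rule N)
    fix \<Phi> :: "vec \<times> vec \<Rightarrow> ennreal" assume \<Phi>: "\<Phi> \<in> borel_measurable (?S \<Otimes>\<^sub>M ?S)"
    have m1: "(\<lambda>w. \<Phi> (w h, w (Suc h))) \<in> borel_measurable (Pi\<^sub>M {0..?H} (\<lambda>_. ?S))"
    proof -
      have "(\<lambda>w. (w h, w (Suc h))) \<in> Pi\<^sub>M {0..?H} (\<lambda>_. ?S) \<rightarrow>\<^sub>M ?S \<Otimes>\<^sub>M ?S"
        using h by (intro measurable_Pair measurable_component_singleton) auto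
      from measurable_compose[OF this \<Phi>] show ?thesis .
    qed
    have m2: "(\<lambda>w. \<integral>\<^sup>+y. \<Phi> (w h, y) * ennreal (?q (b h) (w h) y) \<partial>?S) \<in> borel_measurable (Pi\<^sub>M {0..?H} (\<lambda>_. ?S))"
    proof -
      have "(\<lambda>(x, y). \<Phi> (x, y) * ennreal (?q (b h) x y)) \<in> borel_measurable (?S \<Otimes>\<^sub>M ?S)"
        using q_meas[OF b[OF h]] \<Phi> by (auto simp: split_def intro!: borel_measurable_times_ennreal)
      then have "(\<lambda>x. \<integral>\<^sup>+y. \<Phi> (x, y) * ennreal (?q (b h) x y) \<partial>?S) \<in> borel_measurable ?S"
        by (rule fm.borel_measurable_nn_integral)
      moreover have "(\<lambda>w. w h) \<in> Pi\<^sub>M {0..?H} (\<lambda>_. ?S) \<rightarrow>\<^sub>M ?S" using h by (intro measurable_component_singleton) auto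
      ultimately show ?thesis by (rule measurable_compose[rotated])
    qed
    show "(\<integral>\<^sup>+w. \<Phi> (w h, w (Suc h)) \<partial>P) = (\<integral>\<^sup>+w. \<integral>\<^sup>+y. \<Phi> (w h, y) * ennreal (?q (b h) (w h) y) \<partial>?S \<partial>P)"
      unfolding P_def using refl.markov_property[of b x0 h \<Phi>, OF b'] x0 h \<Phi> m1 m2
      by (simp add: nn_integral_distr[OF fst])
  qed
  obtain E where E: "E \<in> sets ?S" "AE y in ?S. y \<in> E"
    "\<And>a1 a2 x1 x2 y. a1 \<in> actions M \<Longrightarrow> a2 \<in> actions M \<Longrightarrow> x1 \<in> D \<Longrightarrow> x2 \<in> D \<Longrightarrow> y \<in> E \<Longrightarrow>
      \<bar>?q a1 x1 y - ?q a2 x2 y\<bar> \<le> L * (edist d x1 x2 + adist M a1 a2)"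
    using reflected_lipschitz Suc_h by metis
  have ED: "E \<subseteq> D" using sets.sets_into_space[OF E(1)] by (simp add: space_stateM_reflected)
  have ms: "Metric_space (D \<times> actions M) (sa_dist M)"
    using M D_space by (intro metric_space_sa_dist) (auto simp: is_mdp_def)
  interpret T: Metric_space "D \<times> actions M" "sa_dist M" by (rule ms)
  have t0: "(x0, b h) \<in> D \<times> actions M" using x0 b h by simp
  \<comment> \<open>The Lipschitz bound holds on \<open>E\<close> only; the cutoff extends it to all \<open>y\<close> and changes no integral.\<close>
  define \<theta> where "\<theta> t y = indicator E y * ?q (snd t) (fst t) y" for t y
  have q_sec: "?q a x \<in> borel_measurable ?S" if "x \<in> D" "a \<in> actions M" for x a
    using refl.dens_section[of "Suc h" x a] that h by simp
  have \<theta>_meas: "\<theta> t \<in> borel_measurable ?S" if "t \<in> D \<times> actions M" for t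
    unfolding \<theta>_def[abs_def] using q_sec E(1) that by (intro borel_measurable_times borel_measurable_indicator) auto
  have q_bd: "0 \<le> ?q a x y" "0 < ?q a x y" "?q a x y \<le> 2 * \<Lambda> / \<delta> * \<delta>'" if "x \<in> D" "a \<in> actions M" "y \<in> D" for x a y
    using reflected_bounds[OF Suc_h that(2,1,3)] \<delta>' by linarith+
  have \<theta>_bd: "0 \<le> \<theta> t y \<and> \<theta> t y \<le> 2 * \<Lambda> / \<delta> * \<delta>'" if "t \<in> D \<times> actions M" "y \<in> space ?S" for t y
    using that q_bd[of "fst t" "snd t" y] const_pos \<delta>' by (auto simp: \<theta>_def indicator_def space_stateM_reflected)
  have \<theta>_int: "(\<integral>y. \<theta> t y * g y \<partial>?S) = (\<integral>y. g y \<partial>trans_kernel MD (Suc h) (fst t) (snd t))"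
    if t: "t \<in> D \<times> actions M" and g: "g \<in> borel_measurable ?S" for t g
  proof -
    have "(\<integral>y. g y \<partial>trans_kernel MD (Suc h) (fst t) (snd t)) = (\<integral>y. ?q (snd t) (fst t) y * g y \<partial>?S)"
      unfolding trans_kernel_def using t g q_sec q_bd
      by (subst integral_density) (auto intro!: AE_I2 simp: space_stateM_reflected)
    also have "\<dots> = (\<integral>y. \<theta> t y * g y \<partial>?S)"
    proof (rule integral_cong_AE)
      show "(\<lambda>y. ?q (snd t) (fst t) y * g y) \<in> borel_measurable ?S"
        using g q_sec t by (intro borel_measurable_times) auto
      show "(\<lambda>y. \<theta> t y * g y) \<in> borel_measurable ?S"
        using g \<theta>_meas[OF t] by (rule borel_measurable_times[rotated])
      show "AE y in ?S. ?q (snd t) (fst t) y * g y = \<theta> t y * g y"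
        using E(2) by eventually_elim (simp add: \<theta>_def)
    qed
    finally show ?thesis by simp
  qed
  have \<theta>_1: "(\<integral>y. \<theta> t y \<partial>?S) = 1" if t: "t \<in> D \<times> actions M" for t
  proof -
    interpret K: prob_space "trans_kernel MD (Suc h) (fst t) (snd t)"
      using t h by (intro refl.prob_space_trans_kernel) auto
    show ?thesis using \<theta>_int[OF t, of "\<lambda>_. 1"] K.prob_space by simp
  qed
  have \<theta>_lip: "\<bar>\<theta> s y - \<theta> t y\<bar> \<le> L * sa_dist M s t" if "s \<in> D \<times> actions M" "t \<in> D \<times> actions M" for s t y
    using E(3)[of "snd s" "snd t" "fst s" "fst t" y] that const_pos T.nonneg[of s t]
    by (auto simp: \<theta>_def indicator_def sa_dist_def split_def)
  \<comment> \<open>The lower bound is now \<open>\<delta>'\<close> and the upper bound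
    \<open>2 * \<Lambda> / \<delta> * \<delta>'\<close>. Their quotient
    \<open>2 * \<Lambda> / \<delta>\<close> turns the coefficients 8 and 2 of the sampling bound
    into 16 and 8.\<close>
  have Zeq: "8 * (2 * \<Lambda> / \<delta> * \<delta>') / \<delta>' + 2 * (2 * \<Lambda> / \<delta> * \<delta>' / \<delta>')\<^sup>2 = 16 * (\<Lambda> / \<delta>) + 8 * (\<Lambda> / \<delta>)\<^sup>2"
    unfolding \<Lambda>\<delta> using \<delta>' by (simp add: power_mult_distrib power_divide)
  define err where "err g \<omega> t = (\<Sum>n\<in>{1..N}. \<theta> t (\<omega> n (Suc h)) * g (\<omega> n (Suc h)) / ms.den n (ms.pts \<omega>) (\<omega> n (Suc h)))
    - (\<integral>y. \<theta> t y * g y \<partial>?S)" for g \<omega> t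
  have majorant: "\<exists>B. B \<in> borel_measurable ms.samples \<and> (\<integral>\<^sup>+\<omega>. B \<omega> \<partial>ms.samples) \<le> ennreal (k / sqrt N) * entropy_term \<and>
      (\<forall>\<omega> t. \<omega> \<in> space ms.samples \<longrightarrow> t \<in> D \<times> actions M \<longrightarrow>
       ennreal \<bar>err g \<omega> t\<bar> \<le> B \<omega>)"
    if g: "g \<in> borel_measurable ?S" "\<And>y. y \<in> space ?S \<Longrightarrow> \<bar>g y\<bar> \<le> k" "0 < k" for g k
    unfolding err_def
    by (rule ms.importance_sampling_uniform[OF ms t0 fin \<theta>_meas \<theta>_bd \<theta>_1 \<theta>_lip const_pos(3) g, unfolded Zeq])
      (simp_all, blast)
  obtain B where B: "B \<in> borel_measurable ms.samples" "(\<integral>\<^sup>+\<omega>. B \<omega> \<partial>ms.samples) \<le> ennreal (K / sqrt N) * entropy_term"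
    "\<And>\<omega> t. \<omega> \<in> space ms.samples \<Longrightarrow> t \<in> D \<times> actions M \<Longrightarrow>
       ennreal \<bar>err V \<omega> t\<bar> \<le> B \<omega>"
    using majorant[of V K] V K unfolding space_stateM_reflected by blast
  obtain B1 where B1: "B1 \<in> borel_measurable ms.samples" "(\<integral>\<^sup>+\<omega>. B1 \<omega> \<partial>ms.samples) \<le> ennreal (1 / sqrt N) * entropy_term"
    "\<And>\<omega> t. \<omega> \<in> space ms.samples \<Longrightarrow> t \<in> D \<times> actions M \<Longrightarrow>
       ennreal \<bar>err (\<lambda>_. 1) \<omega> t\<bar> \<le> B1 \<omega>"
    using majorant[of "\<lambda>_. 1" 1] by auto
  \<comment> \<open>The next state has a density with respect to the measure for which
    \<open>E\<close> has full measure; the Markov identity for the indicator of the complement makes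
    this precise.\<close>
  have AE_P: "AE w in P. w (Suc h) \<in> E"
  proof -
    define \<Phi> :: "vec \<times> vec \<Rightarrow> ennreal" where "\<Phi> p = indicator (space ?S - E) (snd p)" for p
    have \<Phi>: "\<Phi> \<in> borel_measurable (?S \<Otimes>\<^sub>M ?S)"
      unfolding \<Phi>_def using E(1) by (intro measurable_compose[OF measurable_snd borel_measurable_indicator]) auto
    have "(\<integral>\<^sup>+w. \<Phi> (w h, w (Suc h)) \<partial>P) = (\<integral>\<^sup>+w. \<integral>\<^sup>+y. \<Phi> (w h, y) * ennreal (?q (b h) (w h) y) \<partial>?S \<partial>P)"
      by (rule ms.markov[OF \<Phi>])
    also have "\<dots> = (\<integral>\<^sup>+w. \<integral>\<^sup>+y. 0 \<partial>?S \<partial>P)"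
      using E(2) by (intro nn_integral_cong nn_integral_cong_AE) (auto simp: \<Phi>_def elim!: eventually_mono)
    finally have "(\<integral>\<^sup>+w. \<Phi> (w h, w (Suc h)) \<partial>P) = 0" by simp
    moreover have "(\<lambda>w. \<Phi> (w h, w (Suc h))) \<in> borel_measurable P"
      using measurable_compose[OF measurable_Pair[OF X] \<Phi>] .
    ultimately have "AE w in P. \<Phi> (w h, w (Suc h)) = 0" by (simp add: nn_integral_0_iff_AE)
    then show ?thesis
      using AE_space
    proof eventually_elim
      case (elim w)
      then show ?case using measurable_space[OF X(2), of w] by (auto simp: \<Phi>_def indicator_def split: if_splits)
    qed
  qed
  have AE_samples: "AE \<omega> in ms.samples. \<forall>n\<in>{1..N}. \<omega> n (Suc h) \<in> E"
    by (intro AE_finite_allI AE_PiM_component AE_P prob) auto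
  show thesis
  proof (rule that[of "\<lambda>\<omega>. B \<omega> + ennreal K * B1 \<omega>"])
    show "(\<lambda>\<omega>. B \<omega> + ennreal K * B1 \<omega>) \<in> borel_measurable (mesh_law MD b x0 N)"
      unfolding mesh using B(1) B1(1) by measurable
    have "(\<integral>\<^sup>+\<omega>. B \<omega> + ennreal K * B1 \<omega> \<partial>ms.samples) = (\<integral>\<^sup>+\<omega>. B \<omega> \<partial>ms.samples) + ennreal K * (\<integral>\<^sup>+\<omega>. B1 \<omega> \<partial>ms.samples)"
      using B(1) B1(1) by (simp add: nn_integral_add nn_integral_cmult)
    also have "\<dots> \<le> ennreal (K / sqrt N) * entropy_term + ennreal K * (ennreal (1 / sqrt N) * entropy_term)"
      using B(2) B1(2) by (intro add_mono mult_left_mono) auto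
    also have "\<dots> = (ennreal (K / sqrt N) + ennreal K * ennreal (1 / sqrt N)) * entropy_term"
      by (simp only: distrib_right mult.assoc)
    also have "ennreal (K / sqrt N) + ennreal K * ennreal (1 / sqrt N) = ennreal (2 * K / sqrt N)"
      using K by (simp flip: ennreal_mult ennreal_plus)
    finally show "(\<integral>\<^sup>+\<omega>. B \<omega> + ennreal K * B1 \<omega> \<partial>mesh_law MD b x0 N) \<le> ennreal (2 * K / sqrt N) * entropy_term"
      unfolding mesh .
    show "AE \<omega> in mesh_law MD b x0 N. mesh_step_within b N V \<omega> h (B \<omega> + ennreal K * B1 \<omega>)"
      using AE_samples AE_space unfolding mesh mesh_step_within_def
    proof (eventually_elim, intro ballI)
      fix \<omega> x a assume \<omega>E: "\<forall>n\<in>{1..N}. \<omega> n (Suc h) \<in> E" and \<omega>: "\<omega> \<in> space ms.samples"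
        and x: "x \<in> D" and a: "a \<in> actions M"
      let ?t = "(x, a)"
      have t: "?t \<in> D \<times> actions M" using x a by simp
      have yE: "\<omega> n (Suc h) \<in> E" "\<omega> n (Suc h) \<in> D" if "n \<in> {1..N}" for n using \<omega>E that ED by auto
      define r where "r n = \<theta> ?t (\<omega> n (Suc h)) / ms.den n (ms.pts \<omega>) (\<omega> n (Suc h))" for n
      define A where "A = (\<Sum>n\<in>{1..N}. r n)"
      define w where "w n = mesh_weight MD b N \<omega> h n x a" for n
      \<comment> \<open>On \<open>E\<close> the cutoff is invisible, so at the sampled points the
        terms of the estimator are exactly the ratios of the algorithm.\<close>
      have ratio: "mesh_ratio MD b N \<omega> h n x a = r n" if "n \<in> {1..N}" for n
        using yE[OF that] unfolding mesh_ratio_def r_def ms.den_def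
        by (auto simp: \<theta>_def intro!: arg_cong2[where f = "(/)"] sum.cong)
      have r0: "0 < r n" if n: "n \<in> {1..N}" for n
        using yE[OF n] q_bd(2)[OF x a yE(2)[OF n]] ms.den_pos[OF n ms.pts_space[OF \<omega>]]
        by (auto simp: r_def \<theta>_def space_stateM_reflected)
      have A0: "0 < A" unfolding A_def using N r0 by (intro sum_pos) auto
      have w: "w n = r n / A" if "n \<in> {1..N}" for n
        unfolding w_def mesh_weight_def A_def using ratio that by simp
      have w0: "0 \<le> w n" if "n \<in> {1..N}" for n using w[OF that] r0[OF that] A0 by simp
      have w1: "(\<Sum>n\<in>{1..N}. w n) = 1"
        using w A0 by (simp add: A_def flip: sum_divide_distrib)
      define SV where "SV = (\<Sum>n\<in>{1..N}. \<theta> ?t (\<omega> n (Suc h)) * V (\<omega> n (Suc h)) / ms.den n (ms.pts \<omega>) (\<omega> n (Suc h)))"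
      define U where "U = (\<Sum>n\<in>{1..N}. V (\<omega> n (Suc h)) * w n)"
      define I where "I = (\<integral>y. V y \<partial>trans_kernel MD (Suc h) x a)"
      have "U * A = (\<Sum>n\<in>{1..N}. V (\<omega> n (Suc h)) * r n)"
        unfolding U_def sum_distrib_right using w A0 by (intro sum.cong) auto
      also have "\<dots> = SV" unfolding SV_def r_def by (intro sum.cong) auto
      finally have UA: "U * A = SV" .
      have "\<bar>U\<bar> \<le> (\<Sum>n\<in>{1..N}. K * w n)"
        unfolding U_def using V(2)[OF yE(2)] w0
        by (intro order_trans[OF sum_abs] sum_mono) (auto simp: abs_mult intro!: mult_right_mono)
      also have "\<dots> = K" using w1 by (simp flip: sum_distrib_left)
      finally have UK: "\<bar>U\<bar> \<le> K" .
      have b1: "ennreal \<bar>SV - I\<bar> \<le> B \<omega>"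
        using B(3)[OF \<omega> t] \<theta>_int[OF t V(1)] by (simp add: SV_def I_def err_def)
      have b2: "ennreal \<bar>A - 1\<bar> \<le> B1 \<omega>"
        using B1(3)[OF \<omega> t] \<theta>_1[OF t] by (simp add: A_def r_def err_def)
      have "U - I = U * (1 - A) + (SV - I)" by (simp add: UA[symmetric] right_diff_distrib)
      then have "\<bar>U - I\<bar> \<le> \<bar>U\<bar> * \<bar>A - 1\<bar> + \<bar>SV - I\<bar>"
        using abs_triangle_ineq[of "U * (1 - A)" "SV - I"] by (simp add: abs_mult abs_minus_commute)
      also have "\<dots> \<le> K * \<bar>A - 1\<bar> + \<bar>SV - I\<bar>" using UK by (intro add_right_mono mult_right_mono) auto
      finally have "ennreal \<bar>U - I\<bar> \<le> ennreal (K * \<bar>A - 1\<bar> + \<bar>SV - I\<bar>)" by (rule ennreal_leI)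
      also have "\<dots> = ennreal K * ennreal \<bar>A - 1\<bar> + ennreal \<bar>SV - I\<bar>" using K by (simp add: ennreal_mult)
      also have "\<dots> \<le> ennreal K * B1 \<omega> + B \<omega>" using b1 b2 by (intro add_mono mult_left_mono) auto
      finally have "ennreal \<bar>U - I\<bar> \<le> B \<omega> + ennreal K * B1 \<omega>" by (simp add: add.commute)
      then show "(\<forall>n\<in>{1..N}. 0 \<le> mesh_weight MD b N \<omega> h n x a) \<and> (\<Sum>n\<in>{1..N}. mesh_weight MD b N \<omega> h n x a) = 1 \<and>
       ennreal \<bar>(\<Sum>n\<in>{1..N}. V (\<omega> n (Suc h)) * mesh_weight MD b N \<omega> h n x a) -
         (\<integral>y. V y \<partial>trans_kernel MD (Suc h) x a)\<bar> \<le> B \<omega> + ennreal K * B1 \<omega>"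
        using w0 w1 unfolding U_def I_def w_def by blast
    qed
  qed
qed

text \<open>A deterministic statement about one sample point: the one-step errors
  \<open>\<eta> h\<close> are plain numbers. Averaging with nonnegative weights of sum one does not
  enlarge the error inherited from time \<open>h + 1\<close>, so the errors simply add up.\<close>

lemma mesh_error_propagation:
  fixes \<eta> :: "nat \<Rightarrow> ennreal"
  assumes reg: "regular_mdp MD"
    and R: "\<And>h s a. h < horizon M \<Longrightarrow> s \<in> D \<Longrightarrow> a \<in> actions M \<Longrightarrow> \<bar>reward M h s a\<bar> \<le> G"
    and V: "\<And>h y. 0 < h \<Longrightarrow> h \<le> horizon M \<Longrightarrow> y \<in> D \<Longrightarrow> \<bar>value_fun MD h y\<bar> \<le> K"
    and \<omega>: "\<And>n h. n \<in> {1..N} \<Longrightarrow> h \<le> horizon M \<Longrightarrow> \<omega> n h \<in> D"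
    and step: "\<And>h. h < horizon M \<Longrightarrow> mesh_step_within b N (value_fun MD (Suc h)) \<omega> h (\<eta> h)"
    and "h \<le> horizon M" "x \<in> D"
  shows "ennreal \<bar>mesh_value MD b N \<omega> h x - value_fun MD h x\<bar> \<le> (\<Sum>j\<in>{h..<horizon M}. \<eta> j)"
  using assms(6,7)
proof (induction h arbitrary: x rule: inc_induct)
  case base
  then show ?case using reg by (simp add: mesh_value.simps regular_mdp_def)
next
  case (step h)
  define e where "e = (\<Sum>j\<in>{Suc h..<horizon M}. \<eta> j)"
  have sum: "(\<Sum>j\<in>{h..<horizon M}. \<eta> j) = \<eta> h + e"
    using step by (simp add: sum.atLeast_Suc_lessThan e_def)
  show ?case
  \<comment> \<open>With an infinite error the claim is trivial; otherwise the suprema can be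
    compared in the reals.\<close>
  proof (cases "\<eta> h = \<infinity> \<or> e = \<infinity>")
    case True
    then show ?thesis unfolding sum by auto
  next
    case False
    then obtain r1 r2 where r: "\<eta> h = ennreal r1" "0 \<le> r1" "e = ennreal r2" "0 \<le> r2"
      by (metis ennreal_cases infinity_ennreal_def)
    define f where "f a = reward M h x a + (\<Sum>n\<in>{1..N}. mesh_value MD b N \<omega> (Suc h) (\<omega> n (Suc h)) * mesh_weight MD b N \<omega> h n x a)" for a
    define g where "g a = reward M h x a + (\<integral>y. value_fun MD (Suc h) y \<partial>trans_kernel MD (Suc h) x a)" for a
    have f: "mesh_value MD b N \<omega> h x = (SUP a\<in>actions M. f a)"
      using step by (simp add: mesh_value.simps[of MD b N \<omega> h x] f_def)
    have g: "value_fun MD h x = (SUP a\<in>actions M. g a)"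
      using reg step unfolding regular_mdp_def g_def by simp
    have fg: "\<bar>f a - g a\<bar> \<le> r1 + r2" and gK: "\<bar>g a\<bar> \<le> G + (K + r1)" if a: "a \<in> actions M" for a
    proof -
      let ?w = "\<lambda>n. mesh_weight MD b N \<omega> h n x a"
      let ?mv = "\<lambda>n. mesh_value MD b N \<omega> (Suc h) (\<omega> n (Suc h))" and ?v = "\<lambda>n. value_fun MD (Suc h) (\<omega> n (Suc h))"
      let ?I = "\<integral>y. value_fun MD (Suc h) y \<partial>trans_kernel MD (Suc h) x a"
      have w: "0 \<le> ?w n" if "n \<in> {1..N}" for n using assms(5)[of h] step a that unfolding mesh_step_within_def by blast
      have w1: "(\<Sum>n\<in>{1..N}. ?w n) = 1" using assms(5)[of h] step a unfolding mesh_step_within_def by blast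
      have 1: "\<bar>(\<Sum>n\<in>{1..N}. ?v n * ?w n) - ?I\<bar> \<le> r1"
        using assms(5)[of h] step a r unfolding mesh_step_within_def by (simp add: r)
      have "\<bar>?mv n - ?v n\<bar> \<le> r2" if "n \<in> {1..N}" for n
        using step.IH[of "\<omega> n (Suc h)"] \<omega>[OF that] step.hyps r(4) unfolding e_def[symmetric] r(3) by simp
      then have "\<bar>\<Sum>n\<in>{1..N}. (?mv n - ?v n) * ?w n\<bar> \<le> (\<Sum>n\<in>{1..N}. r2 * ?w n)"
        using w by (intro order_trans[OF sum_abs] sum_mono) (auto simp: abs_mult intro!: mult_right_mono)
      also have "\<dots> = r2" using w1 by (simp flip: sum_distrib_left)
      finally have 2: "\<bar>(\<Sum>n\<in>{1..N}. ?mv n * ?w n) - (\<Sum>n\<in>{1..N}. ?v n * ?w n)\<bar> \<le> r2"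
        by (simp add: left_diff_distrib sum_subtractf)
      show "\<bar>f a - g a\<bar> \<le> r1 + r2" using 1 2 unfolding f_def g_def by linarith
      \<comment> \<open>The integral in \<open>g\<close> is bounded by way of the weighted sum, from
        which it differs by at most \<open>r1\<close>. The resulting bound only secures that the
        supremum is genuine.\<close>
      have "\<bar>\<Sum>n\<in>{1..N}. ?v n * ?w n\<bar> \<le> (\<Sum>n\<in>{1..N}. K * ?w n)"
        using w V[of "Suc h"] \<omega> step.hyps
        by (intro order_trans[OF sum_abs] sum_mono) (auto simp: abs_mult intro!: mult_right_mono)
      also have "\<dots> = K" using w1 by (simp flip: sum_distrib_left)
      finally show "\<bar>g a\<bar> \<le> G + (K + r1)" using 1 R[of h x a] step a unfolding g_def by linarith
    qed
    have "\<bar>mesh_value MD b N \<omega> h x - value_fun MD h x\<bar> \<le> r1 + r2"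
      unfolding f g by (rule abs_cSUP_diff_le[OF actions_ne gK fg])
    then show ?thesis unfolding sum using r by (simp flip: ennreal_plus add: ennreal_leI)
  qed
qed

text \<open>Only value functions at times \<open>h + 1 \<ge> 1\<close> are integrated. From there at
  most \<open>H - 1\<close> rewards and the terminal one remain, hence the bound
  \<open>K = H * G\<close>. The \<open>H\<close> steps contribute \<open>2 * K / sqrt N\<close>
  each, which gives the factor \<open>2 * H\<^sup>2 * G / sqrt N\<close>.\<close>

lemma mesh_error:
  fixes x0 :: vec and b :: "nat \<Rightarrow> vec"
  assumes fin: "dudley (D \<times> actions M) (sa_dist M) < \<infinity>"
    and reg: "regular_mdp MD" and G: "0 < G"
    and R: "\<And>h s a. h < horizon M \<Longrightarrow> s \<in> D \<Longrightarrow> a \<in> actions M \<Longrightarrow> \<bar>reward M h s a\<bar> \<le> G"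
    and F: "\<And>s. s \<in> D \<Longrightarrow> \<bar>terminal M s\<bar> \<le> G"
    and x0: "x0 \<in> D" and b: "\<And>t. t < horizon M \<Longrightarrow> b t \<in> actions M" and N: "2 \<le> N"
  shows "(\<integral>\<^sup>+\<omega>. ennreal \<bar>mesh_value MD b N \<omega> 0 x0 - value_fun M 0 x0\<bar> \<partial>mesh_law MD b x0 N)
    \<le> ennreal (2 * (real (horizon M))\<^sup>2 * G / sqrt N) *
         entropy_term
      + ennreal \<bar>value_fun MD 0 x0 - value_fun M 0 x0\<bar>"
proof -
  let ?v = "ennreal \<bar>value_fun MD 0 x0 - value_fun M 0 x0\<bar>"
  let ?H = "horizon M" and ?mesh = "mesh_law MD b x0 N"
  define K where "K = real ?H * G"
  have K: "0 < K" using G horizon_pos by (simp add: K_def)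
  have VK: "\<bar>value_fun MD h y\<bar> \<le> K" if "0 < h" "h \<le> ?H" "y \<in> D" for h y
  proof -
    have "\<bar>value_fun MD h y\<bar> \<le> real (?H - h + 1) * G"
      using refl.value_fun_bounded[OF reg, of G h y] actions_ne R F that by simp
    also have "\<dots> \<le> K" unfolding K_def using G that by (intro mult_right_mono) auto
    finally show ?thesis .
  qed
  have Vm: "value_fun MD h \<in> borel_measurable (stateM MD)" if "h \<le> ?H" for h
    using reg that by (simp add: regular_mdp_def)
  define majorant where "majorant h \<eta> \<longleftrightarrow> \<eta> \<in> borel_measurable ?mesh \<and>
      (\<integral>\<^sup>+\<omega>. \<eta> \<omega> \<partial>?mesh) \<le> ennreal (2 * K / sqrt N) * entropy_term \<and> (AE \<omega> in ?mesh. mesh_step_within b N (value_fun MD (Suc h)) \<omega> h (\<eta> \<omega>))" for h \<eta>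
  have ex: "\<exists>\<eta>. majorant h \<eta>" if h: "h < ?H" for h
  proof -
    have m: "value_fun MD (Suc h) \<in> borel_measurable (stateM MD)" using Vm h by simp
    have k: "\<bar>value_fun MD (Suc h) y\<bar> \<le> K" if "y \<in> D" for y using VK h that by simp
    show ?thesis
      by (rule mesh_step_error[where b = b, OF fin x0 b N h m k K]) (assumption, assumption, unfold majorant_def, rule exI, rule conjI, assumption, rule conjI)
  qed
  obtain \<eta> where \<eta>: "\<And>h. h < ?H \<Longrightarrow> \<eta> h \<in> borel_measurable ?mesh"
    "\<And>h. h < ?H \<Longrightarrow> (\<integral>\<^sup>+\<omega>. \<eta> h \<omega> \<partial>?mesh) \<le> ennreal (2 * K / sqrt N) * entropy_term"
    "\<And>h. h < ?H \<Longrightarrow> AE \<omega> in ?mesh. mesh_step_within b N (value_fun MD (Suc h)) \<omega> h (\<eta> h \<omega>)"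
  proof -
    obtain \<eta> where "majorant h (\<eta> h)" if "h < ?H" for h using ex by metis
    then show thesis using that unfolding majorant_def by blast
  qed
  have "AE \<omega> in ?mesh. \<forall>h\<in>{..<?H}. mesh_step_within b N (value_fun MD (Suc h)) \<omega> h (\<eta> h \<omega>)"
    using \<eta>(3) by (intro AE_finite_allI) auto
  then have AE: "AE \<omega> in ?mesh. ennreal \<bar>mesh_value MD b N \<omega> 0 x0 - value_fun M 0 x0\<bar>
      \<le> (\<Sum>j\<in>{0..<?H}. \<eta> j \<omega>) + ?v"
    using AE_space
  proof eventually_elim
    case (elim \<omega>)
    have \<omega>: "\<omega> n h \<in> D" if "n \<in> {1..N}" "h \<le> ?H" for n h
    proof -
      have "\<omega> n \<in> space (Pi\<^sub>M {0..?H} (\<lambda>_. stateM MD))"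
        using elim(2) that(1) by (auto simp: mesh_law_def space_PiM PiE_iff)
      then show ?thesis using that(2) by (auto simp: space_PiM PiE_iff space_stateM_reflected)
    qed
    have "ennreal \<bar>mesh_value MD b N \<omega> 0 x0 - value_fun MD 0 x0\<bar> \<le> (\<Sum>j\<in>{0..<?H}. \<eta> j \<omega>)"
      using elim(1) x0 by (intro mesh_error_propagation[OF reg R VK \<omega>]) auto
    moreover have "ennreal \<bar>mesh_value MD b N \<omega> 0 x0 - value_fun M 0 x0\<bar>
        \<le> ennreal \<bar>mesh_value MD b N \<omega> 0 x0 - value_fun MD 0 x0\<bar> + ?v"
      by (simp flip: ennreal_plus add: ennreal_leI)
    ultimately show ?case by (meson add_right_mono order_trans)
  qed
  have "prob_space ?mesh"
    unfolding mesh_law_def reflected_simps by (intro prob_space_PiM trajectories(2)[of x0 b, OF x0 b])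
  then interpret ps: prob_space ?mesh .
  have "(\<integral>\<^sup>+\<omega>. ennreal \<bar>mesh_value MD b N \<omega> 0 x0 - value_fun M 0 x0\<bar> \<partial>?mesh)
    \<le> (\<integral>\<^sup>+\<omega>. (\<Sum>j\<in>{0..<?H}. \<eta> j \<omega>) + ?v \<partial>?mesh)"
    by (rule nn_integral_mono_AE[OF AE])
  also have "\<dots> = (\<Sum>j\<in>{0..<?H}. \<integral>\<^sup>+\<omega>. \<eta> j \<omega> \<partial>?mesh) + ?v"
  proof -
    have "(\<integral>\<^sup>+\<omega>. (\<Sum>j\<in>{0..<?H}. \<eta> j \<omega>) \<partial>?mesh) = (\<Sum>j\<in>{0..<?H}. \<integral>\<^sup>+\<omega>. \<eta> j \<omega> \<partial>?mesh)"
      using \<eta>(1) by (intro nn_integral_sum) auto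
    then show ?thesis
      using \<eta>(1) ps.emeasure_space_1 by (subst nn_integral_add) auto
  qed
  also have "\<dots> \<le> (\<Sum>j\<in>{0..<?H}. ennreal (2 * K / sqrt N) * entropy_term) + ?v"
    using \<eta>(2) by (intro add_right_mono sum_mono) auto
  also have "(\<Sum>j\<in>{0..<?H}. ennreal (2 * K / sqrt N) * entropy_term) = ennreal (real ?H) * ennreal (2 * K / sqrt N) * entropy_term"
    by (simp add: ennreal_of_nat_eq_real_of_nat mult.assoc)
  also have "ennreal (real ?H) * ennreal (2 * K / sqrt N) = ennreal (2 * (real ?H)\<^sup>2 * G / sqrt N)"
    using K by (subst ennreal_mult[symmetric]) (auto simp: K_def power2_eq_square mult_ac)
  finally show ?thesis .
qed

end

text \<open>The constant is \<open>224 = 4 * 4 * 7 / 4 * 2 * 2 * 2\<close>: the maximal inequality,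
  the length of the chaining links, the logarithm of the number of links, the comparison of sum and
  integral, \<open>N / 2 \<le> N - 1\<close>, and self-normalisation. The estimate is not
  asymptotic: \<open>N0 = 1\<close> works, that is, every \<open>N \<ge> 2\<close>.\<close>

theorem theorem3:
  shows "\<exists>C::real. 0 < C \<and>
    (\<forall>(M::mdp) (\<delta>::vec set \<Rightarrow> real) (\<Lambda>::vec set \<Rightarrow> real) (L::vec set \<Rightarrow> real)
        (Lf::vec set \<Rightarrow> vec \<Rightarrow> real) (G::real) (D::vec set) (x0::vec) (b::nat \<Rightarrow> vec).
      is_mdp M \<longrightarrow>
      (\<forall>D'. compact_pos M D' \<longrightarrow> local_bounds M D' (\<delta> D') (\<Lambda> D') (L D') (Lf D')) \<longrightarrow>
      0 < G \<longrightarrow>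
      (\<forall>s\<in>states M. \<forall>a\<in>actions M. \<forall>h<horizon M. max \<bar>reward M h s a\<bar> \<bar>terminal M s\<bar> \<le> G) \<longrightarrow>
      compact_pos M D \<longrightarrow>
      x0 \<in> D \<longrightarrow>
      (\<forall>t<horizon M. b t \<in> actions M) \<longrightarrow>
      regular_mdp M \<longrightarrow> regular_mdp (reflected M D) \<longrightarrow>
      mesh_measurable (reflected M D) b x0 \<longrightarrow>
      (\<exists>N0::nat. \<forall>N>N0.
        (\<integral>\<^sup>+\<omega>. ennreal \<bar>mesh_value (reflected M D) b N \<omega> 0 x0 - value_fun M 0 x0\<bar>
            \<partial>mesh_law (reflected M D) b x0 N)
        \<le> ennreal (C * (real (horizon M))\<^sup>2 * G / sqrt (real N)) *
            ((ennreal (L D) * dudley (D \<times> actions M) (sa_dist M)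
                + ennreal (L D) * mdiam D (edist (sdim M)) * mdiam (actions M) (adist M)
                + ennreal (\<Lambda> D)) / ennreal (\<delta> D)
              + ennreal ((\<Lambda> D)\<^sup>2 / (\<delta> D)\<^sup>2))
          + ennreal (C * real (horizon M) * G) *
              (\<Sum>l\<in>{0..horizon M}. SUP \<pi>\<in>policies M. exit_prob M D \<pi> x0 l)))"
proof (intro exI[of _ "224::real"] exI[of _ "1::nat"] conjI allI impI)
  fix M :: mdp and \<delta> \<Lambda> L :: "vec set \<Rightarrow> real" and Lf :: "vec set \<Rightarrow> vec \<Rightarrow> real" and G :: real
    and D :: "vec set" and x0 :: vec and b :: "nat \<Rightarrow> vec" and N :: nat
  assume M: "is_mdp M"
    and lb: "\<forall>D'. compact_pos M D' \<longrightarrow> local_bounds M D' (\<delta> D') (\<Lambda> D') (L D') (Lf D')"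
    and G: "0 < G" and RF: "\<forall>s\<in>states M. \<forall>a\<in>actions M. \<forall>h<horizon M. max \<bar>reward M h s a\<bar> \<bar>terminal M s\<bar> \<le> G"
    and D: "compact_pos M D" and x0: "x0 \<in> D" and b: "\<forall>t<horizon M. b t \<in> actions M"
    and reg: "regular_mdp M" and regD: "regular_mdp (reflected M D)"
    and N: "1 < N"
  have H: "1 \<le> horizon M" using M by (simp add: is_mdp_def)
  then have ne: "actions M \<noteq> {}" using b by force
  interpret reflection M D "\<delta> D" "\<Lambda> D" "L D" "Lf D"
    using M D lb ne by unfold_locales auto
  let ?dud = "dudley (D \<times> actions M) (sa_dist M)"
  let ?diam = "ennreal (L D) * mdiam D (edist (sdim M)) * mdiam (actions M) (adist M)"
  let ?X = "\<Sum>l\<in>{0..horizon M}. SUP \<pi>\<in>policies M. exit_prob M D \<pi> x0 l"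
  let ?Q = "(ennreal (L D) * ?dud + ?diam + ennreal (\<Lambda> D)) / ennreal (\<delta> D) + ennreal ((\<Lambda> D)\<^sup>2 / (\<delta> D)\<^sup>2)"
  have R: "\<bar>reward M h s a\<bar> \<le> G" if "h < horizon M" "s \<in> states M" "a \<in> actions M" for h s a
    using RF that by fastforce
  have F: "\<bar>terminal M s\<bar> \<le> G" if "s \<in> states M" for s
  proof -
    obtain a where "a \<in> actions M" using ne by blast
    then show ?thesis using RF that H by fastforce
  qed
  show "(\<integral>\<^sup>+\<omega>. ennreal \<bar>mesh_value (reflected M D) b N \<omega> 0 x0 - value_fun M 0 x0\<bar> \<partial>mesh_law (reflected M D) b x0 N)
      \<le> ennreal (224 * (real (horizon M))\<^sup>2 * G / sqrt (real N)) * ?Q + ennreal (224 * real (horizon M) * G) * ?X"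
  \<comment> \<open>An infinite entropy integral makes the right-hand side infinite, because its
    coefficients are strictly positive. The other case is the one chaining covers.\<close>
  proof (cases "?dud = \<infinity>")
    case True
    then have Q: "?Q = \<infinity>" using const_pos by (simp add: ennreal_mult_top ennreal_top_divide)
    have pos: "0 < 224 * (real (horizon M))\<^sup>2 * G / sqrt (real N)" using H G N by simp
    have top: "ennreal c * (\<infinity> :: ennreal) = \<infinity>" if "0 < c" for c
      using that by (simp add: ennreal_mult_top)
    show ?thesis unfolding Q top[OF pos] by simp
  next
    case False
    then obtain dd where dd: "?dud = ennreal dd" "0 \<le> dd" by (cases ?dud) auto
    have fin: "?dud < \<infinity>" using dd by simp
    have \<delta>': "0 < \<delta>'" using \<delta>'_ge const_pos by simp
    have split: "ennreal (u * dd + v) = ennreal u * ?dud + ennreal v" if "0 \<le> u" "0 \<le> v" for u v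
      unfolding dd(1) using that dd(2) by (simp add: ennreal_mult)
    \<comment> \<open>Here \<open>\<delta>'\<close> is replaced by the smaller
      \<open>\<delta> D\<close>, and the coefficients 16 and 8 are raised to 112, so that one
      constant can be factored out.\<close>
    have Q: "ennreal (112 * L D / \<delta>') * ?dud + ennreal (16 * (\<Lambda> D / \<delta> D) + 8 * (\<Lambda> D / \<delta> D)\<^sup>2) \<le> ennreal 112 * ?Q"
    proof -
      have "112 * L D / \<delta>' \<le> 112 * L D / \<delta> D"
        using \<delta>'_ge \<delta>' const_pos by (intro divide_left_mono) auto
      then have "112 * L D / \<delta>' * dd \<le> 112 * L D / \<delta> D * dd" using dd by (intro mult_right_mono)
      moreover have "0 \<le> \<Lambda> D / \<delta> D" "0 \<le> (\<Lambda> D / \<delta> D)\<^sup>2" using const_pos by simp_all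
      moreover have "112 * ((L D * dd + \<Lambda> D) / \<delta> D + (\<Lambda> D)\<^sup>2 / (\<delta> D)\<^sup>2)
          = 112 * L D / \<delta> D * dd + 112 * (\<Lambda> D / \<delta> D) + 112 * (\<Lambda> D / \<delta> D)\<^sup>2"
        by (simp add: add_divide_distrib distrib_left power_divide)
      ultimately have "112 * L D / \<delta>' * dd + (16 * (\<Lambda> D / \<delta> D) + 8 * (\<Lambda> D / \<delta> D)\<^sup>2)
        \<le> 112 * ((L D * dd + \<Lambda> D) / \<delta> D + (\<Lambda> D)\<^sup>2 / (\<delta> D)\<^sup>2)"
        by linarith
      then have "ennreal (112 * L D / \<delta>' * dd + (16 * (\<Lambda> D / \<delta> D) + 8 * (\<Lambda> D / \<delta> D)\<^sup>2))
        \<le> ennreal (112 * ((L D * dd + \<Lambda> D) / \<delta> D + (\<Lambda> D)\<^sup>2 / (\<delta> D)\<^sup>2))"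
        by (rule ennreal_leI)
      also have "\<dots> = ennreal 112 * ((ennreal (L D) * ?dud + ennreal (\<Lambda> D)) / ennreal (\<delta> D) + ennreal ((\<Lambda> D)\<^sup>2 / (\<delta> D)\<^sup>2))"
        using dd const_pos by (simp add: divide_ennreal flip: ennreal_mult ennreal_plus del: ennreal_numeral)
      also have "\<dots> \<le> ennreal 112 * ?Q"
        by (intro mult_left_mono add_right_mono divide_right_mono_ennreal) (auto simp: add_increasing2)
      finally show ?thesis
        using const_pos \<delta>' by (subst split[symmetric]) auto
    qed
    have "(\<integral>\<^sup>+\<omega>. ennreal \<bar>mesh_value MD b N \<omega> 0 x0 - value_fun M 0 x0\<bar> \<partial>mesh_law MD b x0 N)
        \<le> ennreal (2 * (real (horizon M))\<^sup>2 * G / sqrt N) * (ennreal (112 * L D / \<delta>') * ?dud + ennreal (16 * (\<Lambda> D / \<delta> D) + 8 * (\<Lambda> D / \<delta> D)\<^sup>2))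
          + ennreal \<bar>value_fun MD 0 x0 - value_fun M 0 x0\<bar>"
      using R F D_subset b N by (intro mesh_error[OF fin regD G _ _ x0]) auto
    also have "\<dots> \<le> ennreal (2 * (real (horizon M))\<^sup>2 * G / sqrt N) * (ennreal 112 * ?Q) + ennreal (4 * real (horizon M) * G) * ?X"
      by (intro add_mono mult_left_mono Q reflected_value_close[OF reg G R F x0]) auto
    also have "\<dots> \<le> ennreal (224 * (real (horizon M))\<^sup>2 * G / sqrt (real N)) * ?Q + ennreal (224 * real (horizon M) * G) * ?X"
    proof (rule add_mono)
      have "ennreal (2 * (real (horizon M))\<^sup>2 * G / sqrt N) * ennreal 112 = ennreal (224 * (real (horizon M))\<^sup>2 * G / sqrt (real N))"
        using G by (subst ennreal_mult[symmetric]) auto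
      then show "ennreal (2 * (real (horizon M))\<^sup>2 * G / sqrt N) * (ennreal 112 * ?Q) \<le> ennreal (224 * (real (horizon M))\<^sup>2 * G / sqrt (real N)) * ?Q"
        by (simp only: mult.assoc[symmetric] order_refl)
      show "ennreal (4 * real (horizon M) * G) * ?X \<le> ennreal (224 * real (horizon M) * G) * ?X"
        using G by (intro mult_right_mono ennreal_leI) auto
    qed
    finally show ?thesis .
  qed
qed simp

end
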